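(* There exist nodes $\beta_1<\beta_2<\beta_3<\beta_4$ and weights $\theta_1,\theta_2,\theta_3,\theta_4$ with decimal expansions $$\beta_1=-0.86029\ldots,\quad \beta_2=-0.48984\ldots,\quad \beta_3=-0.19572\ldots,\quad \beta_4=0.478545\ldots,$$ $$\theta_1=0.09960\ldots,\quad \theta_2=0.14653\ldots,\quad \theta_3=0.33372\ldots,\quad \theta_4=0.37847\ldots,$$ such that $\{(\beta_i,\theta_i)\}_{i=1}^4$ is a $1/24$-quadrature rule exact for the subspace $$\Lambda_{4,3}:=\mathcal P_5\oplus\mathrm{span}\left(P_8^{(4)},P_9^{(4)}\right),$$ and the following hold. (1) For every absolutely monotone $h$ the Hermite interpolant $f^h\in\Lambda_{4,3}$ with $f^h(\beta_i)=h(\beta_i)$ and $(f^h)'(\beta_i)=h'(\beta_i)$, $i=1,\dots,4$, exists and belongs to $\Lambda_{4,3}\cap A_{4,h}$. Subsequently, $\Lambda_{4,3}$ is a ULB-space for dimension $4$ and cardinality $24$. (2) For every absolutely monotone $h$, the universal lower bound $$\mathcal E_h(4,24)\ge S_5(4,24;h):=24^2\sum_{i=1}^4\theta_ih(\beta_i)$$ holds, and it is an improvement of the first level bound $\mathcal E_h(4,24)\ge R_5(4,24;h)$, i.e. $S_5(4,24;h)>R_5(4,24;h)$. (3) The test functions $Q_j:=\frac1{24}+\sum_{i=1}^4\theta_iP_j^{(4)}(\beta_i)$ are positive for all $j\in\mathbb N\setminus\{1,2,3,4,5,8,9\}$, and therefore $f^h$ is LP-optimal for every absolutely monotone $h$.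
   Context: $\mu$ is the probability measure on $[-1,1]$ with density proportional to $(1-t^2)^{1/2}$ (the case $n=4$ of $(1-t^2)^{(n-3)/2}$). $P_i^{(n)}$ is the Gegenbauer polynomial of degree $i$, orthogonal with respect to the probability measure with density proportional to $(1-t^2)^{(n-3)/2}$ on $[-1,1]$, with $P_i^{(n)}(1)=1$; here $n=4$. For $f=\sum f_iP_i^{(4)}$, $f_0=\int f\,d\mu$. $\mathcal P_m$ is the space of real polynomials of degree at most $m$. A $1/N$-quadrature rule exact for a subspace $\Lambda\subset C[-1,1]$ is a finite sequence of pairs $(\beta_i,\theta_i)_{i=1}^m$ with $-1\le\beta_1<\dots<\beta_m<1$, $\theta_i>0$ and $f_0=\frac{f(1)}N+\sum_{i}\theta_if(\beta_i)$ for all $f\in\Lambda$. A function $h:[-1,1]\to(0,+\infty]$ is absolutely monotone if $h^{(i)}(t)\ge0$ for all $t\in[-1,1)$ and all integers $i\ge0$, and $h(1)=\lim_{t\to1^-}h(t)$. $A_{n,h}$ is the set of continuous $f$ on $[-1,1]$ with $f(t)=\sum_{i\ge0}f_iP_i^{(n)}(t)\le h(t)$ on $[-1,1]$ and $f_i\ge0$ for all $i\ge1$. For a finite set $C\subset\mathbb S^3\subset\mathbb R^4$, $E_h(C)=\sum_{x\ne y\in C}h(\langle x,y\rangle)$ (ordered pairs); $\mathcal E_h(4,24)=\inf\{E_h(C):C\subset\mathbb S^3,\ |C|=24\}$. A subspace $\Lambda\subset C[-1,1]$ is a ULB-space for dimension $n$ and cardinality $N$ if (i) there is a $1/N$-quadrature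 rule exact for $\Lambda$, and (ii) for every absolutely monotone $h$ there is $f\in\Lambda\cap A_{n,h}$ that agrees with $h$ at the nodes of the rule in (i). A polynomial $f\in A_{4,h}$ is LP-optimal (for $(n,N)=(4,24)$ and $h$) if it attains the supremum of $24^2\left(p_0-\frac{p(1)}{24}\right)$ over all real polynomials $p\in A_{4,h}$. First level bound: $R_5(4,24;h):=24^2\sum_{i=1}^3\rho_ih(\alpha_i)$, where $\{(\alpha_i,\rho_i)\}_{i=1}^3$ is the Levenshtein $1/24$-quadrature rule, which has three nodes and is exact for $\mathcal P_5$: $\alpha\approx(-0.817352,-0.257597,0.47495)$, $\rho\approx(0.138436,0.433999,0.385897)$.
   Formalization: The strict inequality S_5 > R_5 is asserted only for absolutely monotone h that are not polynomials of degree at most 5 on [-1,1); for those (e.g. h = 1) both rules are exact and S_5 = R_5, so only S_5 ≥ R_5 is asserted for every h. *)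

theory Defs
  imports "HOL-Analysis.Analysis" "HOL-Computational_Algebra.Polynomial"
begin

definition gegenbauer_weight :: "nat \<Rightarrow> real \<Rightarrow> real" where
  "gegenbauer_weight n t = indicator {-1..1} t * (1 - t\<^sup>2) powr ((real n - 3) / 2)"

definition gegenbauer_measure :: "nat \<Rightarrow> real measure" where
  "gegenbauer_measure n =
     density lborel
       (\<lambda>t. ennreal (gegenbauer_weight n t / (LINT s|lborel. gegenbauer_weight n s)))"

text \<open>The mean is the coefficient \<open>f\<^sub>0\<close> of the Gegenbauer expansion of \<open>f\<close>.\<close>

definition mean :: "nat \<Rightarrow> (real \<Rightarrow> real) \<Rightarrow> real" where
  "mean n f = (LINT t|gegenbauer_measure n. f t)"

definition gegenbauer :: "nat \<Rightarrow> nat \<Rightarrow> real poly" where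
  "gegenbauer n i = (THE p. degree p = i \<and> poly p 1 = 1 \<and>
     (\<forall>q. degree q < i \<longrightarrow> mean n (\<lambda>t. poly p t * poly q t) = 0))"

text \<open>A function on \<open>[-1,1]\<close> is a function on the reals whose values outside
  \<open>[-1,1]\<close> are irrelevant.  In the next definition \<open>D i\<close> is the \<open>i\<close>-th derivative
  of \<open>h\<close> on \<open>[-1,1)\<close>, one-sided at \<open>-1\<close>; only the value \<open>h 1\<close> can be infinite.\<close>

definition absolutely_monotone :: "(real \<Rightarrow> ereal) \<Rightarrow> bool" where
  "absolutely_monotone h \<longleftrightarrow>
     (\<forall>t\<in>{-1..1}. 0 < h t) \<and>
     (\<exists>D :: nat \<Rightarrow> real \<Rightarrow> real.
        (\<forall>t\<in>{-1..<1}. h t = ereal (D 0 t)) \<and>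
        (\<forall>i. \<forall>t\<in>{-1..<1}. (D i has_real_derivative D (Suc i) t) (at t within {-1..<1})) \<and>
        (\<forall>i. \<forall>t\<in>{-1..<1}. 0 \<le> D i t)) \<and>
     (h \<longlongrightarrow> h 1) (at_left 1)"

text \<open>The class \<open>A\<^bsub>n,h\<^esub>\<close>.  The coefficient \<open>c 0\<close> may have any sign.  As the
  \<open>c i\<close> with \<open>i \<ge> 1\<close> are nonnegative, convergence at \<open>1\<close> makes the series absolutely
  and uniformly convergent, so \<open>c\<close> is unique and \<open>c 0 = mean n f\<close>.\<close>

definition A_class :: "nat \<Rightarrow> (real \<Rightarrow> ereal) \<Rightarrow> (real \<Rightarrow> real) set" where
  "A_class n h = {f. continuous_on {-1..1} f \<and>
     (\<exists>c :: nat \<Rightarrow> real. (\<forall>i\<ge>1. 0 \<le> c i) \<and>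
        (\<forall>t\<in>{-1..1}. (\<lambda>i. c i * poly (gegenbauer n i) t) sums f t)) \<and>
     (\<forall>t\<in>{-1..1}. ereal (f t) \<le> h t)}"

text \<open>Nodes and weights are indexed by \<open>1, \<dots>, m\<close>.\<close>

definition quadrature_rule ::
  "nat \<Rightarrow> nat \<Rightarrow> (real \<Rightarrow> real) set \<Rightarrow> nat \<Rightarrow> (nat \<Rightarrow> real) \<Rightarrow> (nat \<Rightarrow> real) \<Rightarrow> bool" where
  "quadrature_rule n N \<Lambda> m \<beta> \<theta> \<longleftrightarrow>
     strict_mono_on {1..m} \<beta> \<and>
     (\<forall>i\<in>{1..m}. -1 \<le> \<beta> i \<and> \<beta> i < 1 \<and> 0 < \<theta> i) \<and>
     (\<forall>f\<in>\<Lambda>. mean n f = f 1 / real N + (\<Sum>i=1..m. \<theta> i * f (\<beta> i)))"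

definition continuous_subspace :: "(real \<Rightarrow> real) set \<Rightarrow> bool" where
  "continuous_subspace \<Lambda> \<longleftrightarrow>
     (\<forall>f\<in>\<Lambda>. continuous_on {-1..1} f) \<and>
     (\<lambda>t. 0) \<in> \<Lambda> \<and>
     (\<forall>f\<in>\<Lambda>. \<forall>g\<in>\<Lambda>. (\<lambda>t. f t + g t) \<in> \<Lambda>) \<and>
     (\<forall>a. \<forall>f\<in>\<Lambda>. (\<lambda>t. a * f t) \<in> \<Lambda>)"

definition ULB_space :: "nat \<Rightarrow> nat \<Rightarrow> (real \<Rightarrow> real) set \<Rightarrow> bool" where
  "ULB_space n N \<Lambda> \<longleftrightarrow> continuous_subspace \<Lambda> \<and>
     (\<exists>m \<beta> \<theta>. quadrature_rule n N \<Lambda> m \<beta> \<theta> \<and>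
        (\<forall>h. absolutely_monotone h \<longrightarrow>
           (\<exists>f\<in>\<Lambda> \<inter> A_class n h. \<forall>i\<in>{1..m}. ereal (f (\<beta> i)) = h (\<beta> i))))"

definition energy :: "(real \<Rightarrow> ereal) \<Rightarrow> 'a::real_inner set \<Rightarrow> ereal" where
  "energy h C = (\<Sum>(x, y)\<in>{(x, y). x \<in> C \<and> y \<in> C \<and> x \<noteq> y}. h (x \<bullet> y))"

text \<open>The minimal energy of \<open>N\<close> points on the sphere in four-dimensional space.\<close>

definition min_energy4 :: "(real \<Rightarrow> ereal) \<Rightarrow> nat \<Rightarrow> ereal" where
  "min_energy4 h N =
     (INF C\<in>{C :: (real ^ 4) set. C \<subseteq> sphere 0 1 \<and> finite C \<and> card C = N}. energy h C)"

text \<open>The first level bound \<open>R\<^sub>5\<close> and the bound \<open>S\<^sub>5\<close> are both of this form.\<close>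

definition quadrature_bound ::
  "nat \<Rightarrow> nat \<Rightarrow> (nat \<Rightarrow> real) \<Rightarrow> (nat \<Rightarrow> real) \<Rightarrow> (real \<Rightarrow> ereal) \<Rightarrow> ereal" where
  "quadrature_bound N m \<beta> \<theta> h =
     ereal ((real N)\<^sup>2) * (\<Sum>i=1..m. ereal (\<theta> i) * h (\<beta> i))"

definition LP_optimal :: "nat \<Rightarrow> nat \<Rightarrow> (real \<Rightarrow> ereal) \<Rightarrow> real poly \<Rightarrow> bool" where
  "LP_optimal n N h f \<longleftrightarrow>
     is_arg_max (\<lambda>p. (real N)\<^sup>2 * (mean n (poly p) - poly p 1 / real N))
       (\<lambda>p. poly p \<in> A_class n h) f"

definition test_function ::
  "nat \<Rightarrow> nat \<Rightarrow> nat \<Rightarrow> (nat \<Rightarrow> real) \<Rightarrow> (nat \<Rightarrow> real) \<Rightarrow> nat \<Rightarrow> real" where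
  "test_function n N m \<beta> \<theta> j =
     1 / real N + (\<Sum>i=1..m. \<theta> i * poly (gegenbauer n j) (\<beta> i))"

definition polys_upto :: "nat \<Rightarrow> real poly set" where
  "polys_upto m = {p. degree p \<le> m}"

definition Lambda43 :: "real poly set" where
  "Lambda43 = {p + (smult a (gegenbauer 4 8) + smult b (gegenbauer 4 9)) | p a b.
     p \<in> polys_upto 5}"

text \<open>To be used with nodes in \<open>(-1,1)\<close> only, where \<open>deriv\<close> of the real part of \<open>h\<close>
  is the derivative of \<open>h\<close>.\<close>

definition hermite_interpolant ::
  "real poly set \<Rightarrow> nat \<Rightarrow> (nat \<Rightarrow> real) \<Rightarrow> (real \<Rightarrow> ereal) \<Rightarrow> real poly \<Rightarrow> bool" where
  "hermite_interpolant \<Lambda> m \<beta> h f \<longleftrightarrow> f \<in> \<Lambda> \<and>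
     (\<forall>i\<in>{1..m}. ereal (poly f (\<beta> i)) = h (\<beta> i) \<and>
        poly (pderiv f) (\<beta> i) = deriv (\<lambda>t. real_of_ereal (h t)) (\<beta> i))"

end

theory Submission
  imports Defs
begin

text \<open>In dimension 4 the Gegenbauer polynomials are the normalised Chebyshev polynomials of the
  second kind.  The nodes \<open>\<beta>\<^sub>i\<close> are the roots of a quartic \<open>w\<close>; exactness on \<open>\<P>\<^sub>5\<close> leaves two
  free coefficients of \<open>w\<close>, and exactness in degrees 8 and 9 is a pair of cubic equations for
  them, solved by Brouwer's theorem in a tiny box.

  For absolutely monotone \<open>h\<close> the quotient \<open>(h t - h a) / (t - a)\<close> is again absolutely monotone,
  so repeated deflation at \<open>\<beta>\<^sub>1, \<beta>\<^sub>1, \<dots>, \<beta>\<^sub>4, \<beta>\<^sub>4\<close> writes \<open>h\<close> as a nonnegative combination of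
  the Newton polynomials of degrees below 8 plus a nonnegative multiple of \<open>w\<^sup>2\<close>.  Those of degrees
  6 and 7 are moved into \<open>\<Lambda>\<^sub>4\<^sub>,\<^sub>3\<close> by subtracting \<open>w\<^sup>2\<close> times a linear polynomial that is
  nonnegative on \<open>[-1, 1]\<close>; the results still have nonnegative Gegenbauer coefficients.

  On the sphere, \<open>U\<^sub>n (x \<bullet> y)\<close> is the average over complex structures \<open>J\<close> on \<open>\<real>\<^sup>4\<close> of the \<open>n\<close>-th
  powers of the Hermitian products of \<open>x\<close> and \<open>y\<close>, hence positive definite.  For \<open>n \<le> 9\<close> a finite
  spherical design suffices for the averaging.\<close>

section \<open>Chebyshev polynomials of the second kind\<close>

text \<open>A rule with four free nodes and four weights has eight unknowns, and
  \<open>Lambda43\<close> has dimension 8, so the nodes are isolated solutions of equations and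
  known only approximately. Exact facts (Vieta's relations, \<open>eqn8\<close>,
  \<open>eqn9\<close>) are therefore kept apart from inequalities, which have enough slack for
  rational ball arithmetic. The space has as many dimensions as there are Hermite conditions, but it
  omits degrees 6 and 7, so unique solvability is not automatic: it rests on a 2 by 2 determinant
  made of the Chebyshev coefficients 6 and 7 of \<open>w * w\<close> and \<open>t * w * w\<close>.

  Deflation leaves a remainder that is again absolutely monotone up to vanishing values. This one
  fact gives the sign of the error, its smoothness at the nodes and, since such a function is zero
  once it vanishes at an interior point, the strict comparison with the first level bound.

  LP optimality involves infinitely many test functions. From degree 27 on the contribution of the
  node 1 outweighs a bound for the others that is uniform in the degree; smaller degrees are settled
  in integer arithmetic.\<close>

definition wgt :: "real \<Rightarrow> real" where "wgt t = sqrt (1 - t\<^sup>2)"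

lemma continuous_on_wgt_poly: "continuous_on S (\<lambda>t. wgt t * poly p t)"
  unfolding wgt_def by (intro continuous_intros)

lemma gegenbauer_weight_4: "gegenbauer_weight 4 t = indicator {-1..1} t * wgt t"
proof (cases "t \<in> {-1..1}")
  case True
  then have "t\<^sup>2 \<le> 1" by (simp add: abs_square_le_1 abs_le_iff)
  then show ?thesis by (simp add: gegenbauer_weight_def wgt_def powr_half_sqrt)
qed (simp add: gegenbauer_weight_def)

lemma set_integrable_wgt_poly: "set_integrable lborel {-1..1} (\<lambda>t. wgt t * poly p t)"
  using borel_integrable_atLeastAtMost'[OF continuous_on_wgt_poly] .

lemma LINT_wgt_poly:
  "(LINT t|lborel. gegenbauer_weight 4 t * poly p t) = integral {-1..1} (\<lambda>t. wgt t * poly p t)"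
  using set_borel_integral_eq_integral(2)[OF set_integrable_wgt_poly[of p]]
  by (simp add: set_lebesgue_integral_def gegenbauer_weight_4 mult.assoc)

lemma integral_wgt_pos: "0 < integral {-1..1} wgt"
proof -
  have "((\<lambda>t::real. 1 - t\<^sup>2) has_integral ((1 - 1^3/3) - ((-1) - (-1)^3/3))) {-1..1}"
    by (intro fundamental_theorem_of_calculus)
      (auto intro!: derivative_eq_intros simp flip: has_real_derivative_iff_has_vector_derivative)
  then have i1: "((\<lambda>t::real. 1 - t\<^sup>2) has_integral 4/3) {-1..1}" by simp
  have i2: "(wgt has_integral integral {-1..1} wgt) {-1..1}"
    using continuous_on_wgt_poly[of "{-1..1}" 1]
    by (intro integrable_integral integrable_continuous_interval) simp
  have "4/3 \<le> integral {-1..1} wgt"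
  proof (rule has_integral_le[OF i1 i2])
    fix t :: real assume "t \<in> {-1..1}"
    then have "0 \<le> 1 - t\<^sup>2" "1 - t\<^sup>2 \<le> 1" by (simp_all add: abs_square_le_1 abs_le_iff)
    then have "(1 - t\<^sup>2)\<^sup>2 \<le> 1 - t\<^sup>2" by (simp add: power2_eq_square mult_left_le)
    then show "1 - t\<^sup>2 \<le> wgt t" by (simp add: wgt_def real_le_rsqrt)
  qed
  then show ?thesis by simp
qed

lemma mean_4_eq:
  assumes [measurable]: "f \<in> borel_measurable borel"
  shows "mean 4 f = (LINT t|lborel. gegenbauer_weight 4 t * f t) / integral {-1..1} wgt"
proof -
  have Z: "(LINT s|lborel. gegenbauer_weight 4 s) = integral {-1..1} wgt"
    using LINT_wgt_poly[of 1] by simp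
  have m [measurable]: "gegenbauer_weight 4 \<in> borel_measurable borel"
    unfolding gegenbauer_weight_def by measurable
  have "0 \<le> gegenbauer_weight 4 t" for t by (simp add: gegenbauer_weight_def)
  then have "mean 4 f = (LINT t|lborel. (gegenbauer_weight 4 t / integral {-1..1} wgt) *\<^sub>R f t)"
    unfolding mean_def gegenbauer_measure_def Z
    using integral_wgt_pos by (intro integral_density) auto
  also have "\<dots> = (LINT t|lborel. (gegenbauer_weight 4 t * f t) / integral {-1..1} wgt)"
    by (intro Bochner_Integration.integral_cong) auto
  finally show ?thesis by simp
qed

section \<open>The mean as a linear functional on polynomials\<close>

definition pmean :: "real poly \<Rightarrow> real" where "pmean p = mean 4 (poly p)"

lemma mean_4_poly_mult: "mean 4 (\<lambda>t. poly p t * poly q t) = pmean (p * q)"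
  unfolding pmean_def by (rule arg_cong[of _ _ "mean 4"]) (simp add: fun_eq_iff)

lemma pmean_eq: "pmean p = integral {-1..1} (\<lambda>t. wgt t * poly p t) / integral {-1..1} wgt"
proof -
  have "poly p \<in> borel_measurable borel"
    by (intro borel_measurable_continuous_onI continuous_intros)
  then show ?thesis by (simp add: pmean_def mean_4_eq LINT_wgt_poly)
qed

lemma wgt_poly_integrable: "(\<lambda>t. wgt t * poly p t) integrable_on {-1..1}"
  by (intro integrable_continuous_interval continuous_on_wgt_poly)

lemma pmean_add: "pmean (p + q) = pmean p + pmean q"
  using Henstock_Kurzweil_Integration.integral_add[OF wgt_poly_integrable[of p] wgt_poly_integrable[of q]]
  by (simp add: pmean_eq distrib_left add_divide_distrib)

lemma pmean_smult: "pmean (smult c p) = c * pmean p"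
  using Henstock_Kurzweil_Integration.integral_mult_right[of "{-1..1}" c "\<lambda>t. wgt t * poly p t"]
  by (simp add: pmean_eq mult.left_commute)

lemma pmean_0 [simp]: "pmean 0 = 0" using pmean_smult[of 0 0] by simp
lemma pmean_1 [simp]: "pmean 1 = 1" using integral_wgt_pos by (simp add: pmean_eq)

lemma pmean_minus: "pmean (- p) = - pmean p" using pmean_smult[of "-1" p] by simp

lemma pmean_diff: "pmean (p - q) = pmean p - pmean q"
  using pmean_add[of p "- q"] by (simp add: pmean_minus)

lemma pmean_sum: "pmean (sum f A) = (\<Sum>i\<in>A. pmean (f i))"
  by (induction A rule: infinite_finite_induct) (simp_all add: pmean_add)

text \<open>The difference of the two integrands is the derivative of \<open>(1 - t\<^sup>2) powr (3/2) * p t\<close>.\<close>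

lemma pmean_parts: "pmean ([:1, 0, -1:] * pderiv p) = pmean ([:0, 3:] * p)"
proof -
  define r where "r = [:1, 0, -1:] * pderiv p - [:0, 3:] * p"
  have "((\<lambda>t. wgt t * poly r t) has_integral
      ((1 - 1\<^sup>2) * (wgt 1 * poly p 1) - (1 - (-1)\<^sup>2) * (wgt (-1) * poly p (-1)))) {-1..1}"
  proof (rule fundamental_theorem_of_calculus_interior)
    show "continuous_on {-1..1} (\<lambda>t. (1 - t\<^sup>2) * (wgt t * poly p t))"
      by (intro continuous_on_mult continuous_on_wgt_poly) (intro continuous_intros)
    fix t :: real assume t: "t \<in> {-1<..<1}"
    then have t1: "0 < 1 - t\<^sup>2" by (simp add: abs_square_less_1 abs_if)
    have w: "(1 - t\<^sup>2) * inverse (wgt t) = wgt t"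
      using t1 by (simp add: wgt_def inverse_eq_divide real_div_sqrt)
    have dw: "(wgt has_real_derivative (- t * inverse (wgt t))) (at t)"
      unfolding wgt_def using t1
      by (auto intro!: derivative_eq_intros simp: field_simps)
    have "((\<lambda>t. (1 - t\<^sup>2) * (wgt t * poly p t)) has_real_derivative
        (- 2 * t) * (wgt t * poly p t) + (1 - t\<^sup>2) * (- t * inverse (wgt t) * poly p t + wgt t * poly (pderiv p) t)) (at t)"
      by (auto intro!: derivative_eq_intros dw simp: algebra_simps)
    also have "(- 2 * t) * (wgt t * poly p t) + (1 - t\<^sup>2) * (- t * inverse (wgt t) * poly p t + wgt t * poly (pderiv p) t)
      = (- 2 * t) * (wgt t * poly p t) + (((1 - t\<^sup>2) * inverse (wgt t)) * (- t * poly p t) + (1 - t\<^sup>2) * wgt t * poly (pderiv p) t)"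
      by (simp add: algebra_simps)
    also have "\<dots> = wgt t * poly r t"
      unfolding w r_def by (simp add: algebra_simps power2_eq_square)
    finally show "((\<lambda>t. (1 - t\<^sup>2) * (wgt t * poly p t)) has_vector_derivative wgt t * poly r t) (at t)"
      by (simp add: has_real_derivative_iff_has_vector_derivative)
  qed simp
  then have "pmean r = 0" by (simp add: pmean_eq integral_unique)
  then show ?thesis by (simp add: r_def pmean_diff)
qed

fun cheb :: "nat \<Rightarrow> real poly" where
  "cheb 0 = 1"
| "cheb (Suc 0) = [:0, 2:]"
| "cheb (Suc (Suc n)) = [:0, 2:] * cheb (Suc n) - cheb n"

text \<open>\<open>cheb (n - 1)\<close> with the convention \<open>cheb (-1) = 0\<close>.\<close>

definition cheb' :: "nat \<Rightarrow> real poly" where "cheb' n = (if n = 0 then 0 else cheb (n - 1))"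

lemma cheb'_simps [simp]: "cheb' 0 = 0" "cheb' (Suc n) = cheb n" by (simp_all add: cheb'_def)

lemma X_mult_cheb: "[:0, 1:] * cheb n = smult (1/2) (cheb (Suc n) + cheb' n)"
  by (cases n) (simp_all add: smult_diff_right)

lemma degree_cheb [simp]: "degree (cheb n) = n" and coeff_cheb_self: "coeff (cheb n) n = 2 ^ n"
proof -
  have "degree (cheb n) = n \<and> coeff (cheb n) n = 2 ^ n"
  proof (induction n rule: cheb.induct)
    case (3 n)
    have "degree ([:0, 2:] * cheb (Suc n)) = Suc (Suc n)"
      using 3(1) by (subst degree_mult_eq) auto
    then have "degree (cheb (Suc (Suc n))) = Suc (Suc n)"
      using 3(2) degree_add_eq_left[of "- cheb n" "[:0, 2:] * cheb (Suc n)"] by simp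
    moreover have "coeff (cheb n) (Suc (Suc n)) = 0" using 3(2) by (simp add: coeff_eq_0)
    ultimately show ?case using 3 by simp
  qed simp_all
  then show "degree (cheb n) = n" "coeff (cheb n) n = 2 ^ n" by auto
qed

lemma cheb_nonzero [simp]: "cheb n \<noteq> 0"
  using coeff_cheb_self[of n] by force

lemma poly_cheb_1: "poly (cheb n) 1 = real n + 1"
  by (induction n rule: cheb.induct) auto

lemma poly_cheb_minus: "poly (cheb n) (- t) = (-1) ^ n * poly (cheb n) t"
  by (induction n rule: cheb.induct) (auto simp: algebra_simps)

lemma poly_cheb_cos: "poly (cheb n) (cos x) * sin x = sin (real (Suc n) * x)"
proof (induction n rule: cheb.induct)
  case 2 show ?case by (simp add: sin_double)
next
  case (3 n)
  have "sin (real (Suc (Suc (Suc n))) * x) + sin (real (Suc n) * x) = 2 * cos x * sin (real (Suc (Suc n)) * x)"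
  proof -
    have e: "real (Suc (Suc (Suc n))) * x = real (Suc (Suc n)) * x + x"
      "real (Suc n) * x = real (Suc (Suc n)) * x - x" by (simp_all add: algebra_simps)
    show ?thesis unfolding e sin_add sin_diff by simp
  qed
  then show ?case using 3 by (simp add: algebra_simps)
qed simp

text \<open>Substituted into \<open>pmean_parts\<close> with \<open>p = cheb n\<close>, this turns
  integration by parts into a recurrence for the means of the Chebyshev polynomials.\<close>

lemma cheb_pderiv: "[:1, 0, -1:] * pderiv (cheb n) = smult (real n + 1) (cheb' n) - smult (real n) ([:0, 1:] * cheb n)"
proof (induction n rule: cheb.induct)
  case 1 show ?case by simp
next
  case 2 show ?case by (simp add: pderiv_pCons)
next
  case (3 n)
  have "poly ([:1, 0, -1:] * pderiv (cheb (Suc (Suc n)))) t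
     = poly (smult (real (Suc (Suc n)) + 1) (cheb' (Suc (Suc n))) - smult (real (Suc (Suc n))) ([:0, 1:] * cheb (Suc (Suc n)))) t" for t
  proof -
    have a: "(1 - t*t) * poly (pderiv (cheb (Suc n))) t = (real n + 2) * poly (cheb n) t - (real n + 1) * t * poly (cheb (Suc n)) t"
      using arg_cong[OF 3(1), of "\<lambda>p. poly p t"] by (simp add: algebra_simps)
    have b: "(1 - t*t) * poly (pderiv (cheb n)) t = (real n + 1) * poly (cheb' n) t - real n * t * poly (cheb n) t"
      using arg_cong[OF 3(2), of "\<lambda>p. poly p t"] by (simp add: algebra_simps)
    have c: "poly (cheb' n) t = 2 * t * poly (cheb n) t - poly (cheb (Suc n)) t"
      by (cases n) simp_all
    have "(1 - t*t) * poly (pderiv (cheb (Suc (Suc n)))) t = (1 - t*t) * 2 * poly (cheb (Suc n)) t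
       + 2 * t * ((1 - t*t) * poly (pderiv (cheb (Suc n))) t) - (1 - t*t) * poly (pderiv (cheb n)) t"
      by (simp add: pderiv_mult pderiv_diff pderiv_pCons pderiv_smult algebra_simps)
    also have "\<dots> = (real n + 3) * poly (cheb (Suc n)) t - (real n + 2) * t * poly (cheb (Suc (Suc n))) t"
      unfolding a b c by (simp add: algebra_simps)
    finally show ?thesis by (simp add: algebra_simps)
  qed
  then show ?case by (rule poly_ext)
qed

lemma pmean_cheb: "pmean (cheb n) = (if n = 0 then 1 else 0)"
proof (induction n rule: cheb.induct)
  case 2
  then show ?case using pmean_parts[of 1] pmean_smult[of "2/3" "[:0,3:]"] by simp
next
  case (3 n)
  define m where "m = Suc n"
  define y where "y = pmean ([:0, 1:] * cheb m)"
  have y: "y = (pmean (cheb (Suc m)) + pmean (cheb n)) / 2"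
    unfolding y_def X_mult_cheb by (simp only: pmean_smult pmean_add m_def cheb'_simps)
  have "pmean (smult (real m + 1) (cheb' m) - smult (real m) ([:0, 1:] * cheb m)) = pmean (smult 3 ([:0, 1:] * cheb m))"
    using pmean_parts[of "cheb m"] unfolding cheb_pderiv by simp
  \<comment> \<open>As \<open>y\<close> is also half the sum of the two neighbouring means, it can
    be eliminated. The factor \<open>m - 1\<close> that remains vanishes exactly when
    \<open>n = 0\<close>, the one case in which \<open>cheb n\<close> has nonzero mean.\<close>
  then have "(real m + 1) * pmean (cheb n) - real m * y = 3 * y"
    unfolding pmean_diff pmean_smult y_def[symmetric] by (simp add: m_def)
  then have "(real m + 3) * pmean (cheb (Suc m)) = (real m - 1) * pmean (cheb n)"
    unfolding y by (simp add: field_simps)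
  moreover have "(real m - 1) * pmean (cheb n) = 0"
    using 3 by (cases "n = 0") (auto simp: m_def)
  ultimately show ?case by (auto simp: m_def)
qed simp

text \<open>The coefficient of \<open>cheb i\<close> in \<open>t ^ k\<close>: multiplication by
  \<open>t\<close> sends \<open>cheb i\<close> to half the sum of its neighbours, so
  \<open>2 ^ k * cmom k i\<close> counts the \<open>k\<close>-step paths from 0 to \<open>i\<close>
  on the nonnegative integers.\<close>

fun cmom :: "nat \<Rightarrow> nat \<Rightarrow> real" where
  "cmom 0 i = (if i = 0 then 1 else 0)"
| "cmom (Suc k) 0 = cmom k (Suc 0) / 2"
| "cmom (Suc k) (Suc i) = (cmom k (Suc (Suc i)) + cmom k i) / 2"

text \<open>The coefficient of \<open>cheb i\<close> in the Chebyshev expansion of \<open>p\<close>.\<close>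

definition ccoef :: "real poly \<Rightarrow> nat \<Rightarrow> real" where "ccoef p i = pmean (p * cheb i)"

lemma ccoef_linear [simp]:
  "ccoef (p + q) i = ccoef p i + ccoef q i" "ccoef (p - q) i = ccoef p i - ccoef q i"
  "ccoef (smult c p) i = c * ccoef p i" "ccoef 0 i = 0"
  by (simp_all add: ccoef_def distrib_right left_diff_distrib pmean_add pmean_diff pmean_smult)

lemma ccoef_sum: "ccoef (sum f A) i = (\<Sum>j\<in>A. ccoef (f j) i)"
  by (simp add: ccoef_def sum_distrib_right pmean_sum)

lemma ccoef_1: "ccoef 1 i = (if i = 0 then 1 else 0)"
  by (simp add: ccoef_def pmean_cheb)

lemma ccoef_0_right: "ccoef p 0 = pmean p" by (simp add: ccoef_def)

text \<open>Multiplication by \<open>t\<close> is self-adjoint for the mean, so it can be moved onto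
  \<open>cheb i\<close> and expanded by the three-term recurrence.\<close>

lemma ccoef_X_mult:
  "ccoef ([:0, 1:] * p) 0 = ccoef p (Suc 0) / 2"
  "ccoef ([:0, 1:] * p) (Suc i) = (ccoef p (Suc (Suc i)) + ccoef p i) / 2"
proof -
  have "ccoef ([:0, 1:] * p) j = pmean (p * smult (1/2) (cheb (Suc j) + cheb' j))" for j
  proof -
    have "[:0, 1:] * p * cheb j = p * ([:0, 1:] * cheb j)"
      by (metis mult.assoc mult.commute)
    then show ?thesis by (simp only: ccoef_def X_mult_cheb)
  qed
  then have *: "ccoef ([:0, 1:] * p) j = (ccoef p (Suc j) + pmean (p * cheb' j)) / 2" for j
    by (simp add: ccoef_def distrib_left pmean_add pmean_smult del: cheb.simps)
  show "ccoef ([:0, 1:] * p) 0 = ccoef p (Suc 0) / 2" using *[of 0] by simp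
  show "ccoef ([:0, 1:] * p) (Suc i) = (ccoef p (Suc (Suc i)) + ccoef p i) / 2"
    using *[of "Suc i"] by (simp add: ccoef_def)
qed

lemma ccoef_monom: "ccoef (monom 1 k) i = cmom k i"
proof (induction k i rule: cmom.induct)
  case (1 i) then show ?case by (simp add: ccoef_1)
next
  case (2 k) then show ?case using ccoef_X_mult(1)[of "monom 1 k"] by (simp add: monom_Suc)
next
  case (3 k i) then show ?case using ccoef_X_mult(2)[of "monom 1 k" i] by (simp add: monom_Suc)
qed

lemma cmom_eq_0: "k < i \<Longrightarrow> cmom k i = 0"
  by (induction k i rule: cmom.induct) auto

lemma cmom_self: "cmom k k = 1 / 2 ^ k"
  by (induction k) (auto simp: cmom_eq_0)

lemma ccoef_eq_sum_monom: "degree p \<le> n \<Longrightarrow> ccoef p i = (\<Sum>k\<le>n. coeff p k * cmom k i)"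
proof -
  assume "degree p \<le> n"
  then have "p = (\<Sum>k\<le>n. smult (coeff p k) (monom 1 k))"
    using poly_as_sum_of_monoms'[of p n] by (simp add: smult_monom)
  then have "ccoef p i = ccoef (\<Sum>k\<le>n. smult (coeff p k) (monom 1 k)) i" by simp
  then show ?thesis by (simp add: ccoef_sum ccoef_monom)
qed

lemma ccoef_eq_0: "degree p < i \<Longrightarrow> ccoef p i = 0"
  by (subst ccoef_eq_sum_monom[OF order_refl]) (auto intro!: sum.neutral simp: cmom_eq_0)

lemma ccoef_degree: "ccoef p (degree p) = lead_coeff p / 2 ^ degree p"
proof -
  have "ccoef p (degree p) = (\<Sum>k\<in>{degree p}. coeff p k * cmom k (degree p))"
    unfolding ccoef_eq_sum_monom[OF order_refl]
    by (intro sum.mono_neutral_right) (auto simp: cmom_eq_0)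
  then show ?thesis by (simp add: cmom_self)
qed

lemma ccoef_cheb: "ccoef (cheb n) i = (if i = n then 1 else 0)"
proof (cases i n rule: linorder_cases)
  case less
  have "ccoef (cheb n) i = ccoef (cheb i) n" by (simp add: ccoef_def mult.commute)
  then show ?thesis using less by (simp add: ccoef_eq_0)
next
  case equal
  then show ?thesis using ccoef_degree[of "cheb n"] by (simp add: coeff_cheb_self)
qed (simp add: ccoef_eq_0)

lemma poly_eq_0_if_ccoef_eq_0: "(\<And>i. ccoef p i = 0) \<Longrightarrow> p = 0"
  using ccoef_degree[of p] by simp

lemma cheb_expansion: "degree p \<le> n \<Longrightarrow> p = (\<Sum>i\<le>n. smult (ccoef p i) (cheb i))"
proof -
  assume n: "degree p \<le> n"
  have "ccoef (p - (\<Sum>i\<le>n. smult (ccoef p i) (cheb i))) j = 0" for j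
    using n by (auto simp: ccoef_sum ccoef_cheb ccoef_eq_0 if_distrib[of "(*) _"] cong: if_cong)
  then show ?thesis by (simp only: eq_iff_diff_eq_0[of p] poly_eq_0_if_ccoef_eq_0)
qed

text \<open>Orthogonality to all lower degrees leaves a candidate only its top Chebyshev
  coefficient, which the value 1 at 1 then fixes.\<close>

lemma gegenbauer_4: "gegenbauer 4 n = smult (1 / (real n + 1)) (cheb n)"
  unfolding gegenbauer_def
proof (rule the_equality)
  have "mean 4 (\<lambda>t. poly (smult (1 / (real n + 1)) (cheb n)) t * poly q t) = 0" if "degree q < n" for q
  proof -
    have "mean 4 (\<lambda>t. poly (smult (1 / (real n + 1)) (cheb n)) t * poly q t)
        = pmean (smult (1 / (real n + 1)) (cheb n) * q)"
      by (rule mean_4_poly_mult)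
    also have "\<dots> = ccoef q n / (real n + 1)"
      by (simp add: ccoef_def pmean_smult mult.commute)
    finally show ?thesis using ccoef_eq_0[OF that] by simp
  qed
  then show "degree (smult (1 / (real n + 1)) (cheb n)) = n \<and> poly (smult (1 / (real n + 1)) (cheb n)) 1 = 1 \<and>
    (\<forall>q. degree q < n \<longrightarrow> mean 4 (\<lambda>t. poly (smult (1 / (real n + 1)) (cheb n)) t * poly q t) = 0)"
    by (simp add: poly_cheb_1)
next
  fix p :: "real poly"
  assume p: "degree p = n \<and> poly p 1 = 1 \<and>
    (\<forall>q. degree q < n \<longrightarrow> mean 4 (\<lambda>t. poly p t * poly q t) = 0)"
  have "ccoef p i = 0" if "i < n" for i
    using p[THEN conjunct2, THEN conjunct2, rule_format, of "cheb i"] that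
    by (simp add: ccoef_def mean_4_poly_mult)
  then have "(\<Sum>i\<le>n. smult (ccoef p i) (cheb i)) = (\<Sum>i\<in>{n}. smult (ccoef p i) (cheb i))"
    by (intro sum.mono_neutral_right) auto
  then have e: "p = smult (ccoef p n) (cheb n)" using cheb_expansion[of p n] p by simp
  have "ccoef p n * (real n + 1) = 1"
    using p by (subst (asm) e) (simp add: poly_cheb_1)
  then have "ccoef p n = 1 / (real n + 1)" by (simp add: field_simps)
  then show "p = smult (1 / (real n + 1)) (cheb n)" using e by simp
qed

lemma poly_gegenbauer_4: "poly (gegenbauer 4 n) t = poly (cheb n) t / (real n + 1)"
  by (simp add: gegenbauer_4)

section \<open>Bounds for Chebyshev and Gegenbauer polynomials on [-1, 1]\<close>

lemma abs_sin_mult_le: "\<bar>sin (real n * x)\<bar> \<le> real n * \<bar>sin x\<bar>"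
proof (induction n)
  case (Suc n)
  have "sin (real (Suc n) * x) = sin (real n * x) * cos x + cos (real n * x) * sin x"
    by (simp add: distrib_right sin_add add.commute)
  also have "\<bar>\<dots>\<bar> \<le> \<bar>sin (real n * x)\<bar> * 1 + 1 * \<bar>sin x\<bar>"
    by (intro order.trans[OF abs_triangle_ineq] add_mono) (auto simp: abs_mult intro!: mult_left_le mult_left_le_one_le)
  finally show ?case using Suc by (simp add: algebra_simps)
qed simp

lemma abs_cheb_le:
  assumes "t \<in> {-1..1}" shows "\<bar>poly (cheb n) t\<bar> \<le> real n + 1"
proof (cases "t = 1 \<or> t = -1")
  case True
  then show ?thesis using poly_cheb_minus[of n 1] by (auto simp: poly_cheb_1 abs_mult)
next
  case False
  define x where "x = arccos t"
  have t: "cos x = t" using assms by (simp add: x_def)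
  have "0 < sin x" using sin_gt_zero arccos_lt_bounded[of t] assms False by (auto simp: x_def)
  moreover have "\<bar>poly (cheb n) t\<bar> * \<bar>sin x\<bar> \<le> (real n + 1) * \<bar>sin x\<bar>"
    using abs_sin_mult_le[of "Suc n" x] unfolding poly_cheb_cos[symmetric] t by (simp add: abs_mult add.commute)
  ultimately show ?thesis by simp
qed

text \<open>Unlike \<open>abs_cheb_le\<close>, this is uniform in \<open>n\<close>, which controls
  the test functions of large degree.\<close>

lemma abs_cheb_wgt_le:
  assumes "t \<in> {-1..1}" shows "\<bar>poly (cheb n) t\<bar> * wgt t \<le> 1"
proof -
  have "\<bar>poly (cheb n) (cos (arccos t)) * sin (arccos t)\<bar> \<le> 1" unfolding poly_cheb_cos by simp
  then show ?thesis using assms sin_arccos[of t] abs_square_le_1[of t]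
    by (simp add: abs_mult wgt_def abs_le_iff)
qed

lemma abs_gegenbauer_4_le: "t \<in> {-1..1} \<Longrightarrow> \<bar>poly (gegenbauer 4 n) t\<bar> \<le> 1"
  using abs_cheb_le[of t n] by (simp add: poly_gegenbauer_4 divide_le_eq add.commute)

section \<open>Positive definiteness on the three-dimensional sphere\<close>

text \<open>Schur's product theorem for powers of a kernel of finite rank. The induction varies
  \<open>c\<close>, because each factor \<open>K\<close> is absorbed by passing from
  \<open>c\<close> to \<open>c * \<phi> m\<close>.\<close>

lemma kernel_power_nonneg:
  fixes K :: "'a \<Rightarrow> 'a \<Rightarrow> complex" and \<phi> :: "'m \<Rightarrow> 'a \<Rightarrow> complex"
  assumes K: "\<And>x y. K x y = (\<Sum>m\<in>M. \<phi> m x * cnj (\<phi> m y))"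
  shows "0 \<le> Re (\<Sum>x\<in>C. \<Sum>y\<in>C. c x * cnj (c y) * K x y ^ n)"
proof (induction n arbitrary: c)
  case 0
  have "(\<Sum>x\<in>C. \<Sum>y\<in>C. c x * cnj (c y) * K x y ^ 0) = sum c C * cnj (sum c C)"
    by (simp add: sum_product)
  also have "\<dots> = of_real ((cmod (sum c C))\<^sup>2)" by (rule complex_norm_square[symmetric])
  finally show ?case by simp
next
  case (Suc n)
  have "c x * cnj (c y) * K x y ^ Suc n = (\<Sum>m\<in>M. (c x * \<phi> m x) * cnj (c y * \<phi> m y) * K x y ^ n)" for x y
  proof -
    have "(\<Sum>m\<in>M. (c x * \<phi> m x) * cnj (c y * \<phi> m y) * K x y ^ n)
       = (\<Sum>m\<in>M. (c x * cnj (c y) * K x y ^ n) * (\<phi> m x * cnj (\<phi> m y)))"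
      by (intro sum.cong refl) (simp add: mult_ac)
    also have "\<dots> = (c x * cnj (c y) * K x y ^ n) * K x y"
      by (simp only: sum_distrib_left[symmetric] K[symmetric])
    finally show ?thesis by (simp add: mult_ac)
  qed
  then have "(\<Sum>x\<in>C. \<Sum>y\<in>C. c x * cnj (c y) * K x y ^ Suc n) =
     (\<Sum>x\<in>C. \<Sum>y\<in>C. \<Sum>m\<in>M. (c x * \<phi> m x) * cnj (c y * \<phi> m y) * K x y ^ n)"
    by (simp only:)
  also have "\<dots> = (\<Sum>m\<in>M. \<Sum>x\<in>C. \<Sum>y\<in>C. (c x * \<phi> m x) * cnj (c y * \<phi> m y) * K x y ^ n)"
    by (subst (2) sum.swap, subst sum.swap) (rule refl)
  finally have *: "Re (\<Sum>x\<in>C. \<Sum>y\<in>C. c x * cnj (c y) * K x y ^ Suc n)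
      = (\<Sum>m\<in>M. Re (\<Sum>x\<in>C. \<Sum>y\<in>C. (c x * \<phi> m x) * cnj (c y * \<phi> m y) * K x y ^ n))"
    by (simp only: Re_sum[of _ M])
  show ?case unfolding * by (intro sum_nonneg Suc)
qed

text \<open>\<open>x \<bullet> y\<close> and the three forms below are the components of the quaternion \<open>x\<close> times the
  conjugate of \<open>y\<close>.\<close>

definition quat1 :: "real ^ 4 \<Rightarrow> real ^ 4 \<Rightarrow> real" where
  "quat1 x y = x$1 * y$2 - x$2 * y$1 + x$3 * y$4 - x$4 * y$3"
definition quat2 :: "real ^ 4 \<Rightarrow> real ^ 4 \<Rightarrow> real" where
  "quat2 x y = x$1 * y$3 - x$3 * y$1 + x$4 * y$2 - x$2 * y$4"
definition quat3 :: "real ^ 4 \<Rightarrow> real ^ 4 \<Rightarrow> real" where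
  "quat3 x y = x$1 * y$4 - x$4 * y$1 + x$2 * y$3 - x$3 * y$2"

lemma inner_4: "x \<bullet> y = x$1 * y$1 + x$2 * y$2 + x$3 * y$3 + x$4 * y$4" for x y :: "real ^ 4"
  by (simp add: inner_vec_def sum_4)

text \<open>Euler's four-square identity for \<open>x\<close> times the conjugate of
  \<open>y\<close>. The imaginary part thus has the length that Laplace's integral requires.\<close>

lemma quat_norm:
  assumes "norm x = 1" "norm y = 1"
  shows "(quat1 x y)\<^sup>2 + (quat2 x y)\<^sup>2 + (quat3 x y)\<^sup>2 = 1 - (x \<bullet> y)\<^sup>2"
proof -
  have "(x \<bullet> y)\<^sup>2 + ((quat1 x y)\<^sup>2 + (quat2 x y)\<^sup>2 + (quat3 x y)\<^sup>2) = (x \<bullet> x) * (y \<bullet> y)"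
    by (simp add: quat1_def quat2_def quat3_def inner_4 power2_eq_square algebra_simps)
  also have "\<dots> = 1" using assms by (simp add: dot_square_norm)
  finally show ?thesis by simp
qed

text \<open>A unit vector \<open>(j1, j2, j3)\<close> defines a complex structure on \<open>\<real>\<^sup>4\<close>, and the kernel is the
  Hermitian product for that structure.\<close>

lemma hermitian_kernel_power_nonneg:
  fixes C :: "(real ^ 4) set"
  assumes j: "j1\<^sup>2 + j2\<^sup>2 + j3\<^sup>2 = 1"
  shows "0 \<le> (\<Sum>x\<in>C. \<Sum>y\<in>C. Re (Complex (x \<bullet> y) (j1 * quat1 x y + j2 * quat2 x y + j3 * quat3 x y) ^ n))"
proof -
  \<comment> \<open>\<open>J\<close> is skew and orthogonal. With \<open>\<phi> m x\<close> the
    \<open>m\<close>-th coordinate of \<open>(x - i J x) / sqrt 2\<close>, these two properties turn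
    the sum over \<open>m\<close> into \<open>x \<bullet> y\<close> plus \<open>i\<close> times
    \<open>x \<bullet> J y\<close>.\<close>
  define J :: "nat \<Rightarrow> real ^ 4 \<Rightarrow> real" where "J m x = [j1 * x$2 + j2 * x$3 + j3 * x$4,
     - j1 * x$1 + j3 * x$3 - j2 * x$4, - j2 * x$1 - j3 * x$2 + j1 * x$4, - j3 * x$1 + j2 * x$2 - j1 * x$3] ! m" for m x
  define \<phi> where "\<phi> m x = Complex ([x$1, x$2, x$3, x$4] ! m / sqrt 2) (- J m x / sqrt 2)" for m and x :: "real ^ 4"
  have "Complex (x \<bullet> y) (j1 * quat1 x y + j2 * quat2 x y + j3 * quat3 x y)
      = (\<Sum>m\<in>{..<4}. \<phi> m x * cnj (\<phi> m y))" for x y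
  proof -
    have j1: "j1 * j1 = 1 - j2 * j2 - j3 * j3" using j by (simp add: power2_eq_square)
    have j1': "j1 * (j1 * z) = z - j2 * (j2 * z) - j3 * (j3 * z)" for z
      unfolding mult.assoc[symmetric] j1 by (simp add: algebra_simps)
    have s: "{..<4::nat} = {0, 1, 2, 3}" by auto
    show ?thesis
      by (simp add: s \<phi>_def J_def quat1_def quat2_def quat3_def inner_4 complex_eq_iff
          add_divide_distrib[symmetric] diff_divide_distrib[symmetric] algebra_simps j1')
  qed
  then have "0 \<le> Re (\<Sum>x\<in>C. \<Sum>y\<in>C. 1 * cnj 1 * Complex (x \<bullet> y) (j1 * quat1 x y + j2 * quat2 x y + j3 * quat3 x y) ^ n)"
    by (rule kernel_power_nonneg)
  then show ?thesis by simp
qed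

text \<open>The 38-point Lebedev rule of degree 9 on the two-dimensional sphere, evaluated at the even
  functions \<open>u \<mapsto> F (u \<bullet> (a, b, c))\<close>; antipodal points are merged.\<close>

definition lebedev_p :: real where "lebedev_p = sqrt ((1 + sqrt (1/3)) / 2)"
definition lebedev_q :: real where "lebedev_q = sqrt ((1 - sqrt (1/3)) / 2)"

definition lebedev :: "(real \<Rightarrow> real) \<Rightarrow> real \<Rightarrow> real \<Rightarrow> real \<Rightarrow> real" where
  "lebedev F a b c = 2/105 * (F a + F b + F c)
   + 9/140 * (F ((a + b + c) / sqrt 3) + F ((a + b - c) / sqrt 3) + F ((a - b + c) / sqrt 3) + F ((a - b - c) / sqrt 3))
   + 2/35 * ((F (lebedev_p * a + lebedev_q * b) + F (lebedev_p * a - lebedev_q * b) + F (lebedev_q * a + lebedev_p * b) + F (lebedev_q * a - lebedev_p * b))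
     + (F (lebedev_p * b + lebedev_q * c) + F (lebedev_p * b - lebedev_q * c) + F (lebedev_q * b + lebedev_p * c) + F (lebedev_q * b - lebedev_p * c))
     + (F (lebedev_p * c + lebedev_q * a) + F (lebedev_p * c - lebedev_q * a) + F (lebedev_q * c + lebedev_p * a) + F (lebedev_q * c - lebedev_p * a)))"

lemma lebedev_pq:
  "lebedev_p\<^sup>2 + lebedev_q\<^sup>2 = 1" "lebedev_p\<^sup>2 * lebedev_q\<^sup>2 = 1/6"
proof -
  have "sqrt (1/3) \<le> 1" by simp
  then have p: "lebedev_p\<^sup>2 = (1 + sqrt (1/3)) / 2" "lebedev_q\<^sup>2 = (1 - sqrt (1/3)) / 2"
    by (simp_all add: lebedev_p_def lebedev_q_def)
  show "lebedev_p\<^sup>2 + lebedev_q\<^sup>2 = 1" unfolding p by (simp add: field_simps)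
  have "(1 + sqrt (1/3)) * (1 - sqrt (1/3)) = 1 - (sqrt (1/3))\<^sup>2"
    by (simp add: power2_eq_square algebra_simps)
  also have "\<dots> = 2/3" by simp
  finally show "lebedev_p\<^sup>2 * lebedev_q\<^sup>2 = 1/6" unfolding p by (simp add: mult.commute)
qed

text \<open>The left sides are even in \<open>p\<close> and in \<open>q\<close> and symmetric under
  their exchange, hence polynomials in \<open>p^2 + q^2\<close> and \<open>p^2 * q^2\<close>, whose
  values for the design are in \<open>lebedev_pq\<close>.\<close>

lemma sum_quad_powers:
  fixes p q :: real
  assumes "p\<^sup>2 + q\<^sup>2 = 1" "p\<^sup>2 * q\<^sup>2 = 1/6"
  shows
  "(p*a + q*b)^2 + (p*a - q*b)^2 + (q*a + p*b)^2 + (q*a - p*b)^2 = 2 * (a^2 + b^2)"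
  "(p*a + q*b)^4 + (p*a - q*b)^4 + (q*a + p*b)^4 + (q*a - p*b)^4 = 4/3 * (a^4 + b^4) + 4 * a^2 * b^2"
  "(p*a + q*b)^6 + (p*a - q*b)^6 + (q*a + p*b)^6 + (q*a - p*b)^6 = (a^6 + b^6) + 5 * (a^4 * b^2 + a^2 * b^4)"
  "(p*a + q*b)^8 + (p*a - q*b)^8 + (q*a + p*b)^8 + (q*a - p*b)^8 = 7/9 * (a^8 + b^8) + 56/9 * (a^6 * b^2 + a^2 * b^6) + 70/9 * a^4 * b^4"
proof -
  define P Q A B where "P = p\<^sup>2" "Q = q\<^sup>2" "A = a\<^sup>2" "B = b\<^sup>2"
  note d = P_Q_A_B_def
  have sym: "P + Q = 1" "P*P + Q*Q = 2/3" "P*Q = 1/6" "P*P*P + Q*Q*Q = 1/2" "P*P*Q + P*Q*Q = 1/6"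
    "P*P*P*P + Q*Q*Q*Q = 7/18" "P*P*P*Q + P*Q*Q*Q = 1/9" "P*P*Q*Q = 1/36"
  proof -
    show s1: "P + Q = 1" "P*Q = 1/6" using assms unfolding d by auto
    have "P*P + Q*Q = (P + Q)\<^sup>2 - 2 * (P * Q)" by (simp add: power2_eq_square algebra_simps)
    then show s2: "P*P + Q*Q = 2/3" unfolding s1 by simp
    have "P*P*P + Q*Q*Q = (P + Q) * (P*P + Q*Q - P*Q)" by (simp add: algebra_simps)
    then show "P*P*P + Q*Q*Q = 1/2" unfolding s1 s2 by simp
    have "P*P*Q + P*Q*Q = (P * Q) * (P + Q)" by (simp add: algebra_simps)
    then show "P*P*Q + P*Q*Q = 1/6" unfolding s1 by simp
    have "P*P*P*P + Q*Q*Q*Q = (P*P + Q*Q)\<^sup>2 - 2 * (P * Q)\<^sup>2" by (simp add: power2_eq_square algebra_simps)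
    then show "P*P*P*P + Q*Q*Q*Q = 7/18" unfolding s1 s2 by (simp add: power2_eq_square)
    have "P*P*P*Q + P*Q*Q*Q = (P * Q) * (P*P + Q*Q)" by (simp add: algebra_simps)
    then show "P*P*P*Q + P*Q*Q*Q = 1/9" unfolding s1 s2 by simp
    have "P*P*Q*Q = (P * Q) * (P * Q)" by (simp add: algebra_simps)
    then show "P*P*Q*Q = 1/36" unfolding s1 by simp
  qed
  show "(p*a + q*b)^2 + (p*a - q*b)^2 + (q*a + p*b)^2 + (q*a - p*b)^2 = 2 * (a^2 + b^2)"
  proof -
    have "(p*a + q*b)^2 + (p*a - q*b)^2 + (q*a + p*b)^2 + (q*a - p*b)^2 = 2 * (P + Q) * (A + B)"
      unfolding d by (simp add: power2_eq_square algebra_simps)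
    then show ?thesis unfolding sym by (simp add: d)
  qed
  have "(p*a + q*b)^4 + (p*a - q*b)^4 + (q*a + p*b)^4 + (q*a - p*b)^4
    = 2 * ((P*P + Q*Q) * (A*A + B*B) + 12 * (P*Q) * (A*B))"
    unfolding d by (simp add: numeral_eq_Suc algebra_simps)
  also have "\<dots> = 4/3 * (A*A + B*B) + 4 * A * B"
    unfolding sym by simp
  finally show "(p*a + q*b)^4 + (p*a - q*b)^4 + (q*a + p*b)^4 + (q*a - p*b)^4 = 4/3 * (a^4 + b^4) + 4 * a^2 * b^2"
    unfolding d by (simp add: numeral_eq_Suc algebra_simps)
  have "(p*a + q*b)^6 + (p*a - q*b)^6 + (q*a + p*b)^6 + (q*a - p*b)^6
    = 2 * ((P*P*P + Q*Q*Q) * (A*A*A + B*B*B) + 15 * (P*P*Q + P*Q*Q) * (A*A*B + A*B*B))"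
    unfolding d by (simp add: numeral_eq_Suc algebra_simps)
  also have "\<dots> = A*A*A + B*B*B + 5 * (A*A*B + A*B*B)"
    unfolding sym(4,5) by (simp add: field_simps)
  finally show "(p*a + q*b)^6 + (p*a - q*b)^6 + (q*a + p*b)^6 + (q*a - p*b)^6 = (a^6 + b^6) + 5 * (a^4 * b^2 + a^2 * b^4)"
    unfolding d by (simp add: numeral_eq_Suc algebra_simps)
  have "(p*a + q*b)^8 + (p*a - q*b)^8 + (q*a + p*b)^8 + (q*a - p*b)^8
    = 2 * ((P*P*P*P + Q*Q*Q*Q) * (A*A*A*A + B*B*B*B) + 28 * (P*P*P*Q + P*Q*Q*Q) * (A*A*A*B + A*B*B*B) + 140 * (P*P*Q*Q) * (A*A*B*B))"
    unfolding d by (simp add: numeral_eq_Suc algebra_simps)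
  also have "\<dots> = 7/9 * (A*A*A*A + B*B*B*B) + 56/9 * (A*A*A*B + A*B*B*B) + 70/9 * (A*A*B*B)"
    unfolding sym(6,7,8) by (simp add: field_simps)
  finally show "(p*a + q*b)^8 + (p*a - q*b)^8 + (q*a + p*b)^8 + (q*a - p*b)^8 = 7/9 * (a^8 + b^8) + 56/9 * (a^6 * b^2 + a^2 * b^6) + 70/9 * a^4 * b^4"
    unfolding d by (simp add: numeral_eq_Suc algebra_simps)
qed

text \<open>By Archimedes, the inner product of a fixed vector of squared length \<open>r\<close>
  with a uniform unit vector is uniform on an interval, so \<open>r ^ k / (2 * k + 1)\<close> is the
  true spherical mean of its power \<open>2 * k\<close>: the rule is exact.\<close>

lemma lebedev_even_powers:
  defines "r \<equiv> \<lambda>a b c. a\<^sup>2 + b\<^sup>2 + c\<^sup>2"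
  shows "lebedev (\<lambda>s. s^2) a b c = r a b c / 3"
    and "lebedev (\<lambda>s. s^4) a b c = r a b c ^ 2 / 5"
    and "lebedev (\<lambda>s. s^6) a b c = r a b c ^ 3 / 7"
    and "lebedev (\<lambda>s. s^8) a b c = r a b c ^ 4 / 9"
proof -
  have s: "sqrt 3 ^ 2 = 3" "sqrt 3 ^ 4 = 9" "sqrt 3 ^ 6 = 27" "sqrt 3 ^ 8 = 81"
    using power_mult[of "sqrt 3" 2 2] power_mult[of "sqrt 3" 2 3] power_mult[of "sqrt 3" 2 4] by simp_all
  note sp = sum_quad_powers[OF lebedev_pq]
  show "lebedev (\<lambda>s. s^2) a b c = r a b c / 3"
    unfolding lebedev_def sp r_def power_divide s by (simp add: numeral_eq_Suc field_simps)
  show "lebedev (\<lambda>s. s^4) a b c = r a b c ^ 2 / 5"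
    unfolding lebedev_def sp r_def power_divide s by (simp add: numeral_eq_Suc field_simps)
  show "lebedev (\<lambda>s. s^6) a b c = r a b c ^ 3 / 7"
    unfolding lebedev_def sp r_def power_divide s by (simp add: numeral_eq_Suc field_simps)
  show "lebedev (\<lambda>s. s^8) a b c = r a b c ^ 4 / 9"
    unfolding lebedev_def sp r_def power_divide s by (simp add: numeral_eq_Suc field_simps)
qed

lemma lebedev_even_poly:
  fixes a b c :: real
  defines "r \<equiv> a\<^sup>2 + b\<^sup>2 + c\<^sup>2"
  shows "lebedev (\<lambda>s. c0 + c1 * s^2 + c2 * s^4 + c3 * s^6 + c4 * s^8) a b c =
    c0 + c1 * r / 3 + c2 * r^2 / 5 + c3 * r^3 / 7 + c4 * r^4 / 9"
proof -
  have "lebedev (\<lambda>s. c0 + c1 * s^2 + c2 * s^4 + c3 * s^6 + c4 * s^8) a b c =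
    c0 + c1 * lebedev (\<lambda>s. s^2) a b c + c2 * lebedev (\<lambda>s. s^4) a b c
     + c3 * lebedev (\<lambda>s. s^6) a b c + c4 * lebedev (\<lambda>s. s^8) a b c"
    unfolding lebedev_def by (simp add: algebra_simps)
  then show ?thesis unfolding lebedev_even_powers r_def by simp
qed

lemma Re_Complex_power_Suc_Suc:
  "Re (Complex t s ^ Suc (Suc n)) = 2 * t * Re (Complex t s ^ Suc n) - (t\<^sup>2 + s\<^sup>2) * Re (Complex t s ^ n)"
proof -
  have "Complex t s * Complex t s = of_real (2 * t) * Complex t s - of_real (t\<^sup>2 + s\<^sup>2)"
    by (simp add: complex_eq_iff power2_eq_square)
  then have "Complex t s ^ Suc (Suc n) = of_real (2 * t) * Complex t s ^ Suc n - of_real (t\<^sup>2 + s\<^sup>2) * Complex t s ^ n"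
    by (simp only: power_Suc left_diff_distrib flip: mult.assoc)
  then show ?thesis by (simp only: minus_complex.simps Re_complex_of_real times_complex.simps Im_complex_of_real mult_zero_left diff_zero)
qed

lemma poly_cheb_numeral:
  "poly (cheb 2) t = 4 * t^2 - 1"
  "poly (cheb 3) t = 8 * t^3 - 4 * t"
  "poly (cheb 4) t = 16 * t^4 - 12 * t^2 + 1"
  "poly (cheb 5) t = 32 * t^5 - 32 * t^3 + 6 * t"
  "poly (cheb 6) t = 64 * t^6 - 80 * t^4 + 24 * t^2 - 1"
  "poly (cheb 7) t = 128 * t^7 - 192 * t^5 + 80 * t^3 - 8 * t"
  "poly (cheb 8) t = 256 * t^8 - 448 * t^6 + 240 * t^4 - 40 * t^2 + 1"
  "poly (cheb 9) t = 512 * t^9 - 1024 * t^7 + 672 * t^5 - 160 * t^3 + 10 * t"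
  by (simp_all add: numeral_eq_Suc algebra_simps)

text \<open>A discrete form of Laplace's integral for the Gegenbauer polynomials.\<close>

lemma lebedev_Re_power:
  assumes r: "a\<^sup>2 + b\<^sup>2 + c\<^sup>2 = 1 - t\<^sup>2" and n: "n \<le> 9"
  shows "lebedev (\<lambda>s. Re (Complex t s ^ n)) a b c = poly (cheb n) t / (real n + 1)"
proof -
  define R where "R n s = Re (Complex t s ^ n)" for n s
  have R0: "R 0 s = 1" and R1: "R 1 s = t" and RS: "R (Suc (Suc n)) s = 2 * t * R (Suc n) s - (t\<^sup>2 + s\<^sup>2) * R n s" for n s
    unfolding R_def Re_Complex_power_Suc_Suc by simp_all
  have R: "R 2 s = t^2 - s^2" "R 3 s = t^3 - 3 * t * s^2" "R 4 s = t^4 - 6 * t^2 * s^2 + s^4"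
     "R 5 s = t^5 - 10 * t^3 * s^2 + 5 * t * s^4"
     "R 6 s = t^6 - 15 * t^4 * s^2 + 15 * t^2 * s^4 - s^6"
     "R 7 s = t^7 - 21 * t^5 * s^2 + 35 * t^3 * s^4 - 7 * t * s^6"
     "R 8 s = t^8 - 28 * t^6 * s^2 + 70 * t^4 * s^4 - 28 * t^2 * s^6 + s^8"
     "R 9 s = t^9 - 36 * t^7 * s^2 + 126 * t^5 * s^4 - 84 * t^3 * s^6 + 9 * t * s^8" for s
    by (simp_all add: numeral_eq_Suc RS R0 R1[unfolded One_nat_def] algebra_simps)
  \<comment> \<open>Averaging replaces \<open>s ^ (2 * k)\<close> by
    \<open>(1 - t^2) ^ k / (2 * k + 1)\<close>, so each degree needs only the coefficients of the
    even powers of \<open>s\<close> in the real part of \<open>(t + i s) ^ n\<close>; they are the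
    instances of \<open>c0\<close> to \<open>c4\<close> below.\<close>
  have eval: "lebedev (R n) a b c = poly (cheb n) t / (real n + 1)"
    if "\<And>s. R n s = c0 + c1 * s^2 + c2 * s^4 + c3 * s^6 + c4 * s^8"
      "c0 + c1 * (1 - t^2) / 3 + c2 * (1 - t^2)^2 / 5 + c3 * (1 - t^2)^3 / 7 + c4 * (1 - t^2)^4 / 9 = poly (cheb n) t / (real n + 1)"
    for n c0 c1 c2 c3 c4
    unfolding that(1)[abs_def] lebedev_even_poly r that(2) ..
  have "n = 0 \<or> n = 1 \<or> n = 2 \<or> n = 3 \<or> n = 4 \<or> n = 5 \<or> n = 6 \<or> n = 7 \<or> n = 8 \<or> n = 9" using n by arith
  then have "lebedev (R n) a b c = poly (cheb n) t / (real n + 1)"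
  proof (elim disjE)
    show ?thesis if "n = 0" unfolding that
      by (rule eval[of _ "(1)" "0" "0" "0" "0"]) (simp_all add: R0)
    show ?thesis if "n = 1" unfolding that
      by (rule eval[of _ "(1 * t^1)" "0" "0" "0" "0"]) (simp_all add: R1[unfolded One_nat_def])
    show ?thesis if "n = 2" unfolding that
      by (rule eval[of _ "(1 * t^2)" "(-1)" "0" "0" "0"]) (simp_all only: R poly_cheb_numeral, simp_all add: numeral_eq_Suc field_simps)
    show ?thesis if "n = 3" unfolding that
      by (rule eval[of _ "(1 * t^3)" "(-3 * t^1)" "0" "0" "0"]) (simp_all only: R poly_cheb_numeral, simp_all add: numeral_eq_Suc field_simps)
    show ?thesis if "n = 4" unfolding that
      by (rule eval[of _ "(1 * t^4)" "(-6 * t^2)" "(1)" "0" "0"]) (simp_all only: R poly_cheb_numeral, simp_all add: numeral_eq_Suc field_simps)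
    show ?thesis if "n = 5" unfolding that
      by (rule eval[of _ "(1 * t^5)" "(-10 * t^3)" "(5 * t^1)" "0" "0"]) (simp_all only: R poly_cheb_numeral, simp_all add: numeral_eq_Suc field_simps)
    show ?thesis if "n = 6" unfolding that
      by (rule eval[of _ "(1 * t^6)" "(-15 * t^4)" "(15 * t^2)" "(-1)" "0"]) (simp_all only: R poly_cheb_numeral, simp_all add: numeral_eq_Suc field_simps)
    show ?thesis if "n = 7" unfolding that
      by (rule eval[of _ "(1 * t^7)" "(-21 * t^5)" "(35 * t^3)" "(-7 * t^1)" "0"]) (simp_all only: R poly_cheb_numeral, simp_all add: numeral_eq_Suc field_simps)
    show ?thesis if "n = 8" unfolding that
      by (rule eval[of _ "(1 * t^8)" "(-28 * t^6)" "(70 * t^4)" "(-28 * t^2)" "(1)"]) (simp_all only: R poly_cheb_numeral, simp_all add: numeral_eq_Suc field_simps)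
    show ?thesis if "n = 9" unfolding that
      by (rule eval[of _ "(1 * t^9)" "(-36 * t^7)" "(126 * t^5)" "(-84 * t^3)" "(9 * t^1)"]) (simp_all only: R poly_cheb_numeral, simp_all add: numeral_eq_Suc field_simps)
  qed
  then show ?thesis by (simp add: R_def[abs_def])
qed

text \<open>The directions of the design do not depend on the pair \<open>x, y\<close>. The double
  sum is therefore a positive combination of 19 sums \<open>S\<close>, one for each antipodal pair
  of Lebedev points, all nonnegative by \<open>hermitian_kernel_power_nonneg\<close>.\<close>

lemma sum_cheb_inner_nonneg:
  fixes C :: "(real ^ 4) set"
  assumes C: "C \<subseteq> sphere 0 1" and n: "n \<le> 9"
  shows "0 \<le> (\<Sum>x\<in>C. \<Sum>y\<in>C. poly (cheb n) (x \<bullet> y))"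
proof -
  let ?p = lebedev_p and ?q = lebedev_q and ?d = "1 / sqrt 3"
  define S where "S j1 j2 j3 = (\<Sum>x\<in>C. \<Sum>y\<in>C. Re (Complex (x \<bullet> y) (j1 * quat1 x y + j2 * quat2 x y + j3 * quat3 x y) ^ n))" for j1 j2 j3
  have S: "0 \<le> S j1 j2 j3" if "j1\<^sup>2 + j2\<^sup>2 + j3\<^sup>2 = 1" for j1 j2 j3
    unfolding S_def by (rule hermitian_kernel_power_nonneg[OF that])
  have "(\<Sum>x\<in>C. \<Sum>y\<in>C. poly (cheb n) (x \<bullet> y)) / (real n + 1) =
     (\<Sum>x\<in>C. \<Sum>y\<in>C. lebedev (\<lambda>s. Re (Complex (x \<bullet> y) s ^ n)) (quat1 x y) (quat2 x y) (quat3 x y))"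
    unfolding sum_divide_distrib
  proof (intro sum.cong refl)
    fix x y assume "x \<in> C" "y \<in> C"
    then have "norm x = 1" "norm y = 1" using C by auto
    from lebedev_Re_power[OF quat_norm[OF this] n]
    show "poly (cheb n) (x \<bullet> y) / (real n + 1) = lebedev (\<lambda>s. Re (Complex (x \<bullet> y) s ^ n)) (quat1 x y) (quat2 x y) (quat3 x y)"
      by simp
  qed
  also have "\<dots> = 2/105 * (S 1 0 0 + S 0 1 0 + S 0 0 1)
   + 9/140 * (S ?d ?d ?d + S ?d ?d (-?d) + S ?d (-?d) ?d + S ?d (-?d) (-?d))
   + 2/35 * ((S ?p ?q 0 + S ?p (-?q) 0 + S ?q ?p 0 + S ?q (-?p) 0)
     + (S 0 ?p ?q + S 0 ?p (-?q) + S 0 ?q ?p + S 0 ?q (-?p))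
     + (S ?q 0 ?p + S (-?q) 0 ?p + S ?p 0 ?q + S (-?p) 0 ?q))"
    unfolding lebedev_def S_def sum_distrib_left sum.distrib[symmetric]
    by (intro sum.cong refl) (simp add: add_divide_distrib diff_divide_distrib add.commute)
  also have "\<dots> \<ge> 0"
    using lebedev_pq(1) by (intro add_nonneg_nonneg mult_nonneg_nonneg S) (auto simp: power_divide add.commute)
  finally show ?thesis by (simp add: zero_le_divide_iff)
qed

section \<open>Absolutely monotone functions\<close>

text \<open>Compared with \<open>absolutely_monotone\<close>, values may be zero and nothing is
  asked at 1. This makes the class closed under difference quotients, for instance of
  constants.\<close>

definition amon :: "(real \<Rightarrow> real) \<Rightarrow> bool" where
  "amon g \<longleftrightarrow> (\<exists>D :: nat \<Rightarrow> real \<Rightarrow> real. D 0 = g \<and>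
     (\<forall>i. \<forall>t\<in>{-1..<1}. (D i has_real_derivative D (Suc i) t) (at t within {-1..<1})) \<and>
     (\<forall>i. \<forall>t\<in>{-1..<1}. 0 \<le> D i t))"

lemma amon_nonneg: "amon g \<Longrightarrow> t \<in> {-1..<1} \<Longrightarrow> 0 \<le> g t"
  by (auto simp: amon_def)

lemma amon_differentiable:
  assumes "amon g" "t \<in> {-1<..<1}"
  obtains g' where "(g has_real_derivative g') (at t)"
proof -
  have "at t within {-1..<1} = at t"
    using assms(2) by (intro at_within_interior) auto
  moreover obtain D where D: "D 0 = g" "\<And>i t. t \<in> {-1..<1} \<Longrightarrow> (D i has_real_derivative D (Suc i) t) (at t within {-1..<1})"
    using assms(1) unfolding amon_def by blast
  have "(g has_real_derivative D 1 t) (at t within {-1..<1})"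
    using D(2)[of t 0] D(1) assms(2) by simp
  ultimately show ?thesis using that by simp
qed

text \<open>The \<open>k\<close>-th derivative of the quotient \<open>(g t - g a) / (t - a)\<close> is the mean of
  \<open>s ^ k * D (k + 1) (a + s * (t - a))\<close> over \<open>s \<in> [0, 1]\<close>.\<close>

lemma amon_quotient:
  assumes "amon g" and a: "a \<in> {-1..<1}"
  obtains r where "amon r" "\<And>t. t \<in> {-1..<1} \<Longrightarrow> g t = g a + (t - a) * r t"
proof -
  obtain D where D: "D 0 = g" "\<And>i t. t \<in> {-1..<1} \<Longrightarrow> (D i has_real_derivative D (Suc i) t) (at t within {-1..<1})"
    "\<And>i t. t \<in> {-1..<1} \<Longrightarrow> (0::real) \<le> D i t"
    using assms(1) unfolding amon_def by blast
  have contD: "continuous_on {-1..<1} (D i)" for i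
    by (rule DERIV_continuous_on) (rule D(2))
  have mem: "a + s * (t - a) \<in> {-1..<1}" if "t \<in> {-1..<1}" "s \<in> {0..1}" for s t
  proof -
    have "(1 - s) * a + s * t < 1" using that a by (intro convex_bound_lt) auto
    moreover have "(1 - s) * (- a) + s * (- t) \<le> 1" using that a by (intro convex_bound_le) auto
    ultimately show ?thesis by (simp add: algebra_simps)
  qed
  define F where "F k t s = s ^ k * D (Suc k) (a + s * (t - a))" for k s t
  define E where "E k t = integral {0..1} (F k t)" for k t
  have contF: "continuous_on ({-1..<1} \<times> cbox 0 1) (\<lambda>(t, s). F k t s)" for k
    unfolding F_def split_beta
    by (intro continuous_intros continuous_on_compose2[OF contD]) (auto intro: mem)
  have contF1: "continuous_on {0..1} (F k t)" if "t \<in> {-1..<1}" for k t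
    unfolding F_def using that
    by (intro continuous_intros continuous_on_compose2[OF contD]) (auto intro: mem)
  have dF: "((\<lambda>t. F k t s) has_real_derivative F (Suc k) t s) (at t within {-1..<1})"
    if t: "t \<in> {-1..<1}" and s: "s \<in> {0..1}" for k t s
  proof -
    let ?g = "\<lambda>t. a + s * (t - a)"
    have "(D (Suc k) has_real_derivative D (Suc (Suc k)) (?g t)) (at (?g t) within ?g ` {-1..<1})"
      using D(2)[OF mem[OF t s], of "Suc k"] by (rule DERIV_subset) (use mem s in auto)
    moreover have "(?g has_real_derivative s) (at t within {-1..<1})"
      by (auto intro!: derivative_eq_intros)
    ultimately have "(D (Suc k) \<circ> ?g has_real_derivative D (Suc (Suc k)) (?g t) * s) (at t within {-1..<1})"
      by (rule DERIV_image_chain)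
    then show ?thesis
      unfolding F_def by (auto intro!: derivative_eq_intros simp: o_def)
  qed
  have dE: "(E k has_real_derivative E (Suc k) t) (at t within {-1..<1})" if "t \<in> {-1..<1}" for k t
    unfolding E_def cbox_interval[symmetric]
  proof (rule leibniz_rule_field_derivative)
    show "F k t integrable_on cbox 0 1" if "t \<in> {-1..<1}" for t
      unfolding cbox_interval by (rule integrable_continuous_interval[OF contF1[OF that]])
  qed (use dF contF that in auto)
  have E0: "0 \<le> E k t" if "t \<in> {-1..<1}" for k t
    unfolding E_def
  proof (rule Henstock_Kurzweil_Integration.integral_nonneg)
    show "F k t integrable_on {0..1}" using contF1[OF that] by (rule integrable_continuous_interval)
    show "0 \<le> F k t s" if "s \<in> {0..1}" for s
      using that \<open>t \<in> _\<close> D(3) mem unfolding F_def by auto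
  qed
  have "g t = g a + (t - a) * E 0 t" if t: "t \<in> {-1..<1}" for t
  proof -
    have "((\<lambda>s. (t - a) * F 0 t s) has_integral (g (a + 1 * (t - a)) - g (a + 0 * (t - a)))) {0..1}"
    proof (rule fundamental_theorem_of_calculus)
      fix s :: real assume s: "s \<in> {0..1}"
      let ?g = "\<lambda>s. a + s * (t - a)"
      have "(D 0 has_real_derivative D 1 (?g s)) (at (?g s) within ?g ` {0..1})"
        using D(2)[OF mem[OF t s], of 0] unfolding One_nat_def
        by (rule DERIV_subset) (use mem t in auto)
      moreover have "(?g has_real_derivative (t - a)) (at s within {0..1})"
        by (auto intro!: derivative_eq_intros)
      ultimately have "(D 0 \<circ> ?g has_real_derivative D 1 (?g s) * (t - a)) (at s within {0..1})"
        by (rule DERIV_image_chain)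
      then show "((\<lambda>s. g (?g s)) has_vector_derivative (t - a) * F 0 t s) (at s within {0..1})"
        by (simp add: F_def D(1) o_def mult.commute has_real_derivative_iff_has_vector_derivative)
    qed simp
    then have "integral {0..1} (\<lambda>s. (t - a) * F 0 t s) = g t - g a"
      by (intro integral_unique) simp
    then show ?thesis unfolding E_def by (subst (asm) Henstock_Kurzweil_Integration.integral_mult_right) simp
  qed
  moreover have "amon (E 0)" unfolding amon_def using dE E0 by blast
  ultimately show thesis using that by blast
qed

lemma amon_mono:
  assumes g: "amon g" and x: "x \<in> {-1..<1}" and y: "y \<in> {-1..<1}" and "x \<le> y"
  shows "g x \<le> g y"
proof -
  obtain r where "amon r" "\<And>t. t \<in> {-1..<1} \<Longrightarrow> g t = g x + (t - x) * r t"
    using amon_quotient[OF g x] by blast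
  then show ?thesis using amon_nonneg[of r y] y \<open>x \<le> y\<close> by simp
qed

definition newton_poly :: "real list \<Rightarrow> nat \<Rightarrow> real poly" where
  "newton_poly xs j = (\<Prod>i<j. [:- (xs ! i), 1:])"

text \<open>The coefficients are divided differences: each is the value at a node of an iterated
  quotient, which lies in the class and is therefore nonnegative. Repeated entries of
  \<open>xs\<close> give Hermite interpolation.\<close>

lemma amon_newton_expansion:
  assumes "amon g" "set xs \<subseteq> {-1..<1}"
  shows "\<exists>c r. (\<forall>j. 0 \<le> c j) \<and> amon r \<and>
    (\<forall>t\<in>{-1..<1}. g t = (\<Sum>j<length xs. c j * poly (newton_poly xs j) t) + r t * poly (newton_poly xs (length xs)) t)"
  using assms
proof (induction xs arbitrary: g)
  case Nil
  then show ?case by (intro exI[of _ "\<lambda>_. 0"] exI[of _ g]) (simp add: newton_poly_def)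
next
  case (Cons a xs)
  obtain g1 where g1: "amon g1" "\<And>t. t \<in> {-1..<1} \<Longrightarrow> g t = g a + (t - a) * g1 t"
    using amon_quotient[of g a] Cons.prems by auto
  have "\<exists>c r. (\<forall>j. 0 \<le> c j) \<and> amon r \<and>
    (\<forall>t\<in>{-1..<1}. g1 t = (\<Sum>j<length xs. c j * poly (newton_poly xs j) t) + r t * poly (newton_poly xs (length xs)) t)"
    using Cons.prems(2) by (intro Cons.IH[OF g1(1)]) auto
  then obtain c r where c: "\<And>j. 0 \<le> c j" "amon r" and
    e: "\<And>t. t \<in> {-1..<1} \<Longrightarrow> g1 t = (\<Sum>j<length xs. c j * poly (newton_poly xs j) t) + r t * poly (newton_poly xs (length xs)) t"
    by metis
  have n: "newton_poly (a # xs) (Suc j) = [:- a, 1:] * newton_poly xs j" for j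
    unfolding newton_poly_def by (subst prod.lessThan_Suc_shift) simp
  have n0: "newton_poly (a # xs) 0 = 1" by (simp add: newton_poly_def)
  have "g t = (\<Sum>j<length (a # xs). case_nat (g a) c j * poly (newton_poly (a # xs) j) t)
     + r t * poly (newton_poly (a # xs) (length (a # xs))) t" if "t \<in> {-1..<1}" for t
    unfolding list.size add_Suc_right add_0_right sum.lessThan_Suc_shift n g1(2)[OF that] e[OF that]
    by (simp add: n0 sum_distrib_left algebra_simps)
  moreover have "\<forall>j. 0 \<le> case_nat (g a) c j"
    using c Cons.prems by (auto split: nat.split intro: amon_nonneg)
  ultimately show ?case using c(2) by blast
qed

text \<open>If \<open>g b = 0\<close> then \<open>g\<close> vanishes on \<open>[-1, b]\<close>, so deflation at \<open>-1\<close> never stops, and every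
  \<open>g t / (t + 1) ^ n\<close> is nondecreasing.\<close>

lemma amon_eq_0:
  assumes g: "amon g" and b: "b \<in> {-1<..<1}" "g b = 0" and t: "t \<in> {-1..<1}"
  shows "g t = 0"
proof -
  have ex: "\<exists>r. amon r \<and> (\<forall>t\<in>{-1..<1}. g t = (t + 1) ^ n * r t)" for n
  proof (induction n)
    case 0 show ?case using g by auto
  next
    case (Suc n)
    then obtain r where r: "amon r" "\<forall>t\<in>{-1..<1}. g t = (t + 1) ^ n * r t" by blast
    have "r b = 0" using r(2)[rule_format, of b] b by auto
    then have "r (-1) = 0"
      using amon_mono[OF r(1), of "-1" b] amon_nonneg[OF r(1), of "-1"] b by auto
    then obtain r' where "amon r'" "\<And>t. t \<in> {-1..<1} \<Longrightarrow> r t = (t + 1) * r' t"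
      using amon_quotient[OF r(1), of "-1"] by (auto simp: add.commute)
    then show ?case using r(2) by (intro exI[of _ r']) auto
  qed
  \<comment> \<open>The midpoint of \<open>t\<close> and 1. As \<open>(t + 1) / (y + 1) < 1\<close>,
    monotonicity of the quotients bounds \<open>g t\<close> by a geometric sequence.\<close>
  define y where "y = (t + 1) / 2"
  have y: "t \<le> y" "-1 \<le> t" "y < 1" "0 < y + 1" "t < y" using t by (auto simp: y_def field_simps)
  have "g t \<le> ((t + 1) / (y + 1)) ^ n * g y" for n
  proof -
    obtain r where r: "amon r" "\<forall>t\<in>{-1..<1}. g t = (t + 1) ^ n * r t" using ex by blast
    have "g t \<le> (t + 1) ^ n * r y"
      using r(2) t y amon_mono[OF r(1), of t y] by (auto intro!: mult_left_mono)
    also have "\<dots> = ((t + 1) / (y + 1)) ^ n * g y"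
      using r(2) y by (simp add: power_divide)
    finally show ?thesis .
  qed
  moreover have "(\<lambda>n. ((t + 1) / (y + 1)) ^ n * g y) \<longlonglongrightarrow> 0 * g y"
    using y by (intro tendsto_mult LIMSEQ_realpow_zero tendsto_const) auto
  ultimately have "g t \<le> 0" by (intro LIMSEQ_le_const[of _ 0 "g t"]) auto
  then show ?thesis using amon_nonneg[OF g t] by simp
qed

section \<open>Quadrature and linear programming\<close>

lemma pmean_nonneg:
  assumes "\<And>t. t \<in> {-1..1} \<Longrightarrow> 0 \<le> poly q t" shows "0 \<le> pmean q"
proof -
  have "0 \<le> integral {-1..1} (\<lambda>t. wgt t * poly q t)"
  proof (rule Henstock_Kurzweil_Integration.integral_nonneg[OF wgt_poly_integrable])
    fix t :: real assume t: "t \<in> {-1..1}"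
    then have "t\<^sup>2 \<le> 1" by (simp add: abs_square_le_1 abs_le_iff)
    then show "0 \<le> wgt t * poly q t" using assms[OF t] by (simp add: wgt_def)
  qed
  then show ?thesis using integral_wgt_pos by (simp add: pmean_eq)
qed

lemma pmean_const: "pmean [:e:] = e"
  using pmean_smult[of e 1] by simp

lemma abs_pmean_le:
  assumes "\<And>t. t \<in> {-1..1} \<Longrightarrow> \<bar>poly q t\<bar> \<le> e" shows "\<bar>pmean q\<bar> \<le> e"
proof -
  have "0 \<le> pmean ([:e:] - q)" "0 \<le> pmean ([:e:] + q)"
    using assms by (intro pmean_nonneg; force simp: abs_le_iff)+
  then show ?thesis by (simp add: pmean_diff pmean_add pmean_const)
qed

text \<open>The linear programming objective without the factor \<open>24^2\<close>. A
  \<open>1/24\<close>-rule is exact for \<open>p\<close> when \<open>lfun p\<close> equals its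
  weighted sum over the nodes.\<close>

definition lfun :: "real poly \<Rightarrow> real" where "lfun p = pmean p - poly p 1 / 24"

lemma lfun_linear:
  "lfun (p + q) = lfun p + lfun q" "lfun (p - q) = lfun p - lfun q" "lfun (smult c p) = c * lfun p"
  "lfun 0 = 0" "lfun (sum f A) = (\<Sum>i\<in>A. lfun (f i))"
  by (simp_all add: lfun_def pmean_add pmean_diff pmean_smult pmean_sum poly_sum
      sum_subtractf sum_divide_distrib add_divide_distrib diff_divide_distrib right_diff_distrib)

lemma lfun_monom: "lfun (monom 1 k) = cmom k 0 - 1 / 24"
  using ccoef_monom[of k 0] by (simp add: lfun_def ccoef_0_right poly_monom)

lemma lfun_cheb: "0 < n \<Longrightarrow> lfun (cheb n) = - (real n + 1) / 24"
  by (simp add: lfun_def pmean_cheb poly_cheb_1 field_simps)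

section \<open>Interpolatory quadrature for \<open>lfun\<close>\<close>

definition node_poly :: "nat set \<Rightarrow> (nat \<Rightarrow> real) \<Rightarrow> real poly" where
  "node_poly I x = (\<Prod>i\<in>I. [:- x i, 1:])"

text \<open>The value of \<open>lfun\<close> on the Lagrange basis polynomial of node
  \<open>i\<close>.\<close>

definition node_weight :: "nat set \<Rightarrow> (nat \<Rightarrow> real) \<Rightarrow> nat \<Rightarrow> real" where
  "node_weight I x i = lfun (node_poly (I - {i}) x) / poly (node_poly (I - {i}) x) (x i)"

lemma degree_node_poly: "finite I \<Longrightarrow> degree (node_poly I x) = card I"
  unfolding node_poly_def by (subst degree_prod_eq_sum_degree) auto

lemma node_poly_eq_0_iff: "finite I \<Longrightarrow> poly (node_poly I x) t = 0 \<longleftrightarrow> t \<in> x ` I"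
  by (auto simp: node_poly_def poly_prod)

lemma lfun_node_weight:
  assumes I: "finite I" "inj_on x I" and p: "degree p < card I"
  shows "lfun p = (\<Sum>i\<in>I. node_weight I x i * poly p (x i))"
proof -
  let ?l = "\<lambda>i. node_poly (I - {i}) x"
  have nz: "poly (?l i) (x i) \<noteq> 0" if "i \<in> I" for i
    using I that by (subst node_poly_eq_0_iff) (auto dest: inj_onD)
  have z: "poly (?l i) (x j) = 0" if "j \<in> I" "j \<noteq> i" for i j
    using I that by (subst node_poly_eq_0_iff) auto
  have "p = (\<Sum>i\<in>I. smult (poly p (x i) / poly (?l i) (x i)) (?l i))" (is "p = ?q")
  proof (rule poly_eqI_degree[of "x ` I"])
    fix t assume "t \<in> x ` I"
    then obtain j where j: "j \<in> I" "t = x j" by auto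
    have "poly ?q (x j) = (\<Sum>i\<in>I. if i = j then poly p (x j) else 0)"
      unfolding poly_sum using nz[OF j(1)] z j(1) by (intro sum.cong) auto
    then show "poly p t = poly ?q t" using j I by simp
  next
    show "degree p < card (x ` I)" using p I by (simp add: card_image)
    have "degree ?q \<le> card I - 1"
      using I by (intro degree_sum_le order.trans[OF degree_smult_le]) (auto simp: degree_node_poly)
    then show "degree ?q < card (x ` I)" using p I by (simp add: card_image)
  qed
  then have "lfun p = lfun ?q" by simp
  then show ?thesis by (simp add: lfun_linear node_weight_def mult.commute)
qed

text \<open>Gauss's argument: divide \<open>p\<close> by the node polynomial. The quotient has
  degree below \<open>m\<close>, so its product with the node polynomial is annihilated; the
  remainder has the same values at the nodes and is determined by them.\<close>

lemma lfun_node_weight_exact: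
  assumes I: "finite I" "inj_on x I" "I \<noteq> {}"
    and ann: "\<And>k. k < m \<Longrightarrow> lfun (node_poly I x * monom 1 k) = 0" and p: "degree p < card I + m"
  shows "lfun p = (\<Sum>i\<in>I. node_weight I x i * poly p (x i))"
proof -
  let ?w = "node_poly I x"
  have w: "?w \<noteq> 0" using I by (auto simp: node_poly_def)
  define q r where "q = p div ?w" "r = p mod ?w"
  have pqr: "p = ?w * q + r" by (simp add: q_r_def)
  have r: "degree r < card I"
    using degree_mod_less[of ?w p] w I card_gt_0_iff[of I]
    by (auto simp: q_r_def degree_node_poly)
  have "lfun (?w * q) = 0"
  proof (cases "q = 0")
    case False
    have "degree (?w * q) \<le> max (degree p) (degree r)"
      using degree_diff_le_max[of p r] pqr by simp
    then have "card I + degree q < card I + m"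
      using False w p r I by (simp add: degree_mult_eq degree_node_poly max_def split: if_splits)
    then have q: "degree q < m" by simp
    have "q = (\<Sum>k\<le>degree q. smult (coeff q k) (monom 1 k))"
      using poly_as_sum_of_monoms[of q] by (simp add: smult_monom)
    then have "?w * q = (\<Sum>k\<le>degree q. smult (coeff q k) (?w * monom 1 k))"
      by (metis (no_types, lifting) mult_smult_right sum.cong sum_distrib_left)
    then show ?thesis using q by (simp add: lfun_linear ann)
  qed (simp add: lfun_linear)
  then have "lfun p = lfun r" by (subst pqr) (simp add: lfun_linear)
  also have "\<dots> = (\<Sum>i\<in>I. node_weight I x i * poly r (x i))"
    by (rule lfun_node_weight[OF I(1,2) r])
  also have "\<dots> = (\<Sum>i\<in>I. node_weight I x i * poly p (x i))"
    using node_poly_eq_0_iff[OF I(1), of x] by (intro sum.cong refl) (subst pqr, auto)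
  finally show ?thesis .
qed

lemma quadrature_rule_4_24_iff:
  "quadrature_rule 4 24 (poly ` P) m \<beta> \<theta> \<longleftrightarrow> strict_mono_on {1..m} \<beta> \<and>
     (\<forall>i\<in>{1..m}. -1 \<le> \<beta> i \<and> \<beta> i < 1 \<and> 0 < \<theta> i) \<and>
     (\<forall>p\<in>P. lfun p = (\<Sum>i=1..m. \<theta> i * poly p (\<beta> i)))"
  by (auto simp: quadrature_rule_def lfun_def pmean_def)

lemma Lambda43_iff: "p \<in> Lambda43 \<longleftrightarrow> degree p \<le> 9 \<and> ccoef p 6 = 0 \<and> ccoef p 7 = 0"
proof
  assume "p \<in> Lambda43"
  then obtain q a b where p: "p = q + (smult a (gegenbauer 4 8) + smult b (gegenbauer 4 9))" and q: "degree q \<le> 5"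
    by (auto simp: Lambda43_def polys_upto_def)
  have "degree p \<le> 9" unfolding p gegenbauer_4 using q
    by (intro degree_add_le order.trans[OF degree_smult_le]) auto
  then show "degree p \<le> 9 \<and> ccoef p 6 = 0 \<and> ccoef p 7 = 0"
    using q by (simp add: p gegenbauer_4 ccoef_cheb ccoef_eq_0)
next
  assume p: "degree p \<le> 9 \<and> ccoef p 6 = 0 \<and> ccoef p 7 = 0"
  have s: "{..9::nat} = {..5} \<union> {6, 7, 8, 9}" by auto
  have "p = (\<Sum>i\<le>9. smult (ccoef p i) (cheb i))" using p by (intro cheb_expansion) simp
  also have "\<dots> = (\<Sum>i\<le>5. smult (ccoef p i) (cheb i)) + (smult (ccoef p 8) (cheb 8) + smult (ccoef p 9) (cheb 9))"
    unfolding s by (subst sum.union_disjoint) (use p in auto)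
  also have "\<dots> = (\<Sum>i\<le>5. smult (ccoef p i) (cheb i)) + (smult (9 * ccoef p 8) (gegenbauer 4 8) + smult (10 * ccoef p 9) (gegenbauer 4 9))"
    by (simp add: gegenbauer_4)
  finally have e: "p = \<dots>" .
  have "degree (\<Sum>i\<le>5. smult (ccoef p i) (cheb i)) \<le> 5"
    by (intro degree_sum_le order.trans[OF degree_smult_le]) auto
  then show "p \<in> Lambda43" unfolding Lambda43_def polys_upto_def mem_Collect_eq using e by blast
qed

lemma polys_upto_5_subset_Lambda43: "polys_upto 5 \<subseteq> Lambda43"
  by (auto simp: polys_upto_def Lambda43_iff ccoef_eq_0)

section \<open>Linear programming: duality and energy bounds\<close>

lemma poly_in_A_class_4:
  assumes "\<And>i. 1 \<le> i \<Longrightarrow> 0 \<le> ccoef p i" and le: "\<And>t. t \<in> {-1..1} \<Longrightarrow> ereal (poly p t) \<le> h t"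
  shows "poly p \<in> A_class 4 h"
proof -
  have "(\<lambda>i. (real i + 1) * ccoef p i * poly (gegenbauer 4 i) t) sums poly p t" for t
  proof -
    have e: "(real i + 1) * ccoef p i * poly (gegenbauer 4 i) t = ccoef p i * poly (cheb i) t" for i
      by (simp add: poly_gegenbauer_4)
    have "(\<lambda>i. ccoef p i * poly (cheb i) t) sums (\<Sum>i\<le>degree p. ccoef p i * poly (cheb i) t)"
      by (rule sums_finite) (auto simp: ccoef_eq_0)
    also have "(\<Sum>i\<le>degree p. ccoef p i * poly (cheb i) t) = poly p t"
      by (subst (3) cheb_expansion[OF order_refl]) (simp add: poly_sum)
    finally show ?thesis unfolding e .
  qed
  then show ?thesis unfolding A_class_def using assms
    by (auto intro!: exI[of _ "\<lambda>i. (real i + 1) * ccoef p i"] continuous_intros)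
qed

text \<open>\<open>A_class\<close> only supplies some series, and nothing says that it is finite
  when the function is a polynomial. All Gegenbauer polynomials equal 1 at 1, so the tail of
  \<open>c\<close> bounds the tail of the series at every \<open>t\<close>, and the mean may be
  taken termwise.\<close>

lemma A_class_4_coeff:
  assumes c: "\<And>i. 1 \<le> i \<Longrightarrow> 0 \<le> c i"
    and s: "\<And>t. t \<in> {-1..1} \<Longrightarrow> (\<lambda>i. c i * poly (gegenbauer 4 i) t) sums poly p t"
  shows "pmean p = c 0"
proof -
  have c1: "c sums poly p 1" using s[of 1] by (simp add: poly_gegenbauer_4 poly_cheb_1)
  \<comment> \<open>With \<open>Suc n\<close> terms the constant term, the only one of nonzero mean,
    is always present.\<close>
  define S where "S n = (\<Sum>i<Suc n. smult (c i) (gegenbauer 4 i))" for n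
  have S: "pmean (S n) = c 0" for n
    unfolding S_def gegenbauer_4 by (subst sum.lessThan_Suc_shift) (simp add: pmean_add pmean_sum pmean_smult pmean_cheb pmean_const)
  have "\<bar>pmean (p - S n)\<bar> \<le> poly p 1 - sum c {..<Suc n}" for n
  proof (rule abs_pmean_le)
    fix t :: real assume t: "t \<in> {-1..1}"
    have A: "(\<lambda>i. c (i + Suc n)) sums (poly p 1 - sum c {..<Suc n})"
      using c1 by (rule sums_split_initial_segment)
    have B: "(\<lambda>i. c (i + Suc n) * poly (gegenbauer 4 (i + Suc n)) t) sums
        (poly p t - (\<Sum>i<Suc n. c i * poly (gegenbauer 4 i) t))"
      by (rule sums_split_initial_segment[OF s[OF t]])
    have "\<bar>c (i + Suc n) * poly (gegenbauer 4 (i + Suc n)) t\<bar> \<le> c (i + Suc n)" for i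
      using c[of "i + Suc n"] abs_gegenbauer_4_le[OF t] by (simp add: abs_mult mult_left_le)
    then have "\<bar>poly p t - (\<Sum>i<Suc n. c i * poly (gegenbauer 4 i) t)\<bar> \<le> poly p 1 - sum c {..<Suc n}"
      using sums_le[OF _ B A] sums_le[OF _ sums_minus[OF A] B] by (simp add: abs_le_iff minus_le_iff)
    then show "\<bar>poly (p - S n) t\<bar> \<le> poly p 1 - sum c {..<Suc n}"
      by (simp add: S_def poly_sum)
  qed
  then have "\<bar>pmean p - c 0\<bar> \<le> poly p 1 - sum c {..<Suc n}" for n by (simp add: pmean_diff S)
  moreover have "(\<lambda>n. poly p 1 - sum c {..<Suc n}) \<longlonglongrightarrow> poly p 1 - poly p 1"
    by (intro tendsto_diff tendsto_const LIMSEQ_Suc) (use c1 in \<open>simp add: sums_def\<close>)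
  ultimately have "\<bar>pmean p - c 0\<bar> \<le> 0"
    by (intro LIMSEQ_le_const[of _ 0]) auto
  then show ?thesis by simp
qed

text \<open>Weak duality: adding the expansions of \<open>p\<close> at 1 and at the nodes gives the
  series of \<open>c j\<close> times the test functions. Its terms with \<open>j \<ge> 1\<close> are
  nonnegative, and the term \<open>j = 0\<close> is the mean of \<open>p\<close> because the weights
  and \<open>1/24\<close> add up to 1.\<close>

lemma lfun_le_quadrature_sum:
  assumes p: "poly p \<in> A_class 4 h" and Q0: "(\<Sum>i=1..m. \<theta> i) = 23/24"
    and Q: "\<And>j. 1 \<le> j \<Longrightarrow> 0 \<le> test_function 4 24 m \<beta> \<theta> j"
    and \<beta>: "\<And>i. i \<in> {1..m} \<Longrightarrow> \<beta> i \<in> {-1..1}"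
  shows "lfun p \<le> (\<Sum>i=1..m. \<theta> i * poly p (\<beta> i))"
proof -
  obtain c where c: "\<And>i. 1 \<le> i \<Longrightarrow> 0 \<le> c i"
    and s: "\<And>t. t \<in> {-1..1} \<Longrightarrow> (\<lambda>i. c i * poly (gegenbauer 4 i) t) sums poly p t"
    using p unfolding A_class_def by blast
  have "(\<lambda>j. 1/24 * (c j * poly (gegenbauer 4 j) 1) + (\<Sum>i=1..m. \<theta> i * (c j * poly (gegenbauer 4 j) (\<beta> i))))
      sums (1/24 * poly p 1 + (\<Sum>i=1..m. \<theta> i * poly p (\<beta> i)))"
    by (intro sums_add sums_mult sums_sum s \<beta>) auto
  also have "(\<lambda>j. 1/24 * (c j * poly (gegenbauer 4 j) 1) + (\<Sum>i=1..m. \<theta> i * (c j * poly (gegenbauer 4 j) (\<beta> i))))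
      = (\<lambda>j. c j * test_function 4 24 m \<beta> \<theta> j)"
    by (simp add: fun_eq_iff test_function_def poly_gegenbauer_4 poly_cheb_1 distrib_left sum_distrib_left mult_ac)
  finally have sm: "(\<lambda>j. c j * test_function 4 24 m \<beta> \<theta> j) sums (1/24 * poly p 1 + (\<Sum>i=1..m. \<theta> i * poly p (\<beta> i)))" .
  have "(\<Sum>j\<in>{0}. c j * test_function 4 24 m \<beta> \<theta> j) \<le> 1/24 * poly p 1 + (\<Sum>i=1..m. \<theta> i * poly p (\<beta> i))"
    unfolding sums_unique[OF sm]
    by (rule sum_le_suminf) (use c Q sm in \<open>auto simp: sums_iff\<close>)
  moreover have "test_function 4 24 m \<beta> \<theta> 0 = 1"
    using Q0 by (simp add: test_function_def poly_gegenbauer_4)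
  ultimately show ?thesis using A_class_4_coeff[OF c s] by (simp add: lfun_def)
qed

text \<open>The Delsarte-Yudin bound. In the sum of \<open>f\<close> over all ordered pairs, the
  components of positive degree are nonnegative, the constant one gives \<open>24^2\<close> times
  the mean, and the diagonal accounts for \<open>24 * f 1\<close>. The degree is limited to 9 by the
  spherical design.\<close>

lemma lfun_le_energy:
  fixes C :: "(real ^ 4) set"
  assumes C: "C \<subseteq> sphere 0 1" "finite C" "card C = 24"
    and f: "degree f \<le> 9" "\<And>i. 1 \<le> i \<Longrightarrow> 0 \<le> ccoef f i"
    and h: "\<And>t. t \<in> {-1..<1} \<Longrightarrow> ereal (poly f t) \<le> h t"
  shows "ereal (24\<^sup>2 * lfun f) \<le> energy h C"
proof -
  let ?P = "{(x, y). x \<in> C \<and> y \<in> C \<and> x \<noteq> y}"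
  have xx: "x \<bullet> x = 1" if "x \<in> C" for x using C that by (auto simp: dot_square_norm)
  have fe: "poly f t = (\<Sum>i\<le>9. ccoef f i * poly (cheb i) t)" for t
    by (subst cheb_expansion[OF f(1)]) (simp add: poly_sum)
  have "24\<^sup>2 * pmean f = ccoef f 0 * (\<Sum>x\<in>C. \<Sum>y\<in>C. poly (cheb 0) (x \<bullet> y))"
    by (simp add: ccoef_0_right C(3) power2_eq_square)
  also have "\<dots> \<le> (\<Sum>i\<le>9. ccoef f i * (\<Sum>x\<in>C. \<Sum>y\<in>C. poly (cheb i) (x \<bullet> y)))"
    using f(2) sum_cheb_inner_nonneg[OF C(1)]
    by (subst sum.atMost_shift) (auto intro!: sum_nonneg simp del: cheb.simps)
  also have "\<dots> = (\<Sum>x\<in>C. \<Sum>y\<in>C. poly f (x \<bullet> y))"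
    unfolding fe sum_distrib_left by (subst (2) sum.swap, subst sum.swap) (rule refl)
  also have "\<dots> = (\<Sum>(x, y)\<in>C \<times> C. poly f (x \<bullet> y))" by (simp add: sum.cartesian_product)
  also have "C \<times> C = ?P \<union> (\<lambda>x. (x, x)) ` C" by auto
  also have "(\<Sum>(x, y)\<in>?P \<union> (\<lambda>x. (x, x)) ` C. poly f (x \<bullet> y))
     = (\<Sum>(x, y)\<in>?P. poly f (x \<bullet> y)) + (\<Sum>(x, y)\<in>(\<lambda>x. (x, x)) ` C. poly f (x \<bullet> y))"
    by (rule sum.union_disjoint) (use C(2) in \<open>auto intro: finite_subset[of _ "C \<times> C"]\<close>)
  also have "(\<Sum>(x, y)\<in>(\<lambda>x. (x, x)) ` C. poly f (x \<bullet> y)) = 24 * poly f 1"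
    using xx C(3) by (subst sum.reindex) (auto simp: inj_on_def)
  finally have "24\<^sup>2 * lfun f \<le> (\<Sum>(x, y)\<in>?P. poly f (x \<bullet> y))"
    by (simp add: lfun_def)
  then have "ereal (24\<^sup>2 * lfun f) \<le> (\<Sum>(x, y)\<in>?P. ereal (poly f (x \<bullet> y)))"
    by (simp add: split_def)
  also have "\<dots> \<le> energy h C" unfolding energy_def
  proof (intro sum_mono, clarify)
    fix x y assume xy: "x \<in> C" "y \<in> C" "x \<noteq> y"
    have n: "norm x = 1" "norm y = 1" using xy C by auto
    then have "\<bar>x \<bullet> y\<bar> \<le> 1" using Cauchy_Schwarz_ineq2[of x y] by simp
    moreover have "0 < (x - y) \<bullet> (x - y)" using xy by simp
    then have "x \<bullet> y < 1" using xx xy by (simp add: inner_diff inner_commute)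
    ultimately show "ereal (poly f (x \<bullet> y)) \<le> h (x \<bullet> y)" by (intro h) auto
  qed
  finally show ?thesis .
qed

lemma lfun_le_min_energy4:
  assumes "degree f \<le> 9" "\<And>i. 1 \<le> i \<Longrightarrow> 0 \<le> ccoef f i"
    and "\<And>t. t \<in> {-1..<1} \<Longrightarrow> ereal (poly f t) \<le> h t"
  shows "ereal (24\<^sup>2 * lfun f) \<le> min_energy4 h 24"
  unfolding min_energy4_def using lfun_le_energy[OF _ _ _ assms] by (intro INF_greatest) auto

lemma absolutely_monotone_amon:
  assumes "absolutely_monotone h"
  obtains g where "amon g" "\<And>t. t \<in> {-1..<1} \<Longrightarrow> h t = ereal (g t)"
  using assms unfolding absolutely_monotone_def amon_def by metis

lemma absolutely_monotone_le_at_1: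
  assumes h: "absolutely_monotone h" and le: "\<And>t. t \<in> {-1..<1} \<Longrightarrow> ereal (poly f t) \<le> h t"
    and t: "t \<in> {-1..1}"
  shows "ereal (poly f t) \<le> h t"
proof (cases "t = 1")
  case True
  have "(h \<longlongrightarrow> h 1) (at_left 1)" using h by (simp add: absolutely_monotone_def)
  moreover have "((\<lambda>t. ereal (poly f t)) \<longlongrightarrow> ereal (poly f 1)) (at_left 1)"
    using continuous_at_imp_continuous_within[OF poly_isCont, of 1 "{..<1}" f]
    by (intro tendsto_ereal) (simp add: continuous_within)
  moreover have "eventually (\<lambda>t. ereal (poly f t) \<le> h t) (at_left 1)"
    unfolding eventually_at_left_field by (rule exI[of _ "-1"]) (auto intro!: le)
  ultimately have "ereal (poly f 1) \<le> h 1" by (intro tendsto_le[of "at_left 1"]) auto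
  then show ?thesis using True by simp
qed (use le t in auto)

section \<open>Existence of the nodes\<close>

definition appr :: "real \<Rightarrow> real \<Rightarrow> real \<Rightarrow> bool" where "appr x m e \<longleftrightarrow> \<bar>x - m\<bar> \<le> e"

lemma appr_numeral: "appr (numeral k) (numeral k) 0" "appr 1 1 0" "appr 0 0 0"
  by (simp_all add: appr_def)

lemma appr_add: "appr x m e \<Longrightarrow> appr y n f \<Longrightarrow> appr (x + y) (m + n) (e + f)"
  and appr_diff: "appr x m e \<Longrightarrow> appr y n f \<Longrightarrow> appr (x - y) (m - n) (e + f)"
  and appr_minus: "appr x m e \<Longrightarrow> appr (- x) (- m) e"
  by (auto simp: appr_def)

lemma appr_mult:
  assumes "appr x m e" "appr y n f"
  shows "appr (x * y) (m * n) (\<bar>m\<bar> * f + \<bar>n\<bar> * e + e * f)"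
proof -
  have "x * y - m * n = m * (y - n) + n * (x - m) + (x - m) * (y - n)" by (simp add: algebra_simps)
  also have "\<bar>\<dots>\<bar> \<le> \<bar>m\<bar> * \<bar>y - n\<bar> + \<bar>n\<bar> * \<bar>x - m\<bar> + \<bar>x - m\<bar> * \<bar>y - n\<bar>"
    by (intro order.trans[OF abs_triangle_ineq] add_mono) (simp_all add: abs_mult)
  also have "\<dots> \<le> \<bar>m\<bar> * f + \<bar>n\<bar> * e + e * f"
    using assms by (intro add_mono mult_mono mult_left_mono) (auto simp: appr_def)
  finally show ?thesis by (simp add: appr_def)
qed

lemma appr_divide: "appr x m e \<Longrightarrow> appr (x / numeral k) (m / numeral k) (e / numeral k)"
  by (simp add: appr_def divide_right_mono flip: diff_divide_distrib)

text \<open>Resolving \<open>appr e ?m ?r\<close> with these rules evaluates \<open>e\<close> in ball arithmetic.\<close>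

lemmas appr_intros = appr_numeral appr_add appr_diff appr_minus appr_mult appr_divide

text \<open>Rounding: exact ball arithmetic accumulates long rationals; short ones are substituted
  at the cost of the shift of the centre.\<close>

lemma appr_weaken: "appr x m e \<Longrightarrow> \<bar>m - n\<bar> + e \<le> f \<Longrightarrow> appr x n f"
  unfolding appr_def by linarith

lemma appr_pos: "appr x m e \<Longrightarrow> e < m \<Longrightarrow> 0 < x"
  unfolding appr_def by linarith

text \<open>For \<open>w = t\<^sup>4 + a t\<^sup>3 + b t\<^sup>2 + c t + d\<close> with \<open>a = 3 + 8 b + 38 d\<close> and \<open>c = - 1 - 3 b - 15 d\<close>,
  which makes \<open>lfun w\<close> and \<open>lfun (t w)\<close> vanish, let \<open>q\<^sub>k\<close> be the moments of the rule at the
  roots of \<open>w\<close>.  Then \<open>24 q\<^sub>6\<close> and \<open>24 q\<^sub>7\<close> are the next two polynomials, and exactness for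
  the Gegenbauer polynomials of degrees 8 and 9 amounts to \<open>eqn8 = eqn9 = 0\<close>.\<close>

definition mom6 :: "real \<Rightarrow> real \<Rightarrow> real" where "mom6 b d = 2 + 3 * b + 18 * d"

definition mom7 :: "real \<Rightarrow> real \<Rightarrow> real" where
  "mom7 b d = - ((3 + 8 * b + 38 * d) * mom6 b d - b + 2 * (- 1 - 3 * b - 15 * d) - d)"

definition eqn8 :: "real \<Rightarrow> real \<Rightarrow> real" where
  "eqn8 b d = 32 * ((3 + 8 * b + 38 * d) * mom7 b d + b * mom6 b d - (- 1 - 3 * b - 15 * d) + 2 * d) + 56 * mom6 b d - 39"

definition eqn9 :: "real \<Rightarrow> real \<Rightarrow> real" where
  "eqn9 b d = (3 + 8 * b + 38 * d) * (56 * mom6 b d - 39) + 32 * ((b + 2) * mom7 b d + (- 1 - 3 * b - 15 * d) * mom6 b d + 1 - d)"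

text \<open>Brouwer's theorem is applied to a Newton step with a fixed approximate inverse Jacobian.\<close>

lemma ex_eqn8_eqn9:
  obtains b d where "eqn8 b d = 0" "eqn9 b d = 0"
    "appr b (- (13525421613 / 250000000000)) (1 / 10 ^ 12)" "appr d (- (39470257467 / 1000000000000)) (1 / 10 ^ 12)"
proof -
  \<comment> \<open>\<open>X\<close> and \<open>Y\<close> are displacements from the approximate
    root in units of \<open>10^-12\<close>, so that the box becomes the square with vertices (-1,
    -1) and (1, 1).\<close>
  let ?b = "\<lambda>X::real. (X - 54101686452) / 10 ^ 12" and ?d = "\<lambda>Y::real. (Y - 39470257467) / 10 ^ 12"
  \<comment> \<open>The multipliers here and in \<open>T2\<close> are \<open>10^28\<close> times the
    rounded entries of minus the inverse Jacobian of \<open>(10^36 * eqn8, 10^36 * eqn9)\<close> in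
    \<open>X, Y\<close>. Both equations are cubic with integer coefficients, so \<open>10^36\<close>
    clears all denominators.\<close>
  define T1 where "T1 X Y = (10 ^ 28 * X + 4475 * (10 ^ 36 * eqn8 (?b X) (?d Y)) - 3544 * (10 ^ 36 * eqn9 (?b X) (?d Y))) / 10000000000000000000000000000" for X Y
  define T2 where "T2 X Y = (10 ^ 28 * Y - 753 * (10 ^ 36 * eqn8 (?b X) (?d Y)) + 612 * (10 ^ 36 * eqn9 (?b X) (?d Y))) / 10000000000000000000000000000" for X Y
  have E: "10 ^ 36 * eqn8 (?b X) (?d Y) = (-54738972376694850638479104) + (-89582690551106390520404352) * X + (-518895592097145952919645952) * Y + (-2059966156219392) * X * X + (-22530926595389184) * X * Y + (-61113914928398592) * Y * Y + (-6144) * X * X * X + (-95232) * X * X * Y + (-488832) * X * Y * Y + (-831744) * Y * Y * Y"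
    "10 ^ 36 * eqn9 (?b X) (?d Y) = (-68281931294374354249680384) + (-110290056694875777170499456) * X + (-655182135386727014982187008) * Y + (-605483268767040) * X * X + (-5778822962429184) * X * Y + (-12927822286938624) * Y * Y + (-768) * X * X * X + (-8256) * X * X * Y + (-21888) * X * Y * Y" for X Y
  proof -
    have a: "3 + 8 * ?b X + 38 * ?d Y = ((1067316724638) + (8) * X + (38) * Y) / 10 ^ 12" and c: "- 1 - 3 * ?b X - 15 * ?d Y = ((-245641078639) + (-3) * X + (-15) * Y) / 10 ^ 12"
      by (simp_all add: field_simps)
    have m6: "mom6 (?b X) (?d Y) = ((1127230306238) + (3) * X + (18) * Y) / 10 ^ 12"
      unfolding mom6_def by (simp add: field_simps)
    have m7: "mom7 (?b X) (?d Y) = ((-805401545007631859691844) + (-5219792623818) * X + (-31046452680528) * Y + (-24) * X * X + (-258) * X * Y + (-684) * Y * Y) / 10 ^ 24"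
      unfolding mom7_def m6 a c by (simp add: field_simps)
    show "10 ^ 36 * eqn8 (?b X) (?d Y) = (-54738972376694850638479104) + (-89582690551106390520404352) * X + (-518895592097145952919645952) * Y + (-2059966156219392) * X * X + (-22530926595389184) * X * Y + (-61113914928398592) * Y * Y + (-6144) * X * X * X + (-95232) * X * X * Y + (-488832) * X * Y * Y + (-831744) * Y * Y * Y"
      unfolding eqn8_def m6 m7 a c by (simp add: field_simps)
    show "10 ^ 36 * eqn9 (?b X) (?d Y) = (-68281931294374354249680384) + (-110290056694875777170499456) * X + (-655182135386727014982187008) * Y + (-605483268767040) * X * X + (-5778822962429184) * X * Y + (-12927822286938624) * Y * Y + (-768) * X * X * X + (-8256) * X * X * Y + (-21888) * X * Y * Y"
      unfolding eqn9_def m6 m7 a c by (simp add: field_simps)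
  qed
  have T1: "T1 X Y = ((-2965736878446745146326709504) + (-14579289561343286559403136) * X + (-92286824167598218544878848) * Y + (-7072515844571389440) * X * X + (-80345747935517570304) * X * Y + (-227668567119673215744) * Y * Y + (-24772608) * X * X * X + (-396903936) * X * X * Y + (-2109952128) * X * Y * Y + (-3722054400) * Y * Y * Y) / 10000000000000000000000000000" for X Y
    unfolding T1_def E by (rule arg_cong[of _ _ "\<lambda>x. x / 10000000000000000000000000000"]) (simp only: ring_distribs, simp)
  have T2: "T2 X Y = ((-570095752505882270029629696) + (-41748712280863566481190016) * X + (-243086007526030620605047040) * Y + (1180598755147773696) * X * X + (13429148073321394944) * X * Y + (38106950701477701888) * Y * Y + (4156416) * X * X * X + (66657024) * X * X * Y + (354695040) * X * Y * Y + (626303232) * Y * Y * Y) / 10000000000000000000000000000" for X Y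
    unfolding T2_def E by (rule arg_cong[of _ _ "\<lambda>x. x / 10000000000000000000000000000"]) (simp only: ring_distribs, simp)
  have cont: "continuous_on S (\<lambda>z. (c0 + c1 * fst z + c2 * snd z + c3 * fst z * fst z + c4 * fst z * snd z + c5 * snd z * snd z
      + c6 * fst z * fst z * fst z + c7 * fst z * fst z * snd z + c8 * fst z * snd z * snd z + c9 * snd z * snd z * snd z) / k)"
    for c0 c1 c2 c3 c4 c5 c6 c7 c8 c9 k :: real and S :: "(real \<times> real) set"
    unfolding divide_inverse by (intro continuous_intros)
  let ?K = "cbox (- 1, - 1) (1, 1) :: (real \<times> real) set"
  let ?T = "\<lambda>z. (T1 (fst z) (snd z), T2 (fst z) (snd z))"
  have "continuous_on ?K ?T"
    unfolding T1 T2 by (intro continuous_on_Pair cont)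
  moreover have "?T \<in> ?K \<rightarrow> ?K"
  proof (rule funcsetI)
    fix z assume z: "z \<in> ?K"
    define X Y where "X = fst z" "Y = snd z"
    then have X: "appr X 0 1" and Y: "appr Y 0 1" using z by (cases z; auto simp: appr_def cbox_Pair_eq)+
    have "appr (T1 X Y) 0 1" unfolding T1
      by (rule appr_weaken, (rule X Y appr_intros)+, simp)
    moreover have "appr (T2 X Y) 0 1" unfolding T2
      by (rule appr_weaken, (rule X Y appr_intros)+, simp)
    ultimately show "?T z \<in> ?K"
      by (auto simp: appr_def cbox_Pair_eq X_Y_def)
  qed
  moreover have "?K \<noteq> {}" by (simp add: cbox_Pair_eq)
  ultimately obtain z where "z \<in> ?K" "?T z = z"
    using brouwer[OF compact_cbox convex_box(1)] by blast
  then obtain X Y where XY: "(X, Y) \<in> ?K" "T1 X Y = X" "T2 X Y = Y" by (cases z) auto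
  \<comment> \<open>At a fixed point two combinations of \<open>eqn8\<close> and \<open>eqn9\<close>
    vanish, and their coefficient matrix has determinant
    \<open>4475 * 612 - 3544 * 753 = 70068\<close>.\<close>
  have "eqn8 (?b X) (?d Y) = 0" "eqn9 (?b X) (?d Y) = 0"
    using XY(2,3) unfolding T1_def T2_def by (simp_all add: field_simps)
  moreover have "appr X 0 1" "appr Y 0 1" using XY(1) by (auto simp: appr_def cbox_Pair_eq)
  then have "appr (?b X) (- (13525421613 / 250000000000)) (1 / 10 ^ 12)" "appr (?d Y) (- (39470257467 / 1000000000000)) (1 / 10 ^ 12)"
    by (auto simp: appr_def abs_if field_simps split: if_splits)
  ultimately show thesis using that by blast
qed

text \<open>All that later proofs know of the nodes: identities come from \<open>vieta\<close>,
  \<open>eqn8\<close> and \<open>eqn9\<close>, numerical inequalities from the balls. The balls of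
  \<open>b\<close> and \<open>d\<close> are much smaller than those of the nodes.\<close>

locale second_level =
  fixes b1 b2 b3 b4 b d :: real
  assumes vieta: "[:- b1, 1:] * [:- b2, 1:] * [:- b3, 1:] * [:- b4, 1:] = [:d, - 1 - 3 * b - 15 * d, b, 3 + 8 * b + 38 * d, 1:]"
    and eqn8: "eqn8 b d = 0" and eqn9: "eqn9 b d = 0"
    and appr_b: "appr b (- (13525421613 / 250000000000)) (1 / 10 ^ 12)" and appr_d: "appr d (- (39470257467 / 1000000000000)) (1 / 10 ^ 12)"
    and appr_b1: "appr b1 (- (86029648883 / 100000000000)) (1 / 500000000)"
    and appr_b2: "appr b2 (- (489841966273 / 1000000000000)) (1 / 500000000)"
    and appr_b3: "appr b3 (- (9786172661 / 50000000000)) (1 / 500000000)"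
    and appr_b4: "appr b4 ((478545183689 / 1000000000000)) (1 / 500000000)"

lemma ex_second_level: "\<exists>b1 b2 b3 b4 b d. second_level b1 b2 b3 b4 b d"
proof -
  obtain b d where bd: "eqn8 b d = 0" "eqn9 b d = 0" and
    appr_b: "appr b (- (13525421613 / 250000000000)) (1 / 10 ^ 12)" and appr_d: "appr d (- (39470257467 / 1000000000000)) (1 / 10 ^ 12)"
    by (rule ex_eqn8_eqn9)
  define w where "w = [:d, - 1 - 3 * b - 15 * d, b, 3 + 8 * b + 38 * d, 1:]"
  have w: "poly w t = d + t * (- 1 - 3 * b - 15 * d + t * (b + t * (3 + 8 * b + 38 * d + t)))" for t
    by (simp add: w_def)
  have "0 < poly w (- (86029649083 / 100000000000))" "0 < - poly w (- (86029648683 / 100000000000))"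
    unfolding w by (rule appr_pos, (rule appr_b appr_d appr_intros)+, simp)+
  then obtain b1 where b1: "poly w b1 = 0" "appr b1 (- (86029648883 / 100000000000)) (1 / 500000000)"
    using poly_IVT_neg[of "- (86029649083 / 100000000000)" "- (86029648683 / 100000000000)" w] by (auto simp: appr_def abs_le_iff field_simps)
  have "0 < - poly w (- (489841968273 / 1000000000000))" "0 < poly w (- (489841964273 / 1000000000000))"
    unfolding w by (rule appr_pos, (rule appr_b appr_d appr_intros)+, simp)+
  then obtain b2 where b2: "poly w b2 = 0" "appr b2 (- (489841966273 / 1000000000000)) (1 / 500000000)"
    using poly_IVT_pos[of "- (489841968273 / 1000000000000)" "- (489841964273 / 1000000000000)" w] by (auto simp: appr_def abs_le_iff field_simps)
  have "0 < poly w (- (9786172761 / 50000000000))" "0 < - poly w (- (9786172561 / 50000000000))"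
    unfolding w by (rule appr_pos, (rule appr_b appr_d appr_intros)+, simp)+
  then obtain b3 where b3: "poly w b3 = 0" "appr b3 (- (9786172661 / 50000000000)) (1 / 500000000)"
    using poly_IVT_neg[of "- (9786172761 / 50000000000)" "- (9786172561 / 50000000000)" w] by (auto simp: appr_def abs_le_iff field_simps)
  have "0 < - poly w ((478545181689 / 1000000000000))" "0 < poly w ((478545185689 / 1000000000000))"
    unfolding w by (rule appr_pos, (rule appr_b appr_d appr_intros)+, simp)+
  then obtain b4 where b4: "poly w b4 = 0" "appr b4 ((478545183689 / 1000000000000)) (1 / 500000000)"
    using poly_IVT_pos[of "(478545181689 / 1000000000000)" "(478545185689 / 1000000000000)" w] by (auto simp: appr_def abs_le_iff field_simps)
  have ord: "b1 < b2" "b2 < b3" "b3 < b4"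
    using b1(2) b2(2) b3(2) b4(2) unfolding appr_def by linarith+
  \<comment> \<open>Two monic quartics with four distinct common roots: the difference has degree at
    most 3.\<close>
  have "[:- b1, 1:] * [:- b2, 1:] * [:- b3, 1:] * [:- b4, 1:] - w = 0"
  proof (rule poly_eqI_degree[of "{b1, b2, b3, b4}"])
    show "degree ([:- b1, 1:] * [:- b2, 1:] * [:- b3, 1:] * [:- b4, 1:] - w) < card {b1, b2, b3, b4}"
      using ord by (auto simp: w_def card_insert_if)
    show "poly ([:- b1, 1:] * [:- b2, 1:] * [:- b3, 1:] * [:- b4, 1:] - w) t = poly 0 t" if "t \<in> {b1, b2, b3, b4}" for t
      using that b1(1) b2(1) b3(1) b4(1) unfolding poly_diff poly_mult by auto
  qed (use ord in \<open>auto simp: card_insert_if\<close>)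
  then have "second_level b1 b2 b3 b4 b d"
    using bd appr_b appr_d b1(2) b2(2) b3(2) b4(2) by unfold_locales (simp_all add: w_def)
  then show ?thesis by blast
qed

section \<open>Hermite interpolation in the extended space\<close>

text \<open>The factor \<open>512 = 2^9\<close> clears the denominators of \<open>cmom k i\<close>
  for \<open>k \<le> 9\<close>.\<close>

lemma ccoef_degree_9:
  fixes l0 l1 l2 l3 l4 l5 l6 l7 l8 l9 :: real
  defines "p \<equiv> [:l0, l1, l2, l3, l4, l5, l6, l7, l8, l9:]"
  shows "512 * ccoef p 0 = 512 * l0 + 128 * l2 + 64 * l4 + 40 * l6 + 28 * l8"
    "512 * ccoef p 1 = 256 * l1 + 128 * l3 + 80 * l5 + 56 * l7 + 42 * l9"
    "512 * ccoef p 2 = 128 * l2 + 96 * l4 + 72 * l6 + 56 * l8"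
    "512 * ccoef p 3 = 64 * l3 + 64 * l5 + 56 * l7 + 48 * l9"
    "512 * ccoef p 4 = 32 * l4 + 40 * l6 + 40 * l8"
    "512 * ccoef p 5 = 16 * l5 + 24 * l7 + 27 * l9"
    "512 * ccoef p 6 = 8 * l6 + 14 * l8"
    "512 * ccoef p 7 = 4 * l7 + 8 * l9"
    "512 * ccoef p 8 = 2 * l8"
    "512 * ccoef p 9 = l9"
proof -
  have deg: "degree p \<le> 9" unfolding p_def by (simp add: degree_pCons_eq_if)
  have s: "{..9::nat} = {0, 1, 2, 3, 4, 5, 6, 7, 8, 9}" by auto
  have k: "coeff p 0 = l0" "coeff p 1 = l1" "coeff p 2 = l2" "coeff p 3 = l3" "coeff p 4 = l4" "coeff p 5 = l5"
    "coeff p 6 = l6" "coeff p 7 = l7" "coeff p 8 = l8" "coeff p 9 = l9"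
    by (simp_all add: p_def numeral_eq_Suc)
  have e: "ccoef p i = l0 * cmom 0 i + l1 * cmom 1 i + l2 * cmom 2 i + l3 * cmom 3 i + l4 * cmom 4 i + l5 * cmom 5 i
      + l6 * cmom 6 i + l7 * cmom 7 i + l8 * cmom 8 i + l9 * cmom 9 i" for i
    unfolding ccoef_eq_sum_monom[OF deg] s by (simp add: k k(2)[unfolded One_nat_def])
  show "512 * ccoef p 0 = 512 * l0 + 128 * l2 + 64 * l4 + 40 * l6 + 28 * l8"
    "512 * ccoef p 1 = 256 * l1 + 128 * l3 + 80 * l5 + 56 * l7 + 42 * l9"
    "512 * ccoef p 2 = 128 * l2 + 96 * l4 + 72 * l6 + 56 * l8"
    "512 * ccoef p 3 = 64 * l3 + 64 * l5 + 56 * l7 + 48 * l9"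
    "512 * ccoef p 4 = 32 * l4 + 40 * l6 + 40 * l8"
    "512 * ccoef p 5 = 16 * l5 + 24 * l7 + 27 * l9"
    "512 * ccoef p 6 = 8 * l6 + 14 * l8"
    "512 * ccoef p 7 = 4 * l7 + 8 * l9"
    "512 * ccoef p 8 = 2 * l8"
    "512 * ccoef p 9 = l9"
    unfolding e by (simp_all add: numeral_eq_Suc)
qed

context second_level
begin

definition a :: real where "a = 3 + 8 * b + 38 * d"
definition c :: real where "c = - 1 - 3 * b - 15 * d"
definition w :: "real poly" where "w = [:d, c, b, a, 1:]"
text \<open>The quotient of \<open>w\<close> by \<open>t - b4\<close> in Horner form. Its
  coefficients involve one node and the precisely known \<open>b\<close> and \<open>d\<close>, which
  keeps the balls small.\<close>

definition cub :: "real poly" where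
  "cub = [:c + b4 * (b + b4 * (a + b4)), b + b4 * (a + b4), a + b4, 1:]"

lemma cub_eq: "cub = [:- b1, 1:] * [:- b2, 1:] * [:- b3, 1:]"
  and w_eq: "w = cub * [:- b4, 1:]"
proof -
  have v: "a = - (b1 + b2 + b3 + b4)" "b = b1 * b2 + b1 * b3 + b2 * b3 + b4 * (b1 + b2 + b3)"
    "c = - (b1 * b2 * b3 + b4 * (b1 * b2 + b1 * b3 + b2 * b3))"
    using vieta by (simp_all add: a_def c_def algebra_simps)
  show e: "cub = [:- b1, 1:] * [:- b2, 1:] * [:- b3, 1:]"
  proof -
    have h1: "a + b4 = - b1 - b2 - b3" using v(1) by simp
    have h2: "b + b4 * (a + b4) = b1 * b2 + b1 * b3 + b2 * b3"
      unfolding h1 using v(2) by (simp add: algebra_simps)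
    have h3: "c + b4 * (b + b4 * (a + b4)) = - (b1 * b2 * b3)"
      unfolding h2 using v(3) by (simp add: algebra_simps)
    have "cub = [:- (b1 * b2 * b3), b1 * b2 + b1 * b3 + b2 * b3, - b1 - b2 - b3, 1:]"
      unfolding cub_def by (intro arg_cong2[of _ _ _ _ pCons] h1 h2 h3 refl)
    then show ?thesis by (simp add: algebra_simps)
  qed
  show "w = cub * [:- b4, 1:]"
    unfolding e using vieta by (simp add: w_def a_def c_def)
qed

text \<open>The first two polynomials are the Newton basis polynomials of degrees 6 and 7 for the doubled
  nodes.  Subtracting multiples of \<open>w\<^sup>2\<close> keeps all values and derivatives at the nodes, and
  the linear factors are found from the Chebyshev coefficients 6 and 7 by Cramer's rule.\<close>

lemma correctors:
  obtains p6 q6 p7 q7 where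
    "\<And>t. t \<in> {-1..1} \<Longrightarrow> 0 \<le> p6 + q6 * t" "\<And>t. t \<in> {-1..1} \<Longrightarrow> 0 \<le> p7 + q7 * t"
    "cub * cub - [:p6, q6:] * (w * w) \<in> Lambda43"
    "cub * cub * [:- b4, 1:] - [:p7, q7:] * (w * w) \<in> Lambda43"
    "\<And>i. 1 \<le> i \<Longrightarrow> 0 \<le> ccoef (cub * cub - [:p6, q6:] * (w * w)) i"
    "\<And>i. 1 \<le> i \<Longrightarrow> 0 \<le> ccoef (cub * cub * [:- b4, 1:] - [:p7, q7:] * (w * w)) i"
    "\<And>p q. ccoef ([:p, q:] * (w * w)) 6 = 0 \<Longrightarrow> ccoef ([:p, q:] * (w * w)) 7 = 0 \<Longrightarrow> p = 0 \<and> q = 0"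
proof -
  \<comment> \<open>Names of coefficients: \<open>u\<close> for \<open>cub\<close>, \<open>s\<close>
    for \<open>w * w\<close>, \<open>g\<close> for \<open>cub * cub\<close>, \<open>k\<close> for
    \<open>cub * cub * (t - b4)\<close>.\<close>
  define u2 where "u2 = a + b4"
  define u1 where "u1 = b + b4 * u2"
  define u0 where "u0 = c + b4 * u1"
  define s0 where "s0 = d * d"
  define s1 where "s1 = 2 * c * d"
  define s2 where "s2 = 2 * b * d + c * c"
  define s3 where "s3 = 2 * a * d + 2 * b * c"
  define s4 where "s4 = 2 * d + 2 * a * c + b * b"
  define s5 where "s5 = 2 * c + 2 * a * b"
  define s6 where "s6 = 2 * b + a * a"
  define s7 where "s7 = 2 * a"
  define g0 where "g0 = u0 * u0"
  define g1 where "g1 = 2 * u0 * u1"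
  define g2 where "g2 = 2 * u0 * u2 + u1 * u1"
  define g3 where "g3 = 2 * u0 + 2 * u1 * u2"
  define g4 where "g4 = 2 * u1 + u2 * u2"
  define g5 where "g5 = 2 * u2"
  define k0 where "k0 = - b4 * g0"
  define k1 where "k1 = g0 - b4 * g1"
  define k2 where "k2 = g1 - b4 * g2"
  define k3 where "k3 = g2 - b4 * g3"
  define k4 where "k4 = g3 - b4 * g4"
  define k5 where "k5 = g4 - b4 * g5"
  define k6 where "k6 = g5 - b4"
  \<comment> \<open>\<open>A6, A7\<close> and \<open>B6, B7\<close> are 256 times the Chebyshev
    coefficients 6 and 7 of \<open>w * w\<close> and \<open>t * w * w\<close>. On the same scale the
    right sides of the two linear systems are \<open>(4, 0)\<close> for \<open>cub * cub\<close> and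
    \<open>(4 * k6, 2)\<close> for the polynomial of degree 7.\<close>
  define A6 where "A6 = 4 * s6 + 7"
  define A7 where "A7 = 2 * s7"
  define B6 where "B6 = 4 * s5 + 7 * s7"
  define B7 where "B7 = 2 * s6 + 4"
  define det where "det = A6 * B7 - A7 * B6"
  define P6 where "P6 = 4 * B7"
  define Q6 where "Q6 = - (4 * A7)"
  define P7 where "P7 = 4 * k6 * B7 - 2 * B6"
  define Q7 where "Q7 = 2 * A6 - 4 * k6 * A7"
  \<comment> \<open>\<open>F\<close> and \<open>H\<close> are the coefficients of \<open>det\<close>
    times the corrected polynomials, so that ball arithmetic never divides by
    \<open>det\<close>.\<close>
  define F0 where "F0 = det * g0 - P6 * s0"
  define F1 where "F1 = det * g1 - P6 * s1 - Q6 * s0"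
  define F2 where "F2 = det * g2 - P6 * s2 - Q6 * s1"
  define F3 where "F3 = det * g3 - P6 * s3 - Q6 * s2"
  define F4 where "F4 = det * g4 - P6 * s4 - Q6 * s3"
  define F5 where "F5 = det * g5 - P6 * s5 - Q6 * s4"
  define F6 where "F6 = det - P6 * s6 - Q6 * s5"
  define F7 where "F7 = - (P6 * s7) - Q6 * s6"
  define F8 where "F8 = - (P6) - Q6 * s7"
  define F9 where "F9 = - (Q6)"
  define H0 where "H0 = det * k0 - P7 * s0"
  define H1 where "H1 = det * k1 - P7 * s1 - Q7 * s0"
  define H2 where "H2 = det * k2 - P7 * s2 - Q7 * s1"
  define H3 where "H3 = det * k3 - P7 * s3 - Q7 * s2"
  define H4 where "H4 = det * k4 - P7 * s4 - Q7 * s3"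
  define H5 where "H5 = det * k5 - P7 * s5 - Q7 * s4"
  define H6 where "H6 = det * k6 - P7 * s6 - Q7 * s5"
  define H7 where "H7 = det - P7 * s7 - Q7 * s6"
  define H8 where "H8 = - (P7) - Q7 * s7"
  define H9 where "H9 = - (Q7)"
  note u_defs = u0_def u1_def u2_def
  note s_defs = s0_def s1_def s2_def s3_def s4_def s5_def s6_def s7_def
  note g_defs = g0_def g1_def g2_def g3_def g4_def g5_def
  note k_defs = k0_def k1_def k2_def k3_def k4_def k5_def k6_def
  note A_defs = A6_def A7_def B6_def B7_def
  note pq_defs = P6_def Q6_def P7_def Q7_def
  note F_defs = F0_def F1_def F2_def F3_def F4_def F5_def F6_def F7_def F8_def F9_def
  note H_defs = H0_def H1_def H2_def H3_def H4_def H5_def H6_def H7_def H8_def H9_def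
  have h_a: "appr a (533658362319 / 500000000000) (23 / 500000000000)"
    unfolding a_def by (rule appr_weaken, (rule appr_b appr_d appr_intros)+, simp)
  have h_c: "appr c (- (245641078639 / 1000000000000)) (9 / 500000000000)"
    unfolding c_def by (rule appr_weaken, (rule appr_b appr_d appr_intros)+, simp)
  have h_u2: "appr u2 (1545861908327 / 1000000000000) (21 / 10000000000)"
    unfolding u2_def by (rule appr_weaken, (rule h_a appr_b4 appr_intros)+, simp)
  have h_u1: "appr u1 (342831542213 / 500000000000) (41 / 10000000000)"
    unfolding u1_def by (rule appr_weaken, (rule appr_b appr_b4 h_u2 appr_intros)+, simp)
  have h_u0: "appr u0 (41239844023 / 500000000000) (17 / 5000000000)"
    unfolding u0_def by (rule appr_weaken, (rule appr_b4 h_c h_u1 appr_intros)+, simp)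
  have h_s0: "appr s0 (62316049 / 40000000000) (57 / 100000000000000)"
    unfolding s0_def by (rule appr_weaken, (rule appr_d appr_intros)+, simp)
  have h_s1: "appr s1 (19391033237 / 1000000000000) (23 / 10000000000000)"
    unfolding s1_def by (rule appr_weaken, (rule h_c appr_d appr_intros)+, simp)
  have h_s2: "appr s2 (32305177251 / 500000000000) (93 / 10000000000000)"
    unfolding s2_def by (rule appr_weaken, (rule appr_b h_c appr_d appr_intros)+, simp)
  have h_s3: "appr s3 (- (3604708663 / 62500000000)) (83 / 10000000000000)"
    unfolding s3_def by (rule appr_weaken, (rule h_a appr_b h_c appr_d appr_intros)+, simp)
  have h_s4: "appr s4 (- (150091796359 / 250000000000)) (1 / 15625000000)"
    unfolding s4_def by (rule appr_weaken, (rule h_a appr_b h_c appr_d appr_intros)+, simp)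
  have h_s5: "appr s5 (- (606769426841 / 1000000000000)) (11 / 250000000000)"
    unfolding s5_def by (rule appr_weaken, (rule h_a appr_b h_c appr_intros)+, simp)
  have h_s6: "appr s6 (257740404447 / 250000000000) (11 / 100000000000)"
    unfolding s6_def by (rule appr_weaken, (rule h_a appr_b appr_intros)+, simp)
  have h_s7: "appr s7 (533658362319 / 250000000000) (23 / 250000000000)"
    unfolding s7_def by (rule appr_weaken, (rule h_a appr_intros)+, simp)
  have h_g0: "appr g0 (340144947 / 50000000000) (57 / 100000000000)"
    unfolding g0_def by (rule appr_weaken, (rule h_u0 appr_intros)+, simp)
  have h_g1: "appr g1 (14138319327 / 125000000000) (27 / 5000000000)"
    unfolding g1_def by (rule appr_weaken, (rule h_u0 h_u1 appr_intros)+, simp)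
  have h_g2: "appr g2 (725138281267 / 1000000000000) (17 / 1000000000)"
    unfolding g2_def by (rule appr_weaken, (rule h_u0 h_u1 h_u2 appr_intros)+, simp)
  have h_g3: "appr g3 (571210066103 / 250000000000) (23 / 1000000000)"
    unfolding g3_def by (rule appr_weaken, (rule h_u0 h_u1 h_u2 appr_intros)+, simp)
  have h_g4: "appr g4 (940253802117 / 250000000000) (3 / 200000000)"
    unfolding g4_def by (rule appr_weaken, (rule h_u1 h_u2 appr_intros)+, simp)
  have h_g5: "appr g5 (1545861908327 / 500000000000) (21 / 5000000000)"
    unfolding g5_def by (rule appr_weaken, (rule h_u2 appr_intros)+, simp)
  have h_k0: "appr k0 (- (3255494523 / 1000000000000)) (29 / 100000000000)"
    unfolding k0_def by (rule appr_weaken, (rule appr_b4 h_g0 appr_intros)+, simp)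
  have h_k1: "appr k1 (- (9464739603 / 200000000000)) (17 / 5000000000)"
    unfolding k1_def by (rule appr_weaken, (rule appr_b4 h_g0 h_g1 appr_intros)+, simp)
  have h_k2: "appr k2 (- (233904877393 / 1000000000000)) (3 / 200000000)"
    unfolding k2_def by (rule appr_weaken, (rule appr_b4 h_g1 h_g2 appr_intros)+, simp)
  have h_k3: "appr k3 (- (184130511383 / 500000000000)) (33 / 1000000000)"
    unfolding k3_def by (rule appr_weaken, (rule appr_b4 h_g2 h_g3 appr_intros)+, simp)
  have h_k4: "appr k4 (485024550619 / 1000000000000) (19 / 500000000)"
    unfolding k4_def by (rule appr_weaken, (rule appr_b4 h_g3 h_g4 appr_intros)+, simp)
  have h_k5: "appr k5 (285185708339 / 125000000000) (3 / 125000000)"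
    unfolding k5_def by (rule appr_weaken, (rule appr_b4 h_g4 h_g5 appr_intros)+, simp)
  have h_k6: "appr k6 (522635726593 / 200000000000) (31 / 5000000000)"
    unfolding k6_def by (rule appr_weaken, (rule appr_b4 h_g5 appr_intros)+, simp)
  have h_A6: "appr A6 (695240404447 / 62500000000) (11 / 25000000000)"
    unfolding A6_def by (rule appr_weaken, (rule h_s6 appr_intros)+, simp)
  have h_A7: "appr A7 (533658362319 / 125000000000) (19 / 100000000000)"
    unfolding A7_def by (rule appr_weaken, (rule h_s7 appr_intros)+, simp)
  have h_B6: "appr B6 (195552444337 / 15625000000) (41 / 50000000000)"
    unfolding B6_def by (rule appr_weaken, (rule h_s5 h_s7 appr_intros)+, simp)
  have h_B7: "appr B7 (757740404447 / 125000000000) (11 / 50000000000)"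
    unfolding B7_def by (rule appr_weaken, (rule h_s6 appr_intros)+, simp)
  have h_det: "appr det (875031651873 / 62500000000) (11 / 1000000000)"
    unfolding det_def by (rule appr_weaken, (rule h_A6 h_A7 h_B6 h_B7 appr_intros)+, simp)
  have h_P6: "appr P6 (757740404447 / 31250000000) (11 / 12500000000)"
    unfolding P6_def by (rule appr_weaken, (rule h_B7 appr_intros)+, simp)
  have h_Q6: "appr Q6 (- (533658362319 / 31250000000)) (19 / 25000000000)"
    unfolding Q6_def by (rule appr_weaken, (rule h_A7 appr_intros)+, simp)
  have h_P7: "appr P7 (38332840220389 / 1000000000000) (1 / 6250000)"
    unfolding P7_def by (rule appr_weaken, (rule h_B6 h_B7 h_k6 appr_intros)+, simp)
  have h_Q7: "appr Q7 (- (22377735208579 / 1000000000000)) (11 / 100000000)"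
    unfolding Q7_def by (rule appr_weaken, (rule h_A6 h_A7 h_k6 appr_intros)+, simp)
  have h_F0: "appr F0 (28734259907 / 500000000000) (81 / 10000000000)"
    unfolding F0_def by (rule appr_weaken, (rule h_P6 h_det h_g0 h_s0 appr_intros)+, simp)
  have h_F1: "appr F1 (284991402483 / 250000000000) (77 / 1000000000)"
    unfolding F1_def by (rule appr_weaken, (rule h_P6 h_Q6 h_det h_g1 h_s0 h_s1 appr_intros)+, simp)
  have h_F2: "appr F2 (4458396558973 / 500000000000) (1 / 4000000)"
    unfolding F2_def by (rule appr_weaken, (rule h_P6 h_Q6 h_det h_g2 h_s1 h_s2 appr_intros)+, simp)
  have h_F3: "appr F3 (34490770105377 / 1000000000000) (7 / 20000000)"
    unfolding F3_def by (rule appr_weaken, (rule h_P6 h_Q6 h_det h_g3 h_s2 h_s3 appr_intros)+, simp)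
  have h_F4: "appr F4 (66228711118523 / 1000000000000) (13 / 50000000)"
    unfolding F4_def by (rule appr_weaken, (rule h_P6 h_Q6 h_det h_g4 h_s3 h_s4 appr_intros)+, simp)
  have h_F5: "appr F5 (47745946916533 / 1000000000000) (3 / 31250000)"
    unfolding F5_def by (rule appr_weaken, (rule h_P6 h_Q6 h_det h_g5 h_s4 h_s5 appr_intros)+, simp)
  have h_F6: "appr F6 (- (21359776829719 / 1000000000000)) (1 / 62500000)"
    unfolding F6_def by (rule appr_weaken, (rule h_P6 h_Q6 h_det h_s5 h_s6 appr_intros)+, simp)
  have h_F7: "appr F7 (- (533658362319 / 15625000000)) (17 / 2500000000)"
    unfolding F7_def by (rule appr_weaken, (rule h_P6 h_Q6 h_s6 h_s7 appr_intros)+, simp)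
  have h_F8: "appr F8 (76284917249 / 6250000000) (41 / 10000000000)"
    unfolding F8_def by (rule appr_weaken, (rule h_P6 h_Q6 h_s7 appr_intros)+, simp)
  have h_F9: "appr F9 (533658362319 / 31250000000) (19 / 25000000000)"
    unfolding F9_def by (rule appr_weaken, (rule h_Q6 appr_intros)+, simp)
  have h_H0: "appr H0 (- (105297350739 / 1000000000000)) (11 / 2500000000)"
    unfolding H0_def by (rule appr_weaken, (rule h_P7 h_det h_k0 h_s0 appr_intros)+, simp)
  have h_H1: "appr H1 (- (1371006816037 / 1000000000000)) (13 / 250000000)"
    unfolding H1_def by (rule appr_weaken, (rule h_P7 h_Q7 h_det h_k1 h_s0 h_s1 appr_intros)+, simp)
  have h_H2: "appr H2 (- (5317557728451 / 1000000000000)) (23 / 100000000)"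
    unfolding H2_def by (rule appr_weaken, (rule h_P7 h_Q7 h_det h_k2 h_s1 h_s2 appr_intros)+, simp)
  have h_H3: "appr H3 (- (1499147872847 / 1000000000000)) (49 / 100000000)"
    unfolding H3_def by (rule appr_weaken, (rule h_P7 h_Q7 h_det h_k3 h_s2 h_s3 appr_intros)+, simp)
  have h_H4: "appr H4 (14256862638541 / 500000000000) (13 / 20000000)"
    unfolding H4_def by (rule appr_weaken, (rule h_P7 h_Q7 h_det h_k4 h_s3 h_s4 appr_intros)+, simp)
  have h_H5: "appr H5 (10441573083197 / 250000000000) (53 / 100000000)"
    unfolding H5_def by (rule appr_weaken, (rule h_P7 h_Q7 h_det h_k5 h_s4 h_s5 appr_intros)+, simp)
  have h_H6: "appr H6 (- (16511988281049 / 1000000000000)) (9 / 25000000)"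
    unfolding H6_def by (rule appr_weaken, (rule h_P7 h_Q7 h_det h_k6 h_s5 h_s6 appr_intros)+, simp)
  have h_H7: "appr H7 (- (44755470417159 / 1000000000000)) (3 / 6250000)"
    unfolding H7_def by (rule appr_weaken, (rule h_P7 h_Q7 h_det h_s6 h_s7 appr_intros)+, simp)
  have h_H8: "appr H8 (1887084374977 / 200000000000) (1 / 2500000)"
    unfolding H8_def by (rule appr_weaken, (rule h_P7 h_Q7 h_s7 appr_intros)+, simp)
  have h_H9: "appr H9 (22377735208579 / 1000000000000) (11 / 100000000)"
    unfolding H9_def by (rule appr_weaken, (rule h_Q7 appr_intros)+, simp)
  have W: "w * w = [:s0, s1, s2, s3, s4, s5, s6, s7, 1:]" unfolding w_def by (simp add: s_defs algebra_simps)
  have cub: "cub = [:u0, u1, u2, 1:]" unfolding cub_def u_defs ..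
  have G: "cub * cub = [:g0, g1, g2, g3, g4, g5, 1:]" unfolding cub by (simp add: g_defs algebra_simps)
  have K: "cub * cub * [:- b4, 1:] = [:k0, k1, k2, k3, k4, k5, k6, 1:]" unfolding G by (simp add: k_defs algebra_simps)
  have pqW: "[:p, q:] * (w * w) = [:p * s0, p * s1 + q * s0, p * s2 + q * s1, p * s3 + q * s2, p * s4 + q * s3, p * s5 + q * s4, p * s6 + q * s5, p * s7 + q * s6, p + q * s7, q:]" for p q
    unfolding W by (simp add: algebra_simps)
  have det: "0 < det" by (rule appr_pos[OF h_det]) simp
  have F: "cub * cub - [:P6 / det, Q6 / det:] * (w * w) = smult (1 / det) [:F0, F1, F2, F3, F4, F5, F6, F7, F8, F9:]"
    unfolding G F_defs pqW using det by (simp add: field_simps)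
  have Fpos: "0 < 512 * ccoef [:F0, F1, F2, F3, F4, F5, F6, F7, F8, F9:] 1"
      "0 < 512 * ccoef [:F0, F1, F2, F3, F4, F5, F6, F7, F8, F9:] 2"
      "0 < 512 * ccoef [:F0, F1, F2, F3, F4, F5, F6, F7, F8, F9:] 3"
      "0 < 512 * ccoef [:F0, F1, F2, F3, F4, F5, F6, F7, F8, F9:] 4"
      "0 < 512 * ccoef [:F0, F1, F2, F3, F4, F5, F6, F7, F8, F9:] 5"
      "0 < 512 * ccoef [:F0, F1, F2, F3, F4, F5, F6, F7, F8, F9:] 8"
      "0 < 512 * ccoef [:F0, F1, F2, F3, F4, F5, F6, F7, F8, F9:] 9"
    unfolding ccoef_degree_9 by (rule appr_pos, (rule h_F0 h_F1 h_F2 h_F3 h_F4 h_F5 h_F6 h_F7 h_F8 h_F9 appr_intros)+, simp)+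
  have F0: "ccoef [:F0, F1, F2, F3, F4, F5, F6, F7, F8, F9:] 6 = 0" "ccoef [:F0, F1, F2, F3, F4, F5, F6, F7, F8, F9:] 7 = 0"
  proof -
    have "512 * ccoef [:F0, F1, F2, F3, F4, F5, F6, F7, F8, F9:] 6 = 0" "512 * ccoef [:F0, F1, F2, F3, F4, F5, F6, F7, F8, F9:] 7 = 0"
      unfolding ccoef_degree_9 F_defs pq_defs det_def A_defs by (simp_all add: algebra_simps)
    then show "ccoef [:F0, F1, F2, F3, F4, F5, F6, F7, F8, F9:] 6 = 0" "ccoef [:F0, F1, F2, F3, F4, F5, F6, F7, F8, F9:] 7 = 0" by simp_all
  qed
  have Fd: "degree [:F0, F1, F2, F3, F4, F5, F6, F7, F8, F9:] \<le> 9" by (simp add: degree_pCons_eq_if)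
  have Fc: "0 \<le> ccoef [:F0, F1, F2, F3, F4, F5, F6, F7, F8, F9:] i" if "1 \<le> i" for i
  proof (cases "i \<le> 9")
    case True
    then have "i = 1 \<or> i = 2 \<or> i = 3 \<or> i = 4 \<or> i = 5 \<or> i = 6 \<or> i = 7 \<or> i = 8 \<or> i = 9" using that by arith
    moreover have "0 < 512 * ccoef [:F0, F1, F2, F3, F4, F5, F6, F7, F8, F9:] j" if "j \<in> {1, 2, 3, 4, 5, 8, 9}" for j
      using that Fpos by (elim insertE emptyE) (simp_all only:)
    ultimately show ?thesis using F0 by (elim disjE) (simp_all add: less_imp_le)
  next
    case False
    then show ?thesis using Fd by (simp add: ccoef_eq_0)
  qed
  have H: "cub * cub * [:- b4, 1:] - [:P7 / det, Q7 / det:] * (w * w) = smult (1 / det) [:H0, H1, H2, H3, H4, H5, H6, H7, H8, H9:]"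
    unfolding K H_defs pqW using det by (simp add: field_simps)
  have Hpos: "0 < 512 * ccoef [:H0, H1, H2, H3, H4, H5, H6, H7, H8, H9:] 1"
      "0 < 512 * ccoef [:H0, H1, H2, H3, H4, H5, H6, H7, H8, H9:] 2"
      "0 < 512 * ccoef [:H0, H1, H2, H3, H4, H5, H6, H7, H8, H9:] 3"
      "0 < 512 * ccoef [:H0, H1, H2, H3, H4, H5, H6, H7, H8, H9:] 4"
      "0 < 512 * ccoef [:H0, H1, H2, H3, H4, H5, H6, H7, H8, H9:] 5"
      "0 < 512 * ccoef [:H0, H1, H2, H3, H4, H5, H6, H7, H8, H9:] 8"
      "0 < 512 * ccoef [:H0, H1, H2, H3, H4, H5, H6, H7, H8, H9:] 9"
    unfolding ccoef_degree_9 by (rule appr_pos, (rule h_H0 h_H1 h_H2 h_H3 h_H4 h_H5 h_H6 h_H7 h_H8 h_H9 appr_intros)+, simp)+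
  have H0: "ccoef [:H0, H1, H2, H3, H4, H5, H6, H7, H8, H9:] 6 = 0" "ccoef [:H0, H1, H2, H3, H4, H5, H6, H7, H8, H9:] 7 = 0"
  proof -
    have "512 * ccoef [:H0, H1, H2, H3, H4, H5, H6, H7, H8, H9:] 6 = 0" "512 * ccoef [:H0, H1, H2, H3, H4, H5, H6, H7, H8, H9:] 7 = 0"
      unfolding ccoef_degree_9 H_defs pq_defs det_def A_defs by (simp_all add: algebra_simps)
    then show "ccoef [:H0, H1, H2, H3, H4, H5, H6, H7, H8, H9:] 6 = 0" "ccoef [:H0, H1, H2, H3, H4, H5, H6, H7, H8, H9:] 7 = 0" by simp_all
  qed
  have Hd: "degree [:H0, H1, H2, H3, H4, H5, H6, H7, H8, H9:] \<le> 9" by (simp add: degree_pCons_eq_if)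
  have Hc: "0 \<le> ccoef [:H0, H1, H2, H3, H4, H5, H6, H7, H8, H9:] i" if "1 \<le> i" for i
  proof (cases "i \<le> 9")
    case True
    then have "i = 1 \<or> i = 2 \<or> i = 3 \<or> i = 4 \<or> i = 5 \<or> i = 6 \<or> i = 7 \<or> i = 8 \<or> i = 9" using that by arith
    moreover have "0 < 512 * ccoef [:H0, H1, H2, H3, H4, H5, H6, H7, H8, H9:] j" if "j \<in> {1, 2, 3, 4, 5, 8, 9}" for j
      using that Hpos by (elim insertE emptyE) (simp_all only:)
    ultimately show ?thesis using H0 by (elim disjE) (simp_all add: less_imp_le)
  next
    case False
    then show ?thesis using Hd by (simp add: ccoef_eq_0)
  qed
  have lin: "0 \<le> p / det + q / det * t" if "0 < p + q" "0 < p - q" "t \<in> {-1..1}" for p q t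
  proof -
    have "0 \<le> (1 + t) * (p + q)" "0 \<le> (1 - t) * (p - q)" using that by simp_all
    then have "0 \<le> (1 + t) * (p + q) + (1 - t) * (p - q)" by simp
    then have "0 \<le> (p + q * t) / det" using det by (simp add: algebra_simps)
    then show ?thesis by (simp add: add_divide_distrib)
  qed
  have l6: "0 < P6 + Q6" "0 < P6 - Q6" and l7: "0 < P7 + Q7" "0 < P7 - Q7"
    by (rule appr_pos, (rule h_P6 h_Q6 h_P7 h_Q7 appr_intros)+, simp)+
  \<comment> \<open>The same determinant excludes from \<open>Lambda43\<close> every product of
    \<open>w * w\<close> with a nonzero polynomial of degree at most 1; uniqueness of the
    interpolant comes from this.\<close>
  have inj: "p = 0 \<and> q = 0" if "ccoef ([:p, q:] * (w * w)) 6 = 0" "ccoef ([:p, q:] * (w * w)) 7 = 0" for p q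
  proof -
    have "512 * ccoef ([:p, q:] * (w * w)) 6 = 0" "512 * ccoef ([:p, q:] * (w * w)) 7 = 0" using that by simp_all
    then have e: "p * A6 + q * B6 = 0" "p * A7 + q * B7 = 0"
      unfolding pqW ccoef_degree_9 A_defs by (simp_all add: algebra_simps)
    have "p * det = (p * A6 + q * B6) * B7 - (p * A7 + q * B7) * B6"
      "q * det = (p * A7 + q * B7) * A6 - (p * A6 + q * B6) * A7"
      by (simp_all add: det_def algebra_simps)
    then show ?thesis unfolding e using det by simp
  qed
  show thesis
  proof (rule that[of "P6 / det" "Q6 / det" "P7 / det" "Q7 / det"])
    show "cub * cub - [:P6 / det, Q6 / det:] * (w * w) \<in> Lambda43"
      "cub * cub * [:- b4, 1:] - [:P7 / det, Q7 / det:] * (w * w) \<in> Lambda43"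
      unfolding F H Lambda43_iff ccoef_linear F0 H0 using Fd Hd by (auto intro: order.trans[OF degree_smult_le])
    fix i :: nat assume "1 \<le> i"
    then show "0 \<le> ccoef (cub * cub - [:P6 / det, Q6 / det:] * (w * w)) i"
      "0 \<le> ccoef (cub * cub * [:- b4, 1:] - [:P7 / det, Q7 / det:] * (w * w)) i"
      unfolding F H ccoef_linear using Fc Hc det by simp_all
  next
    fix t :: real assume t: "t \<in> {-1..1}"
    show "0 \<le> P6 / det + Q6 / det * t" by (rule lin[OF l6 t])
    show "0 \<le> P7 / det + Q7 / det * t" by (rule lin[OF l7 t])
  next
    fix p q assume "ccoef ([:p, q:] * (w * w)) 6 = 0" "ccoef ([:p, q:] * (w * w)) 7 = 0"
    then show "p = 0 \<and> q = 0" by (rule inj)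
  qed
qed

end

section \<open>Weights and test functions\<close>

lemma lfun_degree_5:
  "24 * lfun [:x0, x1, x2, x3, x4, x5:] = 23 * x0 - x1 + 5 * x2 - x3 + 2 * x4 - x5"
  using ccoef_degree_9(1)[of x0 x1 x2 x3 x4 x5 0 0 0 0]
  by (simp add: lfun_def ccoef_0_right field_simps)

text \<open>The ball rules divide by numerals only, so enclosing a general quotient is reduced to
  signs of division-free expressions.\<close>

lemma divide_bounds:
  fixes D N :: real
  shows "0 < D \<Longrightarrow> 0 < N - l * D \<Longrightarrow> 0 < u * D - N \<Longrightarrow> l < N / D \<and> N / D < u"
    and "0 < - D \<Longrightarrow> 0 < l * D - N \<Longrightarrow> 0 < N - u * D \<Longrightarrow> l < N / D \<and> N / D < u"
  by (auto simp: field_simps)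

text \<open>As a function of \<open>n\<close> the convolution obeys the recurrence of
  \<open>cheb\<close> in \<open>x\<close> with inhomogeneity \<open>cheb (n + 2)\<close> at
  \<open>y\<close>. The formula yields a Lipschitz constant without derivatives.\<close>

lemma cheb_diff:
  "poly (cheb (Suc n)) x - poly (cheb (Suc n)) y = 2 * (x - y) * (\<Sum>k\<le>n. poly (cheb k) x * poly (cheb (n - k)) y)"
proof (induction n rule: cheb.induct)
  case (3 n)
  let ?S = "\<lambda>n. \<Sum>k\<le>n. poly (cheb k) x * poly (cheb (n - k)) y"
  have S: "?S (Suc (Suc n)) = 2 * x * ?S (Suc n) - ?S n + poly (cheb (Suc (Suc n))) y"
  proof -
    have "?S (Suc (Suc n)) = poly (cheb (Suc (Suc n))) y + 2 * x * poly (cheb (Suc n)) y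
        + (\<Sum>k\<le>n. poly (cheb (Suc (Suc k))) x * poly (cheb (n - k)) y)"
      by (simp add: sum.atMost_Suc_shift del: sum.atMost_Suc cheb.simps(3))
    moreover have "?S (Suc n) = poly (cheb (Suc n)) y + (\<Sum>k\<le>n. poly (cheb (Suc k)) x * poly (cheb (n - k)) y)"
      by (simp add: sum.atMost_Suc_shift del: sum.atMost_Suc cheb.simps(3))
    moreover have "(\<Sum>k\<le>n. poly (cheb (Suc (Suc k))) x * poly (cheb (n - k)) y)
        = 2 * x * (\<Sum>k\<le>n. poly (cheb (Suc k)) x * poly (cheb (n - k)) y) - ?S n"
      by (simp add: sum_distrib_left sum_subtractf[symmetric] algebra_simps)
    ultimately show ?thesis by (simp add: algebra_simps del: cheb.simps(3))
  qed
  have "poly (cheb (Suc (Suc (Suc n)))) x - poly (cheb (Suc (Suc (Suc n)))) y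
     = 2 * x * (poly (cheb (Suc (Suc n))) x - poly (cheb (Suc (Suc n))) y) - (poly (cheb (Suc n)) x - poly (cheb (Suc n)) y)
       + 2 * (x - y) * poly (cheb (Suc (Suc n))) y"
    by (simp add: algebra_simps)
  also have "\<dots> = 2 * (x - y) * (2 * x * ?S (Suc n) - ?S n + poly (cheb (Suc (Suc n))) y)"
    unfolding 3 by (simp add: algebra_simps)
  finally show ?case unfolding S .
qed (simp_all add: algebra_simps)

lemma cheb_lipschitz:
  assumes "x \<in> {-1..1}" "y \<in> {-1..1}"
  shows "\<bar>poly (cheb n) x - poly (cheb n) y\<bar> \<le> 2 * real n ^ 3 * \<bar>x - y\<bar>"
proof (cases n)
  case (Suc m)
  have "\<bar>\<Sum>k\<le>m. poly (cheb k) x * poly (cheb (m - k)) y\<bar> \<le> (\<Sum>k\<le>m. real n * real n)"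
  proof (intro order.trans[OF sum_abs] sum_mono)
    fix k assume k: "k \<in> {..m}"
    have "\<bar>poly (cheb k) x\<bar> * \<bar>poly (cheb (m - k)) y\<bar> \<le> real n * real n"
      using abs_cheb_le[OF assms(1), of k] abs_cheb_le[OF assms(2), of "m - k"] k Suc
      by (intro mult_mono) auto
    then show "\<bar>poly (cheb k) x * poly (cheb (m - k)) y\<bar> \<le> real n * real n" by (simp add: abs_mult)
  qed
  also have "\<dots> = real n ^ 3" by (simp add: Suc power3_eq_cube)
  finally have "2 * \<bar>x - y\<bar> * \<bar>\<Sum>k\<le>m. poly (cheb k) x * poly (cheb (m - k)) y\<bar> \<le> 2 * \<bar>x - y\<bar> * real n ^ 3"
    by (intro mult_left_mono) auto
  then show ?thesis unfolding Suc cheb_diff abs_mult by (simp add: mult_ac)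
qed simp

text \<open>The Chebyshev recurrence at \<open>n / 2^20\<close> in integers: the state is
  \<open>2^(20 * (j - 1)) * U_(j-1)\<close> and \<open>2^(20 * j) * U_j\<close>, and
  \<open>2^40 = 1099511627776\<close> brings the older term to the new scale.\<close>

primrec scaled_cheb :: "int \<Rightarrow> nat \<Rightarrow> int \<times> int" where
  "scaled_cheb n 0 = (0, 1)"
| "scaled_cheb n (Suc j) = (case scaled_cheb n j of (u, v) \<Rightarrow> (v, 2 * n * v - 1099511627776 * u))"

lemma scaled_cheb:
  "real_of_int (snd (scaled_cheb n j)) = 1048576 ^ j * poly (cheb j) (n / 1048576)"
proof -
  have "real_of_int (fst (scaled_cheb n j)) * 1048576 = 1048576 ^ j * poly (cheb' j) (n / 1048576) \<and>
    real_of_int (snd (scaled_cheb n j)) = 1048576 ^ j * poly (cheb j) (n / 1048576)"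
  proof (induction j)
    case (Suc j)
    have c: "poly (cheb (Suc j)) t = 2 * t * poly (cheb j) t - poly (cheb' j) t" for t
      by (cases j) simp_all
    obtain u v where uv: "scaled_cheb n j = (u, v)" by (cases "scaled_cheb n j")
    have "real_of_int (snd (scaled_cheb n (Suc j))) = 2 * n * real_of_int v - 1048576 * (real_of_int u * 1048576)"
      by (simp add: uv)
    also have "\<dots> = 1048576 ^ Suc j * poly (cheb (Suc j)) (n / 1048576)"
      unfolding c using Suc by (simp add: uv power_add algebra_simps)
    finally show ?case using Suc by (simp add: uv power_add del: cheb.simps)
  qed simp
  then show ?thesis ..
qed

text \<open>Pairs \<open>(n, k)\<close> with \<open>n / 2 ^ 20\<close> close to a node and \<open>k / 10 ^ 5\<close> close to its weight.\<close>

definition approx_rule :: "(int \<times> int) list" where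
  "approx_rule = [(-902086, 9960), (-513637, 14653), (-205231, 33372), (501791, 37847)]"

text \<open>The subtracted terms bound the effect of both approximations on \<open>24 * 10 ^ 6 * (j + 1)\<close>
  times the test function.\<close>

definition test_check :: "nat \<Rightarrow> bool" where
  "test_check j \<longleftrightarrow> 0 < (999040 * (int j + 1) - 48 * int j ^ 3) * 1048576 ^ j
     + 240 * (\<Sum>(n, k)\<leftarrow>approx_rule. k * snd (scaled_cheb n j))"

text \<open>One pass advances the recurrence states of all four nodes, with \<open>s\<close> the
  current power of \<open>2^20\<close>, so no value is recomputed from degree 0. The seven skipped
  degrees are those in which the rule is exact and the test function is 0.\<close>

primrec check_run :: "nat \<Rightarrow> int \<Rightarrow> int \<Rightarrow> (int \<times> int \<times> int \<times> int) list \<Rightarrow> bool" where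
  "check_run 0 j s xs \<longleftrightarrow> True"
| "check_run (Suc m) j s xs \<longleftrightarrow>
     (j \<in> {1, 2, 3, 4, 5, 8, 9} \<or> 0 < (999040 * (j + 1) - 48 * j ^ 3) * s + 240 * (\<Sum>(n, k, u, v)\<leftarrow>xs. k * v)) \<and>
     check_run m (j + 1) (1048576 * s) (map (\<lambda>(n, k, u, v). (n, k, v, 2 * n * v - 1099511627776 * u)) xs)"

lemma check_run_imp_test_check:
  assumes "check_run m (int j) (1048576 ^ j) (map (\<lambda>(n, k). (n, k, scaled_cheb n j)) approx_rule)"
    and "i < m" "j + i \<notin> {1, 2, 3, 4, 5, 8, 9}"
  shows "test_check (j + i)"
  using assms
proof (induction m arbitrary: j i)
  case (Suc m)
  have step: "map (\<lambda>(n, k, u, v). (n, k, v, 2 * n * v - 1099511627776 * u)) (map (\<lambda>(n, k). (n, k, scaled_cheb n j)) approx_rule)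
      = map (\<lambda>(n, k). (n, k, scaled_cheb n (Suc j))) approx_rule"
    by (auto split: prod.split)
  have val: "(\<lambda>(n, k, u, v). k * v) \<circ> (\<lambda>(n, k). (n, k, scaled_cheb n j)) = (\<lambda>(n, k). k * snd (scaled_cheb n j))"
    by (auto simp: fun_eq_iff split: prod.split)
  show ?case
  proof (cases i)
    case 0
    have "int j \<notin> {1, 2, 3, 4, 5, 8, 9}" using Suc.prems(3) 0 by auto
    then show ?thesis using Suc.prems(1) 0 by (simp add: test_check_def val)
  next
    case (Suc i')
    have "check_run m (int (Suc j)) (1048576 ^ Suc j) (map (\<lambda>(n, k). (n, k, scaled_cheb n (Suc j))) approx_rule)"
      using Suc.prems(1) unfolding check_run.simps step by (simp add: add.commute)
    then have "test_check (Suc j + i')" using Suc.prems Suc by (intro Suc.IH) auto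
    then show ?thesis using Suc by simp
  qed
qed simp

lemma check_run: "check_run 27 0 1 (map (\<lambda>(n, k). (n, k, 0, 1)) approx_rule)"
  by code_simp

lemma test_check:
  assumes "j < 27" "j \<notin> {1, 2, 3, 4, 5, 8, 9}" shows "test_check j"
  using check_run_imp_test_check[of 27 0 j] check_run assms by simp

context second_level
begin

definition beta :: "nat \<Rightarrow> real" where
  "beta i = (if i = 1 then b1 else if i = 2 then b2 else if i = 3 then b3 else b4)"
definition theta :: "nat \<Rightarrow> real" where "theta = node_weight {1..4} beta"

lemma beta_simps [simp]: "beta 1 = b1" "beta (Suc 0) = b1" "beta 2 = b2" "beta 3 = b3" "beta 4 = b4"
  by (simp_all add: beta_def)

lemma atLeast1_atMost4: "{1..4::nat} = {1, 2, 3, 4}" by auto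

lemma beta_order: "b1 < b2" "b2 < b3" "b3 < b4" "-1 < b1" "b4 < 1"
  using appr_b1 appr_b2 appr_b3 appr_b4 unfolding appr_def by linarith+

lemma strict_mono_beta: "strict_mono_on {1..4} beta"
  unfolding atLeast1_atMost4 using beta_order by (auto simp: strict_mono_on_def)

lemma inj_beta: "inj_on beta {1..4}"
  using strict_mono_beta by (rule strict_mono_on_imp_inj_on)

lemma beta_bounds: "i \<in> {1..4} \<Longrightarrow> -1 < beta i \<and> beta i < 1"
  unfolding atLeast1_atMost4 using beta_order by auto

lemma node_poly_beta: "node_poly {1..4} beta = w"
  unfolding atLeast1_atMost4 node_poly_def w_eq cub_eq by (simp add: mult_ac del: mult_pCons_left mult_pCons_right)

text \<open>The numerators are \<open>24 * lfun\<close> of the Lagrange cubics; the factors 23, -1,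
  5, -1 are the values of \<open>24 * lfun\<close> on \<open>1, t, t^2, t^3\<close>.\<close>

lemma theta_eq:
  shows "theta 1 = (- 1 - 5 * (b2 + b3 + b4) - (b2 * b3 + b2 * b4 + b3 * b4) - 23 * (b2 * b3 * b4)) / (24 * ((b1 - b2) * (b1 - b3) * (b1 - b4)))"
  and "theta 2 = (- 1 - 5 * (b1 + b3 + b4) - (b1 * b3 + b1 * b4 + b3 * b4) - 23 * (b1 * b3 * b4)) / (24 * ((b2 - b1) * (b2 - b3) * (b2 - b4)))"
  and "theta 3 = (- 1 - 5 * (b1 + b2 + b4) - (b1 * b2 + b1 * b4 + b2 * b4) - 23 * (b1 * b2 * b4)) / (24 * ((b3 - b1) * (b3 - b2) * (b3 - b4)))"
  and "theta 4 = (- 1 - 5 * (b1 + b2 + b3) - (b1 * b2 + b1 * b3 + b2 * b3) - 23 * (b1 * b2 * b3)) / (24 * ((b4 - b1) * (b4 - b2) * (b4 - b3)))"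
proof -
  have l: "lfun ([:- x, 1:] * [:- y, 1:] * [:- z, 1:]) = (- 1 - 5 * (x + y + z) - (x * y + x * z + y * z) - 23 * (x * y * z)) / 24"
    (is "lfun ?p = _") for x y z
  proof -
    have "?p = [:- (x * y * z), x * y + x * z + y * z, - (x + y + z), 1, 0, 0:]" by (simp add: algebra_simps)
    then have "24 * lfun ?p = - 1 - 5 * (x + y + z) - (x * y + x * z + y * z) - 23 * (x * y * z)"
      by (simp only: lfun_degree_5)
    then show ?thesis by simp
  qed
  have s: "{1..4::nat} - {1} = {2, 3, 4}" "{1..4::nat} - {2} = {1, 3, 4}" "{1..4::nat} - {3} = {1, 2, 4}" "{1..4::nat} - {4} = {1, 2, 3}"
    by auto
  have n: "node_poly {i, j, k} beta = [:- beta i, 1:] * [:- beta j, 1:] * [:- beta k, 1:]" if "i \<noteq> j" "i \<noteq> k" "j \<noteq> k" for i j k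
    using that by (simp add: node_poly_def mult.assoc del: mult_pCons_left mult_pCons_right)
  show "theta 1 = (- 1 - 5 * (b2 + b3 + b4) - (b2 * b3 + b2 * b4 + b3 * b4) - 23 * (b2 * b3 * b4)) / (24 * ((b1 - b2) * (b1 - b3) * (b1 - b4)))"
    unfolding theta_def node_weight_def s by (simp add: n l del: mult_pCons_left mult_pCons_right)
  show "theta 2 = (- 1 - 5 * (b1 + b3 + b4) - (b1 * b3 + b1 * b4 + b3 * b4) - 23 * (b1 * b3 * b4)) / (24 * ((b2 - b1) * (b2 - b3) * (b2 - b4)))"
    unfolding theta_def node_weight_def s by (simp add: n l del: mult_pCons_left mult_pCons_right)
  show "theta 3 = (- 1 - 5 * (b1 + b2 + b4) - (b1 * b2 + b1 * b4 + b2 * b4) - 23 * (b1 * b2 * b4)) / (24 * ((b3 - b1) * (b3 - b2) * (b3 - b4)))"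
    unfolding theta_def node_weight_def s by (simp add: n l del: mult_pCons_left mult_pCons_right)
  show "theta 4 = (- 1 - 5 * (b1 + b2 + b3) - (b1 * b2 + b1 * b3 + b2 * b3) - 23 * (b1 * b2 * b3)) / (24 * ((b4 - b1) * (b4 - b2) * (b4 - b3)))"
    unfolding theta_def node_weight_def s by (simp add: n l del: mult_pCons_left mult_pCons_right)
qed

lemma theta_bounds:
  shows "9960 / 100000 < theta 1 \<and> theta 1 < 9961 / 100000"
  and "14653 / 100000 < theta 2 \<and> theta 2 < 14654 / 100000"
  and "33372 / 100000 < theta 3 \<and> theta 3 < 33373 / 100000"
  and "37847 / 100000 < theta 4 \<and> theta 4 < 37848 / 100000"
  unfolding theta_eq
proof -
  note b = appr_b1 appr_b2 appr_b3 appr_b4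
  have n1: "appr (- 1 - 5 * (b2 + b3 + b4) - (b2 * b3 + b2 * b4 + b3 * b4) - 23 * (b2 * b3 * b4)) (- (3939672321 / 5000000000)) (11 / 200000000)" and d1: "appr (24 * ((b1 - b2) * (b1 - b3) * (b1 - b4))) (- (19776894161 / 2500000000)) (1 / 6250000)"
    by (rule appr_weaken, (rule b appr_intros)+, simp)+
  show "9960 / 100000 < (- 1 - 5 * (b2 + b3 + b4) - (b2 * b3 + b2 * b4 + b3 * b4) - 23 * (b2 * b3 * b4)) / (24 * ((b1 - b2) * (b1 - b3) * (b1 - b4))) \<and> (- 1 - 5 * (b2 + b3 + b4) - (b2 * b3 + b2 * b4 + b3 * b4) - 23 * (b2 * b3 * b4)) / (24 * ((b1 - b2) * (b1 - b3) * (b1 - b4))) < 9961 / 100000"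
    by (rule divide_bounds(2); rule appr_pos, (rule n1 d1 appr_intros)+, simp)
  have n2: "appr (- 1 - 5 * (b1 + b3 + b4) - (b1 * b3 + b1 * b4 + b3 * b4) - 23 * (b1 * b3 * b4)) (3710635779 / 10000000000) (17 / 250000000)" and d2: "appr (24 * ((b2 - b1) * (b2 - b3) * (b2 - b4))) (633078451 / 250000000) (73 / 1000000000)"
    by (rule appr_weaken, (rule b appr_intros)+, simp)+
  show "14653 / 100000 < (- 1 - 5 * (b1 + b3 + b4) - (b1 * b3 + b1 * b4 + b3 * b4) - 23 * (b1 * b3 * b4)) / (24 * ((b2 - b1) * (b2 - b3) * (b2 - b4))) \<and> (- 1 - 5 * (b1 + b3 + b4) - (b1 * b3 + b1 * b4 + b3 * b4) - 23 * (b1 * b3 * b4)) / (24 * ((b2 - b1) * (b2 - b3) * (b2 - b4))) < 14654 / 100000"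
    by (rule divide_bounds(1); rule appr_pos, (rule n2 d2 appr_intros)+, simp)
  have n3: "appr (- 1 - 5 * (b1 + b2 + b4) - (b1 * b2 + b1 * b4 + b2 * b4) - 23 * (b1 * b2 * b4)) (- (5277994811 / 5000000000)) (87 / 1000000000)" and d3: "appr (24 * ((b3 - b1) * (b3 - b2) * (b3 - b4))) (- (31630734651 / 10000000000)) (81 / 1000000000)"
    by (rule appr_weaken, (rule b appr_intros)+, simp)+
  show "33372 / 100000 < (- 1 - 5 * (b1 + b2 + b4) - (b1 * b2 + b1 * b4 + b2 * b4) - 23 * (b1 * b2 * b4)) / (24 * ((b3 - b1) * (b3 - b2) * (b3 - b4))) \<and> (- 1 - 5 * (b1 + b2 + b4) - (b1 * b2 + b1 * b4 + b2 * b4) - 23 * (b1 * b2 * b4)) / (24 * ((b3 - b1) * (b3 - b2) * (b3 - b4))) < 33373 / 100000"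
    by (rule divide_bounds(2); rule appr_pos, (rule n3 d3 appr_intros)+, simp)
  have n4: "appr (- 1 - 5 * (b1 + b2 + b3) - (b1 * b2 + b1 * b3 + b2 * b3) - 23 * (b1 * b2 * b3)) (79406792823 / 10000000000) (17 / 250000000)" and d4: "appr (24 * ((b4 - b1) * (b4 - b2) * (b4 - b3))) (209808191647 / 10000000000) (7 / 25000000)"
    by (rule appr_weaken, (rule b appr_intros)+, simp)+
  show "37847 / 100000 < (- 1 - 5 * (b1 + b2 + b3) - (b1 * b2 + b1 * b3 + b2 * b3) - 23 * (b1 * b2 * b3)) / (24 * ((b4 - b1) * (b4 - b2) * (b4 - b3))) \<and> (- 1 - 5 * (b1 + b2 + b3) - (b1 * b2 + b1 * b3 + b2 * b3) - 23 * (b1 * b2 * b3)) / (24 * ((b4 - b1) * (b4 - b2) * (b4 - b3))) < 37848 / 100000"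
    by (rule divide_bounds(1); rule appr_pos, (rule n4 d4 appr_intros)+, simp)
qed

lemma theta_pos: "i \<in> {1..4} \<Longrightarrow> 0 < theta i"
  unfolding atLeast1_atMost4 using theta_bounds by auto

abbreviation quad :: "real poly \<Rightarrow> real" where
  "quad p \<equiv> \<Sum>i=1..4. theta i * poly p (beta i)"

text \<open>The formulas for \<open>a\<close> and \<open>c\<close> say precisely that
  \<open>lfun\<close> annihilates \<open>w\<close> and \<open>t * w\<close>, so four nodes reach
  degree 5.\<close>

lemma lfun_eq_quad_degree_5:
  assumes "degree p \<le> 5" shows "lfun p = quad p"
  unfolding theta_def
proof (rule lfun_node_weight_exact[where m = 2])
  fix k :: nat assume "k < 2"
  then have "k = 0 \<or> k = 1" by arith
  then show "lfun (node_poly {1..4} beta * monom 1 k) = 0"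
  proof
    assume "k = 0"
    then show ?thesis unfolding node_poly_beta
      using lfun_degree_5[of d c b a 1 0] by (simp add: w_def a_def c_def)
  next
    assume "k = 1"
    then show ?thesis unfolding node_poly_beta
      using lfun_degree_5[of 0 d c b a 1] by (simp add: w_def a_def c_def monom_Suc)
  qed
qed (use assms inj_beta in auto)

section \<open>Moments of the rule and exactness in degrees 8 and 9\<close>

definition moment :: "nat \<Rightarrow> real" where "moment k = (\<Sum>i=1..4. theta i * beta i ^ k)"

lemma moment_low: "24 * moment 0 = 23" "24 * moment 1 = - 1" "24 * moment 2 = 5" "24 * moment 3 = - 1"
  "24 * moment 4 = 2" "24 * moment 5 = - 1"
proof -
  have m: "moment k = cmom k 0 - 1 / 24" if "k \<le> 5" for k
    using lfun_eq_quad_degree_5[of "monom 1 k"] that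
    by (simp add: lfun_monom moment_def poly_monom degree_monom_eq)
  show "24 * moment 0 = 23" "24 * moment 1 = - 1" "24 * moment 2 = 5" "24 * moment 3 = - 1"
    "24 * moment 4 = 2" "24 * moment 5 = - 1"
    by (simp_all add: m numeral_eq_Suc)
qed

lemma w_beta: "i \<in> {1..4} \<Longrightarrow> poly w (beta i) = 0"
  unfolding atLeast1_atMost4 w_eq cub_eq by (auto simp del: mult_pCons_left mult_pCons_right)

lemma moment_rec: "moment (k + 4) = - (a * moment (k + 3) + b * moment (k + 2) + c * moment (k + 1) + d * moment k)"
proof -
  have "beta i ^ (k + 4) = - (a * beta i ^ (k + 3) + b * beta i ^ (k + 2) + c * beta i ^ (k + 1) + d * beta i ^ k)"
    if "i \<in> {1..4}" for i
  proof -
    have "beta i ^ k * poly w (beta i) = 0" using w_beta[OF that] by simp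
    then show ?thesis by (simp add: w_def power_add numeral_eq_Suc algebra_simps)
  qed
  then have "moment (k + 4) = (\<Sum>i=1..4. theta i * - (a * beta i ^ (k + 3) + b * beta i ^ (k + 2) + c * beta i ^ (k + 1) + d * beta i ^ k))"
    unfolding moment_def by (intro sum.cong) auto
  also have "\<dots> = - (a * moment (k + 3) + b * moment (k + 2) + c * moment (k + 1) + d * moment k)"
    unfolding moment_def atLeast1_atMost4 by (simp add: algebra_simps)
  finally show ?thesis .
qed

text \<open>The nodes are roots of \<open>w\<close>, so the moments of the rule satisfy a linear
  recurrence, which continues them from degree 5 to degree 9. Degrees 6 and 7 are merely computed;
  \<open>eqn8\<close> and \<open>eqn9\<close> then give \<open>cheb 8\<close> and
  \<open>cheb 9\<close> their required values.\<close>

lemma lfun_eq_quad_cheb_8_9: "lfun (cheb 8) = quad (cheb 8)" "lfun (cheb 9) = quad (cheb 9)"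
proof -
  have "24 * moment 6 = - (a * (24 * moment 5) + b * (24 * moment 4) + c * (24 * moment 3) + d * (24 * moment 2))"
    using moment_rec[of 2] by simp
  then have q6: "24 * moment 6 = mom6 b d"
    unfolding moment_low by (simp add: mom6_def a_def c_def)
  have "24 * moment 7 = - (a * (24 * moment 6) + b * (24 * moment 5) + c * (24 * moment 4) + d * (24 * moment 3))"
    using moment_rec[of 3] by simp
  then have q7: "24 * moment 7 = mom7 b d"
    unfolding q6 moment_low mom7_def a_def[symmetric] c_def[symmetric] by simp
  have "24 * moment 8 = - (a * (24 * moment 7) + b * (24 * moment 6) + c * (24 * moment 5) + d * (24 * moment 4))"
    using moment_rec[of 4] by simp
  then have q8: "24 * moment 8 = - (a * mom7 b d + b * mom6 b d - c + 2 * d)"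
    unfolding q7 q6 moment_low by simp
  have e8: "32 * (24 * moment 8) = 56 * mom6 b d - 39"
    using eqn8 unfolding eqn8_def a_def[symmetric] c_def[symmetric] q8 by simp
  have "24 * moment 9 = - (a * (24 * moment 8) + b * (24 * moment 7) + c * (24 * moment 6) + d * (24 * moment 5))"
    using moment_rec[of 5] by simp
  then have "32 * (24 * moment 9) = - (a * (32 * (24 * moment 8)) + 32 * (b * mom7 b d + c * mom6 b d - d))"
    unfolding q7 q6 moment_low by (simp add: algebra_simps)
  then have e9: "24 * moment 9 = 2 * mom7 b d + 1"
    using eqn9 unfolding eqn9_def a_def[symmetric] c_def[symmetric] e8 by (simp add: algebra_simps)
  have "quad (cheb 8) = 256 * moment 8 - 448 * moment 6 + 240 * moment 4 - 40 * moment 2 + moment 0"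
    unfolding poly_cheb_numeral moment_def by (simp add: sum_distrib_left sum_subtractf sum.distrib algebra_simps)
  then have "24 * quad (cheb 8) = - 9"
    using e8 q6 moment_low by simp
  then show "lfun (cheb 8) = quad (cheb 8)" by (simp add: lfun_cheb)
  have "quad (cheb 9) = 512 * moment 9 - 1024 * moment 7 + 672 * moment 5 - 160 * moment 3 + 10 * moment 1"
    unfolding poly_cheb_numeral moment_def by (simp add: sum_distrib_left sum_subtractf sum.distrib algebra_simps)
  then have "24 * quad (cheb 9) = - 10"
    using e9 q7 moment_low by simp
  then show "lfun (cheb 9) = quad (cheb 9)" by (simp add: lfun_cheb)
qed

lemma lfun_eq_quad: assumes "p \<in> Lambda43" shows "lfun p = quad p"
proof -
  obtain r x y where p: "p = r + (smult x (gegenbauer 4 8) + smult y (gegenbauer 4 9))" and "degree r \<le> 5"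
    using assms by (auto simp: Lambda43_def polys_upto_def)
  then have "lfun p = quad r + (x / 9 * quad (cheb 8) + y / 10 * quad (cheb 9))"
    by (simp add: gegenbauer_4 lfun_linear lfun_eq_quad_degree_5 lfun_eq_quad_cheb_8_9 del: sum.cl_ivl_Suc)
  also have "\<dots> = quad p"
    by (simp add: p gegenbauer_4 sum_distrib_left sum.distrib algebra_simps del: sum.cl_ivl_Suc)
  finally show ?thesis .
qed

lemma quadrature_rule_beta: "quadrature_rule 4 24 (poly ` Lambda43) 4 beta theta"
  unfolding quadrature_rule_4_24_iff using strict_mono_beta beta_bounds theta_pos lfun_eq_quad
  by (auto intro: less_imp_le)

lemma sum_theta: "(\<Sum>i=1..4. theta i) = 23/24"
  using moment_low(1) by (simp add: moment_def)

lemma test_function_beta: "test_function 4 24 4 beta theta j = 1 / 24 + quad (cheb j) / (real j + 1)"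
  by (simp add: test_function_def poly_gegenbauer_4 sum_divide_distrib)

lemma test_function_beta_pos: "0 < test_function 4 24 4 beta theta j \<longleftrightarrow> 0 < (real j + 1) / 24 + quad (cheb j)"
proof -
  have "1 / 24 + x / (real j + 1) = ((real j + 1) / 24 + x) / (real j + 1)" for x by (simp add: field_simps)
  then have "0 < 1 / 24 + x / (real j + 1) \<longleftrightarrow> 0 < (real j + 1) / 24 + x" for x
    by (simp add: zero_less_divide_iff)
  then show ?thesis unfolding test_function_beta .
qed

lemma test_function_eq_0: assumes "j \<in> {1, 2, 3, 4, 5, 8, 9}" shows "test_function 4 24 4 beta theta j = 0"
proof -
  have "lfun (cheb j) = quad (cheb j)"
    using assms lfun_eq_quad_cheb_8_9 lfun_eq_quad_degree_5[of "cheb j"] by (auto simp del: sum.cl_ivl_Suc)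
  moreover have "0 < j" using assms by auto
  ultimately have q: "quad (cheb j) = - (real j + 1) / 24" by (simp add: lfun_cheb)
  show ?thesis unfolding test_function_beta q by (simp add: field_simps)
qed

text \<open>Replacing a node by \<open>r i\<close> costs at most the Lipschitz bound times
  \<open>10^-6\<close>, replacing a weight by \<open>k i / 10^5\<close> at most
  \<open>(j + 1) / 10^5\<close>. The integer check covers the sum of these errors.\<close>

lemma test_function_pos_small:
  assumes "test_check j" shows "0 < test_function 4 24 4 beta theta j"
proof -
  define r :: "nat \<Rightarrow> real" where "r i = (if i = 1 then -902086 else if i = 2 then -513637 else if i = 3 then -205231 else 501791) / 1048576" for i
  define k :: "nat \<Rightarrow> real" where "k i = (if i = 1 then 9960 else if i = 2 then 14653 else if i = 3 then 33372 else 37847)" for i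
  have "\<bar>b1 - (-902086) / 1048576\<bar> \<le> 1 / 1000000" "\<bar>b2 - (-513637) / 1048576\<bar> \<le> 1 / 1000000"
    "\<bar>b3 - (-205231) / 1048576\<bar> \<le> 1 / 1000000" "\<bar>b4 - (501791) / 1048576\<bar> \<le> 1 / 1000000"
    using appr_b1 appr_b2 appr_b3 appr_b4 unfolding appr_def by linarith+
  then have r: "\<bar>beta i - r i\<bar> \<le> 1 / 10 ^ 6 \<and> r i \<in> {-1..1}" if "i \<in> {1..4}" for i
    using that unfolding atLeast1_atMost4 by (auto simp: r_def)
  have k: "\<bar>theta i - k i / 10 ^ 5\<bar> \<le> 1 / 10 ^ 5" if "i \<in> {1..4}" for i
    using that theta_bounds unfolding atLeast1_atMost4
    by (auto simp: k_def abs_le_iff)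
  have "k i / 10 ^ 5 * poly (cheb j) (r i) - (theta i * (2 * real j ^ 3 / 10 ^ 6) + (real j + 1) / 10 ^ 5) \<le> theta i * poly (cheb j) (beta i)"
    if i: "i \<in> {1..4}" for i
  proof -
    have b: "beta i \<in> {-1..1}" using beta_bounds[OF i] by auto
    have "\<bar>poly (cheb j) (beta i) - poly (cheb j) (r i)\<bar> \<le> 2 * real j ^ 3 * \<bar>beta i - r i\<bar>"
      using r[OF i] b by (intro cheb_lipschitz) auto
    also have "\<dots> \<le> 2 * real j ^ 3 * (1 / 10 ^ 6)" using r[OF i] by (intro mult_left_mono) auto
    finally have "theta i * \<bar>poly (cheb j) (beta i) - poly (cheb j) (r i)\<bar> \<le> theta i * (2 * real j ^ 3 / 10 ^ 6)"
      using theta_pos[OF i] by (intro mult_left_mono) auto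
    then have 1: "\<bar>theta i * (poly (cheb j) (beta i) - poly (cheb j) (r i))\<bar> \<le> theta i * (2 * real j ^ 3 / 10 ^ 6)"
      using theta_pos[OF i] by (simp add: abs_mult)
    have "\<bar>theta i - k i / 10 ^ 5\<bar> * \<bar>poly (cheb j) (r i)\<bar> \<le> 1 / 10 ^ 5 * (real j + 1)"
      using r[OF i] k[OF i] by (intro mult_mono abs_cheb_le) auto
    then have 2: "\<bar>(theta i - k i / 10 ^ 5) * poly (cheb j) (r i)\<bar> \<le> (real j + 1) / 10 ^ 5"
      by (simp add: abs_mult)
    have "theta i * poly (cheb j) (beta i) = k i / 10 ^ 5 * poly (cheb j) (r i)
        + theta i * (poly (cheb j) (beta i) - poly (cheb j) (r i)) + (theta i - k i / 10 ^ 5) * poly (cheb j) (r i)"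
      by (simp add: algebra_simps)
    then show ?thesis using 1 2 by linarith
  qed
  then have "(\<Sum>i=1..4. k i / 10 ^ 5 * poly (cheb j) (r i) - (theta i * (2 * real j ^ 3 / 10 ^ 6) + (real j + 1) / 10 ^ 5)) \<le> quad (cheb j)"
    by (intro sum_mono)
  also have "(\<Sum>i=1..4. k i / 10 ^ 5 * poly (cheb j) (r i) - (theta i * (2 * real j ^ 3 / 10 ^ 6) + (real j + 1) / 10 ^ 5))
    = (\<Sum>i=1..4. k i * poly (cheb j) (r i)) / 10 ^ 5 - (\<Sum>i=1..4. theta i) * (2 * real j ^ 3 / 10 ^ 6) - 4 * (real j + 1) / 10 ^ 5"
    unfolding sum_subtractf sum.distrib sum_distrib_right sum_divide_distrib by simp
  finally have q: "(\<Sum>i=1..4. k i * poly (cheb j) (r i)) / 10 ^ 5 - (23/24) * (2 * real j ^ 3 / 10 ^ 6) - 4 * (real j + 1) / 10 ^ 5 \<le> quad (cheb j)"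
    unfolding sum_theta .
  have "0 < real_of_int ((999040 * (int j + 1) - 48 * int j ^ 3) * 1048576 ^ j
     + 240 * (\<Sum>(n, k)\<leftarrow>approx_rule. k * snd (scaled_cheb n j)))"
    using assms unfolding test_check_def of_int_0_less_iff .
  also have "\<dots> = 1048576 ^ j * (999040 * (real j + 1) - 48 * real j ^ 3 + 240 * (\<Sum>i=1..4. k i * poly (cheb j) (r i)))"
    unfolding approx_rule_def atLeast1_atMost4 by (simp add: scaled_cheb k_def r_def algebra_simps)
  finally have "0 < 999040 * (real j + 1) - 48 * real j ^ 3 + 240 * (\<Sum>i=1..4. k i * poly (cheb j) (r i))"
    by (simp add: zero_less_mult_iff)
  moreover have "0 \<le> real j ^ 3" by simp
  \<comment> \<open>After multiplication by \<open>24 * 10^6\<close> the four weight errors turn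
    \<open>10^6\<close> into \<open>999040\<close>, the node errors give \<open>46 * x3\<close>,
    rounded up to \<open>48 * x3\<close>, and \<open>240\<close> is
    \<open>24 * 10^6 / 10^5\<close>.\<close>
  moreover have lin: "0 < (x + 1) / 24 + z" if "0 < 999040 * (x + 1) - 48 * x3 + 240 * y" "0 \<le> x3"
      "y / 10 ^ 5 - (23/24) * (2 * x3 / 10 ^ 6) - 4 * (x + 1) / 10 ^ 5 \<le> z" for x x3 y z :: real
    using that by (simp add: field_simps)
  ultimately have "0 < (real j + 1) / 24 + quad (cheb j)" using q by (intro lin)
  then show ?thesis by (simp only: test_function_beta_pos)
qed

text \<open>By \<open>abs_cheb_wgt_le\<close> the node sum is at least minus the sum of
  \<open>theta i / wgt (beta i)\<close>, for every \<open>j\<close>. That sum is below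
  \<open>28 / 24\<close>, hence the threshold \<open>j + 1 = 28\<close>.\<close>

lemma test_function_pos_large:
  assumes "27 \<le> j" shows "0 < test_function 4 24 4 beta theta j"
proof -
  have wl: "l < wgt (beta i)" if "l\<^sup>2 < 1 - (beta i)\<^sup>2" for l i
    unfolding wgt_def using that by (rule real_less_rsqrt)
  have w4: "509 / 1000 < wgt (beta 1)" "871 / 1000 < wgt (beta 2)" "980 / 1000 < wgt (beta 3)" "878 / 1000 < wgt (beta 4)"
  proof -
    have "0 < 1 - b1 * b1 - 509 / 1000 * (509 / 1000)" "0 < 1 - b2 * b2 - 871 / 1000 * (871 / 1000)"
      "0 < 1 - b3 * b3 - 980 / 1000 * (980 / 1000)" "0 < 1 - b4 * b4 - 878 / 1000 * (878 / 1000)"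
      by (rule appr_pos, (rule appr_b1 appr_b2 appr_b3 appr_b4 appr_intros)+, simp)+
    then show "509 / 1000 < wgt (beta 1)" "871 / 1000 < wgt (beta 2)" "980 / 1000 < wgt (beta 3)" "878 / 1000 < wgt (beta 4)"
      by (intro wl; simp add: power2_eq_square)+
  qed
  have "- (theta i / l) \<le> theta i * poly (cheb j) (beta i)" if i: "i \<in> {1..4}" and l: "0 < l" "l < wgt (beta i)" for i l
  proof -
    have "\<bar>poly (cheb j) (beta i)\<bar> * l \<le> \<bar>poly (cheb j) (beta i)\<bar> * wgt (beta i)"
      using l by (intro mult_left_mono) auto
    also have "\<dots> \<le> 1" using beta_bounds[OF i] by (intro abs_cheb_wgt_le) auto
    finally have "\<bar>poly (cheb j) (beta i)\<bar> \<le> 1 / l" using l by (simp add: field_simps)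
    then have "- (1 / l) \<le> poly (cheb j) (beta i)" by linarith
    then have "theta i * - (1 / l) \<le> theta i * poly (cheb j) (beta i)"
      using theta_pos[OF i] by (intro mult_left_mono) auto
    then show ?thesis by simp
  qed
  from this[of 1 "509 / 1000"] this[of 2 "871 / 1000"] this[of 3 "980 / 1000"] this[of 4 "878 / 1000"]
  have "- (theta 1 * 1000 / 509 + theta 2 * 1000 / 871 + theta 3 * 1000 / 980 + theta 4 * 1000 / 878) \<le> quad (cheb j)"
    using w4 unfolding atLeast1_atMost4 by simp
  moreover have "theta 1 * 1000 / 509 + theta 2 * 1000 / 871 + theta 3 * 1000 / 980 + theta 4 * 1000 / 878 < 28 / 24"
    using theta_bounds by linarith
  ultimately have "- (28 / 24) < quad (cheb j)" by linarith
  moreover have "28 / 24 \<le> (real j + 1) / 24" using assms by simp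
  ultimately have "28 / 24 + - (28 / 24) < (real j + 1) / 24 + quad (cheb j)" by (intro add_le_less_mono)
  then have "0 < (real j + 1) / 24 + quad (cheb j)" by (simp only: right_minus)
  then show ?thesis by (simp only: test_function_beta_pos)
qed

lemma test_function_pos:
  assumes j: "j \<notin> {1, 2, 3, 4, 5, 8, 9}" shows "0 < test_function 4 24 4 beta theta j"
proof -
  show ?thesis
  proof (cases "27 \<le> j")
    case False
    then show ?thesis using j by (intro test_function_pos_small test_check) auto
  qed (rule test_function_pos_large)
qed

end

section \<open>The main theorem\<close>

lemma ex_levenshtein:
  obtains \<alpha> \<rho> :: "nat \<Rightarrow> real" where
    "-817353/1000000 < \<alpha> 1 \<and> \<alpha> 1 < -817352/1000000" "-257598/1000000 < \<alpha> 2 \<and> \<alpha> 2 < -257597/1000000"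
    "47495/100000 < \<alpha> 3 \<and> \<alpha> 3 < 47496/100000"
    "138436/1000000 < \<rho> 1 \<and> \<rho> 1 < 138437/1000000" "433999/1000000 < \<rho> 2 \<and> \<rho> 2 < 434/1000"
    "385897/1000000 < \<rho> 3 \<and> \<rho> 3 < 385898/1000000"
    "quadrature_rule 4 24 (poly ` polys_upto 5) 3 \<alpha> \<rho>"
proof -
  \<comment> \<open>\<open>v\<close> is orthogonal under \<open>lfun\<close> to all polynomials of
    degree at most 2. Its roots are thus Gauss nodes, and three of them reach degree 5.\<close>
  define v :: "real poly" where "v = [:-1, -3, 6, 10:]"
  obtain a1 where a1': "- (31927839 / 39062500) < a1" "a1 < - (2043381691 / 2500000000)" "poly v a1 = 0"
    using poly_IVT_pos[of "- (31927839 / 39062500)" "- (2043381691 / 2500000000)" v] by (auto simp: v_def)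
  have a1: "poly v a1 = 0" "appr a1 (- (4086763387 / 5000000000)) (1 / 1000000000)"
    using a1' unfolding appr_def by (simp, linarith)
  obtain a2 where a2': "- (1287989067 / 5000000000) < a2" "a2 < - (1287989057 / 5000000000)" "poly v a2 = 0"
    using poly_IVT_neg[of "- (1287989067 / 5000000000)" "- (1287989057 / 5000000000)" v] by (auto simp: v_def)
  have a2: "poly v a2 = 0" "appr a2 (- (643994531 / 2500000000)) (1 / 1000000000)"
    using a2' unfolding appr_def by (simp, linarith)
  obtain a3 where a3': "593688111 / 1250000000 < a3" "a3 < 1187376227 / 2500000000" "poly v a3 = 0"
    using poly_IVT_pos[of "593688111 / 1250000000" "1187376227 / 2500000000" v] by (auto simp: v_def)
  have a3: "poly v a3 = 0" "appr a3 (2374752449 / 5000000000) (1 / 1000000000)"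
    using a3' unfolding appr_def by (simp, linarith)
  have ord: "a1 < a2" "a2 < a3" "-1 < a1" "a3 < 1"
    using a1(2) a2(2) a3(2) unfolding appr_def by linarith+
  have v: "v = smult 10 ([:- a1, 1:] * [:- a2, 1:] * [:- a3, 1:])"
  proof -
    have "v - smult 10 ([:- a1, 1:] * [:- a2, 1:] * [:- a3, 1:]) = 0"
    proof (rule poly_eqI_degree[of "{a1, a2, a3}"])
      show "poly (v - smult 10 ([:- a1, 1:] * [:- a2, 1:] * [:- a3, 1:])) t = poly 0 t" if "t \<in> {a1, a2, a3}" for t
        using that a1(1) a2(1) a3(1) unfolding poly_diff poly_smult poly_mult by auto
      show "degree (v - smult 10 ([:- a1, 1:] * [:- a2, 1:] * [:- a3, 1:])) < card {a1, a2, a3}"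
        using ord by (simp add: v_def card_insert_if degree_pCons_eq_if)
    qed (use ord in \<open>auto simp: card_insert_if\<close>)
    then show ?thesis by simp
  qed
  define \<alpha> where "\<alpha> i = (if i = 1 then a1 else if i = 2 then a2 else a3)" for i :: nat
  define \<rho> where "\<rho> = node_weight {1..3} \<alpha>"
  have \<alpha>: "\<alpha> 1 = a1" "\<alpha> 2 = a2" "\<alpha> 3 = a3" by (simp_all add: \<alpha>_def)
  have s: "{1..3::nat} = {1, 2, 3}" by auto
  have mono: "strict_mono_on {1..3} \<alpha>"
    unfolding s using ord by (auto simp: strict_mono_on_def \<alpha>_def)
  then have inj: "inj_on \<alpha> {1..3}" by (rule strict_mono_on_imp_inj_on)
  have npoly: "node_poly {1..3} \<alpha> = [:- a1, 1:] * [:- a2, 1:] * [:- a3, 1:]"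
    unfolding s node_poly_def by (simp add: \<alpha>_def mult_ac del: mult_pCons_left mult_pCons_right)
  have "10 * lfun (node_poly {1..3} \<alpha> * monom 1 k) = 0" if "k < 3" for k
  proof -
    have "smult 10 (node_poly {1..3} \<alpha> * monom 1 k) = v * monom 1 k" unfolding npoly v by (simp del: mult_pCons_left mult_pCons_right)
    then have "10 * lfun (node_poly {1..3} \<alpha> * monom 1 k) = lfun (v * monom 1 k)" by (metis lfun_linear(3))
    moreover have "k = 0 \<or> k = 1 \<or> k = 2" using that by arith
    then have "lfun (v * monom 1 k) = 0"
      using lfun_degree_5[of "-1" "-3" 6 10 0 0] lfun_degree_5[of 0 "-1" "-3" 6 10 0] lfun_degree_5[of 0 0 "-1" "-3" 6 10]
      by (elim disjE) (simp_all add: v_def numeral_eq_Suc monom_Suc)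
    ultimately show ?thesis by simp
  qed
  then have ann: "lfun (node_poly {1..3} \<alpha> * monom 1 k) = 0" if "k < 3" for k using that by simp
  have exact: "lfun p = (\<Sum>i=1..3. \<rho> i * poly p (\<alpha> i))" if "degree p \<le> 5" for p
    unfolding \<rho>_def by (rule lfun_node_weight_exact[OF _ inj _ ann]) (use that in auto)
  have l: "lfun ([:- x, 1:] * [:- y, 1:]) = (5 + (x + y) + 23 * (x * y)) / 24" (is "lfun ?p = _") for x y
  proof -
    have "?p = [:x * y, - (x + y), 1, 0, 0, 0:]" by (simp add: algebra_simps)
    then have "24 * lfun ?p = 5 + (x + y) + 23 * (x * y)" by (simp only: lfun_degree_5)
    then show ?thesis by simp
  qed
  have sd: "{1..3::nat} - {1} = {2, 3}" "{1..3::nat} - {2} = {1, 3}" "{1..3::nat} - {3} = {1, 2}" by auto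
  have n: "node_poly {i, j} \<alpha> = [:- \<alpha> i, 1:] * [:- \<alpha> j, 1:]" if "i \<noteq> j" for i j
    using that by (simp add: node_poly_def del: mult_pCons_left mult_pCons_right)
  have r1: "\<rho> 1 = (5 + (a2 + a3) + 23 * (a2 * a3)) / (24 * ((a1 - a2) * (a1 - a3)))"
    unfolding \<rho>_def node_weight_def sd by (simp add: n l \<alpha>[unfolded One_nat_def] del: mult_pCons_left mult_pCons_right)
  have r2: "\<rho> 2 = (5 + (a1 + a3) + 23 * (a1 * a3)) / (24 * ((a2 - a1) * (a2 - a3)))"
    unfolding \<rho>_def node_weight_def sd by (simp add: n l \<alpha>[unfolded One_nat_def] del: mult_pCons_left mult_pCons_right)
  have r3: "\<rho> 3 = (5 + (a1 + a2) + 23 * (a1 * a2)) / (24 * ((a3 - a1) * (a3 - a2)))"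
    unfolding \<rho>_def node_weight_def sd by (simp add: n l \<alpha>[unfolded One_nat_def] del: mult_pCons_left mult_pCons_right)
  have rb1: "138436/1000000 < \<rho> 1 \<and> \<rho> 1 < 138437/1000000" unfolding r1
    by (rule divide_bounds(1); rule appr_pos, (rule a1(2) a2(2) a3(2) appr_intros)+, simp)
  have rb2: "433999/1000000 < \<rho> 2 \<and> \<rho> 2 < 434/1000" unfolding r2
    by (rule divide_bounds(2); rule appr_pos, (rule a1(2) a2(2) a3(2) appr_intros)+, simp)
  have rb3: "385897/1000000 < \<rho> 3 \<and> \<rho> 3 < 385898/1000000" unfolding r3
    by (rule divide_bounds(1); rule appr_pos, (rule a1(2) a2(2) a3(2) appr_intros)+, simp)
  have ab: "-817353/1000000 < \<alpha> 1 \<and> \<alpha> 1 < -817352/1000000" "-257598/1000000 < \<alpha> 2 \<and> \<alpha> 2 < -257597/1000000"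
    "47495/100000 < \<alpha> 3 \<and> \<alpha> 3 < 47496/100000"
    using a1(2) a2(2) a3(2) unfolding \<alpha> appr_def by (simp_all only: abs_le_iff) linarith+
  have "quadrature_rule 4 24 (poly ` polys_upto 5) 3 \<alpha> \<rho>"
    unfolding quadrature_rule_4_24_iff using mono exact rb1 rb2 rb3 ab
    unfolding s by (auto simp: polys_upto_def)
  then show thesis using that ab rb1 rb2 rb3 by blast
qed

section \<open>Double roots, closure properties of \<open>Lambda43\<close>, signs of Newton
  polynomials\<close>

lemma double_root_dvd:
  fixes p :: "real poly"
  assumes "poly p x = 0" "poly (pderiv p) x = 0"
  obtains q where "p = [:- x, 1:] * [:- x, 1:] * q"
proof -
  obtain r where r: "p = [:- x, 1:] * r" using assms(1) by (auto simp: poly_eq_0_iff_dvd)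
  then have "poly r x = 0" using assms(2) unfolding r pderiv_mult by (simp add: pderiv_pCons)
  then obtain q where "r = [:- x, 1:] * q" by (auto simp: poly_eq_0_iff_dvd)
  then show thesis using that r by (simp only: mult.assoc)
qed

lemma double_root_factor:
  fixes q :: "real poly"
  assumes "poly ([:- x, 1:] * [:- x, 1:] * q) y = 0" "poly (pderiv ([:- x, 1:] * [:- x, 1:] * q)) y = 0" "x \<noteq> y"
  shows "poly q y = 0" "poly (pderiv q) y = 0"
proof -
  show q: "poly q y = 0" using assms(1,3) by (simp del: mult_pCons_left mult_pCons_right)
  show "poly (pderiv q) y = 0"
    using assms(2,3) q by (simp add: pderiv_mult pderiv_pCons del: mult_pCons_left mult_pCons_right)
qed

lemma Lambda43_add: "p \<in> Lambda43 \<Longrightarrow> q \<in> Lambda43 \<Longrightarrow> p + q \<in> Lambda43"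
  and Lambda43_diff: "p \<in> Lambda43 \<Longrightarrow> q \<in> Lambda43 \<Longrightarrow> p - q \<in> Lambda43"
  and Lambda43_smult: "p \<in> Lambda43 \<Longrightarrow> smult x p \<in> Lambda43"
  by (auto simp: Lambda43_iff intro: degree_add_le degree_diff_le order.trans[OF degree_smult_le])

lemma Lambda43_0: "0 \<in> Lambda43" by (simp add: Lambda43_iff)

lemma Lambda43_sum: "(\<And>i. i \<in> A \<Longrightarrow> f i \<in> Lambda43) \<Longrightarrow> sum f A \<in> Lambda43"
  by (induction A rule: infinite_finite_induct) (auto intro: Lambda43_add Lambda43_0)

lemma continuous_subspace_Lambda43: "continuous_subspace (poly ` Lambda43)"
  unfolding continuous_subspace_def
proof (intro conjI ballI allI)
  show "(\<lambda>t. 0) \<in> poly ` Lambda43" using Lambda43_0 by (intro image_eqI[of _ _ 0]) auto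
next
  fix f g assume "f \<in> poly ` Lambda43" "g \<in> poly ` Lambda43"
  then obtain p q where "f = poly p" "g = poly q" "p \<in> Lambda43" "q \<in> Lambda43" by auto
  then show "(\<lambda>t. f t + g t) \<in> poly ` Lambda43"
    by (intro image_eqI[of _ _ "p + q"]) (auto intro: Lambda43_add)
next
  fix f x assume "f \<in> poly ` Lambda43"
  then obtain p where "f = poly p" "p \<in> Lambda43" by auto
  then show "(\<lambda>t. x * f t) \<in> poly ` Lambda43"
    by (intro image_eqI[of _ _ "smult x p"]) (auto intro: Lambda43_smult)
qed (auto intro!: continuous_intros)

lemma newton_poly_0 [simp]: "newton_poly xs 0 = 1"
  and newton_poly_Suc: "newton_poly xs (Suc j) = newton_poly xs j * [:- (xs ! j), 1:]"
  unfolding newton_poly_def by (simp_all add: lessThan_Suc mult.commute)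

lemma degree_newton_poly: "degree (newton_poly xs j) = j"
  unfolding newton_poly_def by (subst degree_prod_eq_sum_degree) auto

text \<open>Multiplication by \<open>t\<close> preserves nonnegative Chebyshev coefficients, and so
  does multiplication by \<open>- x\<close>. It applies to the nodes \<open>b1, b2, b3\<close>,
  which are negative, and handles the Newton polynomials of degree below 6.\<close>

lemma ccoef_mult_linear_nonneg:
  assumes "\<And>i. 0 \<le> ccoef p i" "x \<le> 0" shows "0 \<le> ccoef (p * [:- x, 1:]) i"
proof -
  have "p * [:- x, 1:] = smult (- x) p + [:0, 1:] * p" by simp
  then have "ccoef (p * [:- x, 1:]) i = - x * ccoef p i + ccoef ([:0, 1:] * p) i" by (simp only: ccoef_linear)
  moreover have "0 \<le> - x * ccoef p i" using assms by (intro mult_nonneg_nonneg) auto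
  moreover have "0 \<le> ccoef ([:0, 1:] * p) i"
    by (cases i) (simp_all only: ccoef_X_mult, simp_all add: assms)
  ultimately show ?thesis by simp
qed

lemma ccoef_newton_poly_nonneg:
  assumes "\<And>i. i < j \<Longrightarrow> xs ! i \<le> 0" shows "0 \<le> ccoef (newton_poly xs j) i"
  using assms
proof (induction j arbitrary: i)
  case 0 then show ?case by (simp add: ccoef_1)
next
  case (Suc j)
  then show ?case unfolding newton_poly_Suc by (intro ccoef_mult_linear_nonneg) auto
qed

lemma quadrature_bound_eq:
  assumes "\<And>i. i \<in> {1..m} \<Longrightarrow> h (x i) = ereal (g (x i))"
  shows "quadrature_bound 24 m x y h = ereal (24\<^sup>2 * (\<Sum>i=1..m. y i * g (x i)))"
proof -
  have "(\<Sum>i=1..m. ereal (y i) * h (x i)) = (\<Sum>i=1..m. ereal (y i * g (x i)))"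
    using assms by (intro sum.cong) auto
  then show ?thesis by (simp add: quadrature_bound_def)
qed

context second_level
begin

lemma newton_poly_beta:
  defines "xs \<equiv> [b1, b1, b2, b2, b3, b3, b4, b4]"
  shows "newton_poly xs 6 = cub * cub" "newton_poly xs 7 = cub * cub * [:- b4, 1:]" "newton_poly xs 8 = w * w"
  unfolding w_eq cub_eq xs_def
  by (simp_all add: numeral_eq_Suc newton_poly_Suc mult_ac del: mult_pCons_left mult_pCons_right)

text \<open>Correcting the Newton polynomials of degrees 6 and 7 only moves linear multiples of
  \<open>w * w\<close> into the remainder. These are nonnegative on [-1, 1], so \<open>s\<close>
  keeps its sign and its differentiability.\<close>

lemma hermite_decomposition:
  assumes "amon g"
  obtains f s where "f \<in> Lambda43" "\<And>i. 1 \<le> i \<Longrightarrow> 0 \<le> ccoef f i"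
    "\<And>t. t \<in> {-1..<1} \<Longrightarrow> g t = poly f t + s t * (poly w t)\<^sup>2"
    "\<And>t. t \<in> {-1..<1} \<Longrightarrow> 0 \<le> s t"
    "\<And>t. t \<in> {-1<..<1} \<Longrightarrow> \<exists>s'. (s has_real_derivative s') (at t)"
proof -
  let ?xs = "[b1, b1, b2, b2, b3, b3, b4, b4]"
  let ?N = "newton_poly ?xs"
  have "set ?xs \<subseteq> {-1..<1}" using beta_order by auto
  from amon_newton_expansion[OF assms this] obtain c r where c: "\<forall>j. 0 \<le> c j" and r: "amon r" and
    g: "\<forall>t\<in>{-1..<1}. g t = (\<Sum>j<length ?xs. c j * poly (?N j) t) + r t * poly (?N (length ?xs)) t"
    by (elim exE conjE)
  note cr = c[rule_format] r
  obtain p6 q6 p7 q7 where co: "\<And>t. t \<in> {-1..1} \<Longrightarrow> 0 \<le> p6 + q6 * t" "\<And>t. t \<in> {-1..1} \<Longrightarrow> 0 \<le> p7 + q7 * t"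
    "cub * cub - [:p6, q6:] * (w * w) \<in> Lambda43" "cub * cub * [:- b4, 1:] - [:p7, q7:] * (w * w) \<in> Lambda43"
    "\<And>i. 1 \<le> i \<Longrightarrow> 0 \<le> ccoef (cub * cub - [:p6, q6:] * (w * w)) i"
    "\<And>i. 1 \<le> i \<Longrightarrow> 0 \<le> ccoef (cub * cub * [:- b4, 1:] - [:p7, q7:] * (w * w)) i"
    by (rule correctors) (rule that)
  define f where "f = (\<Sum>j<6. smult (c j) (?N j)) + smult (c 6) (cub * cub - [:p6, q6:] * (w * w))
      + smult (c 7) (cub * cub * [:- b4, 1:] - [:p7, q7:] * (w * w))"
  define s where "s t = r t + c 6 * (p6 + q6 * t) + c 7 * (p7 + q7 * t)" for t
  have neg: "?xs ! i \<le> 0" if "i < 6" for i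
  proof -
    have "b1 \<le> 0" "b2 \<le> 0" "b3 \<le> 0" using appr_b1 appr_b2 appr_b3 unfolding appr_def by linarith+
    moreover have "i = 0 \<or> i = 1 \<or> i = 2 \<or> i = 3 \<or> i = 4 \<or> i = 5" using that by arith
    ultimately show ?thesis by (elim disjE) simp_all
  qed
  show thesis
  proof (rule that)
    have "(\<Sum>j<6. smult (c j) (?N j)) \<in> Lambda43"
      using polys_upto_5_subset_Lambda43
      by (intro Lambda43_sum Lambda43_smult) (auto simp: polys_upto_def degree_newton_poly)
    then show "f \<in> Lambda43"
      unfolding f_def using co(3,4) by (intro Lambda43_add Lambda43_smult)
    show "0 \<le> ccoef f i" if "1 \<le> i" for i
      unfolding f_def ccoef_linear ccoef_sum
      using co(5,6)[OF that] cr(1) neg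
      by (intro add_nonneg_nonneg sum_nonneg mult_nonneg_nonneg ccoef_newton_poly_nonneg) auto
    show "0 \<le> s t" if "t \<in> {-1..<1}" for t
      unfolding s_def using that cr co(1,2)[of t] amon_nonneg[OF cr(2) that] by auto
    show "\<exists>s'. (s has_real_derivative s') (at t)" if t: "t \<in> {-1<..<1}" for t
    proof -
      obtain r' where "(r has_real_derivative r') (at t)" using amon_differentiable[OF cr(2) t] by blast
      then have "(s has_real_derivative r' + c 6 * q6 + c 7 * q7) (at t)"
        unfolding s_def by (auto intro!: derivative_eq_intros)
      then show ?thesis by blast
    qed
    show "g t = poly f t + s t * (poly w t)\<^sup>2" if t: "t \<in> {-1..<1}" for t
    proof -
      have "length ?xs = Suc (Suc 6)" by simp
      then have "g t = (\<Sum>j<6. c j * poly (?N j) t) + c 6 * poly (?N 6) t + c 7 * poly (?N 7) t + r t * poly (?N 8) t"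
        unfolding g[rule_format, OF t] by (simp only: sum.lessThan_Suc) simp
      also have "\<dots> = poly f t + s t * (poly w t)\<^sup>2"
        unfolding f_def s_def newton_poly_beta
        by (simp add: poly_sum power2_eq_square algebra_simps del: mult_pCons_left mult_pCons_right)
      finally show ?thesis .
    qed
  qed
qed

lemma ex_hermite:
  assumes h: "absolutely_monotone h"
  obtains f where "hermite_interpolant Lambda43 4 beta h f" "\<And>i. 1 \<le> i \<Longrightarrow> 0 \<le> ccoef f i"
    "\<And>t. t \<in> {-1..<1} \<Longrightarrow> ereal (poly f t) \<le> h t"
proof -
  obtain g where g: "amon g" "\<And>t. t \<in> {-1..<1} \<Longrightarrow> h t = ereal (g t)"
    using absolutely_monotone_amon[OF h] by blast
  obtain f s where f: "f \<in> Lambda43" "\<And>i. 1 \<le> i \<Longrightarrow> 0 \<le> ccoef f i"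
    and gf: "\<And>t. t \<in> {-1..<1} \<Longrightarrow> g t = poly f t + s t * (poly w t)\<^sup>2"
    and s: "\<And>t. t \<in> {-1..<1} \<Longrightarrow> 0 \<le> s t" "\<And>t. t \<in> {-1<..<1} \<Longrightarrow> \<exists>s'. (s has_real_derivative s') (at t)"
    using hermite_decomposition[OF g(1)] by blast
  have "hermite_interpolant Lambda43 4 beta h f"
    unfolding hermite_interpolant_def
  proof (intro conjI ballI f(1))
    fix i :: nat assume i: "i \<in> {1..4}"
    then have b: "beta i \<in> {-1<..<1}" and wb: "poly w (beta i) = 0" using beta_bounds w_beta by auto
    then show "ereal (poly f (beta i)) = h (beta i)" using g(2) gf by simp
    obtain s' where "(s has_real_derivative s') (at (beta i))" using s(2)[OF b] by blast
    \<comment> \<open>The error has the factor \<open>w^2\<close> with a double zero at each node;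
      differentiability of \<open>s\<close> makes its derivative vanish there.\<close>
    then have "((\<lambda>t. poly f t + s t * (poly w t)\<^sup>2) has_real_derivative poly (pderiv f) (beta i)) (at (beta i))"
      using wb by (auto intro!: derivative_eq_intros poly_DERIV)
    then have "((\<lambda>t. real_of_ereal (h t)) has_real_derivative poly (pderiv f) (beta i)) (at (beta i))"
      by (rule has_field_derivative_transform_within_open[of _ _ _ "{-1<..<1}"]) (use b g(2) gf in auto)
    then show "poly (pderiv f) (beta i) = deriv (\<lambda>t. real_of_ereal (h t)) (beta i)"
      by (simp add: DERIV_imp_deriv)
  qed
  moreover have "ereal (poly f t) \<le> h t" if "t \<in> {-1..<1}" for t
    using g(2)[OF that] gf[OF that] s(1)[OF that] by simp
  ultimately show thesis using that f(2) by blast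
qed

lemma w_sq_injective:
  assumes "ccoef ([:p, q:] * (w * w)) 6 = 0" "ccoef ([:p, q:] * (w * w)) 7 = 0"
  shows "p = 0 \<and> q = 0"
proof (rule correctors)
  assume "\<And>p q. ccoef ([:p, q:] * (w * w)) 6 = 0 \<Longrightarrow> ccoef ([:p, q:] * (w * w)) 7 = 0 \<Longrightarrow> p = 0 \<and> q = 0"
  from this[OF assms] show ?thesis .
qed

lemma hermite_exists: "absolutely_monotone h \<Longrightarrow> \<exists>f. hermite_interpolant Lambda43 4 beta h f"
  by (rule ex_hermite) (auto intro: exI)

text \<open>The difference has double zeros at all four nodes, so it is \<open>w * w\<close> times a
  cofactor, of degree at most 1 by the degree bound of \<open>Lambda43\<close>. The vanishing
  coefficients 6 and 7 then kill the cofactor.\<close>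

lemma hermite_unique:
  assumes f: "hermite_interpolant Lambda43 4 beta h f" and f': "hermite_interpolant Lambda43 4 beta h f'"
  shows "f = f'"
proof -
  define e where "e = f - f'"
  have e: "e \<in> Lambda43" using f f' unfolding e_def hermite_interpolant_def by (intro Lambda43_diff) auto
  have eb: "poly e (beta i) = 0 \<and> poly (pderiv e) (beta i) = 0" if "i \<in> {1..4}" for i
  proof -
    have "ereal (poly f (beta i)) = ereal (poly f' (beta i))" "poly (pderiv f) (beta i) = poly (pderiv f') (beta i)"
      using f f' that unfolding hermite_interpolant_def by metis+
    then show ?thesis by (simp add: e_def pderiv_diff)
  qed
  then have z: "poly e b1 = 0" "poly (pderiv e) b1 = 0" "poly e b2 = 0" "poly (pderiv e) b2 = 0"
    "poly e b3 = 0" "poly (pderiv e) b3 = 0" "poly e b4 = 0" "poly (pderiv e) b4 = 0"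
    using eb[of 1] eb[of 2] eb[of 3] eb[of 4] by auto
  have ne: "b1 \<noteq> b2" "b1 \<noteq> b3" "b1 \<noteq> b4" "b2 \<noteq> b3" "b2 \<noteq> b4" "b3 \<noteq> b4" using beta_order by auto
  obtain e1 where e1: "e = [:- b1, 1:] * [:- b1, 1:] * e1" using double_root_dvd[OF z(1,2)] .
  note z1 = double_root_factor[OF z(3,4)[unfolded e1] ne(1)] double_root_factor[OF z(5,6)[unfolded e1] ne(2)]
    double_root_factor[OF z(7,8)[unfolded e1] ne(3)]
  obtain e2 where e2: "e1 = [:- b2, 1:] * [:- b2, 1:] * e2" using double_root_dvd[OF z1(1,2)] .
  note z2 = double_root_factor[OF z1(3,4)[unfolded e2] ne(4)] double_root_factor[OF z1(5,6)[unfolded e2] ne(5)]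
  obtain e3 where e3: "e2 = [:- b3, 1:] * [:- b3, 1:] * e3" using double_root_dvd[OF z2(1,2)] .
  note z3 = double_root_factor[OF z2(3,4)[unfolded e3] ne(6)]
  obtain e4 where e4: "e3 = [:- b4, 1:] * [:- b4, 1:] * e4" using double_root_dvd[OF z3] .
  have ew: "e = e4 * (w * w)"
    unfolding e1 e2 e3 e4 w_eq cub_eq by (simp only: mult_ac)
  have "degree e4 \<le> 1"
  proof (cases "e4 = 0")
    case False
    have "w \<noteq> 0" "degree w = 4" by (simp_all add: w_def)
    then have "degree e = degree e4 + 8" unfolding ew using False by (simp add: degree_mult_eq)
    then show ?thesis using e unfolding Lambda43_iff by simp
  qed simp
  then have e4': "e4 = [:coeff e4 0, coeff e4 1:]"
    by (intro poly_eqI) (auto simp: coeff_pCons coeff_eq_0 split: nat.split)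
  have "ccoef ([:coeff e4 0, coeff e4 1:] * (w * w)) 6 = 0" "ccoef ([:coeff e4 0, coeff e4 1:] * (w * w)) 7 = 0"
    using e unfolding Lambda43_iff ew e4'[symmetric] by auto
  then have "coeff e4 0 = 0 \<and> coeff e4 1 = 0" by (rule w_sq_injective)
  then have "e4 = 0" by (subst e4') simp
  then show ?thesis using ew by (simp add: e_def)
qed

lemma hermite_properties:
  assumes h: "absolutely_monotone h" and f: "hermite_interpolant Lambda43 4 beta h f"
  shows "f \<in> Lambda43" "\<And>i. 1 \<le> i \<Longrightarrow> 0 \<le> ccoef f i" "\<And>t. t \<in> {-1..1} \<Longrightarrow> ereal (poly f t) \<le> h t"
    "poly f \<in> A_class 4 h" "\<And>i. i \<in> {1..4} \<Longrightarrow> h (beta i) = ereal (poly f (beta i))"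
proof -
  obtain f' where f': "hermite_interpolant Lambda43 4 beta h f'" "\<And>i. 1 \<le> i \<Longrightarrow> 0 \<le> ccoef f' i"
    "\<And>t. t \<in> {-1..<1} \<Longrightarrow> ereal (poly f' t) \<le> h t"
    using ex_hermite[OF h] by blast
  have ff: "f' = f" by (rule hermite_unique[OF f'(1) f])
  show "f \<in> Lambda43" "\<And>i. i \<in> {1..4} \<Longrightarrow> h (beta i) = ereal (poly f (beta i))"
    using f unfolding hermite_interpolant_def by auto
  show c: "0 \<le> ccoef f i" if "1 \<le> i" for i using f'(2)[OF that] ff by simp
  show le: "ereal (poly f t) \<le> h t" if "t \<in> {-1..1}" for t
    using absolutely_monotone_le_at_1[OF h f'(3) that] ff by simp
  show "poly f \<in> A_class 4 h" by (rule poly_in_A_class_4[OF c le])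
qed

section \<open>Energy bound, LP optimality and comparison with the first level\<close>

lemma quadrature_bound_beta:
  assumes "absolutely_monotone h" "hermite_interpolant Lambda43 4 beta h f"
  shows "quadrature_bound 24 4 beta theta h = ereal (24\<^sup>2 * lfun f)"
  using quadrature_bound_eq[of 4 h beta "poly f" theta] hermite_properties[OF assms] lfun_eq_quad[of f]
  by (simp del: sum.cl_ivl_Suc)

lemma quadrature_bound_le_min_energy4:
  assumes h: "absolutely_monotone h" shows "quadrature_bound 24 4 beta theta h \<le> min_energy4 h 24"
proof -
  obtain f where f: "hermite_interpolant Lambda43 4 beta h f" using hermite_exists[OF h] by blast
  note p = hermite_properties[OF h f]
  show ?thesis unfolding quadrature_bound_beta[OF h f]
    using p by (intro lfun_le_min_energy4) (auto simp: Lambda43_iff)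
qed

text \<open>For a feasible \<open>p\<close> of any degree, weak duality bounds \<open>lfun p\<close>
  by the node sum of \<open>p\<close>. At the nodes \<open>p\<close> lies below \<open>h\<close>,
  where \<open>h\<close> equals \<open>f\<close>, and the rule is exact for
  \<open>f\<close>.\<close>

lemma LP_optimal_hermite:
  assumes h: "absolutely_monotone h" and f: "hermite_interpolant Lambda43 4 beta h f"
  shows "LP_optimal 4 24 h f"
proof -
  note pf = hermite_properties[OF h f]
  have Q: "0 \<le> test_function 4 24 4 beta theta j" if "1 \<le> j" for j
    using test_function_eq_0[of j] test_function_pos[of j] by (cases "j \<in> {1, 2, 3, 4, 5, 8, 9}") auto
  have "lfun p \<le> lfun f" if p: "poly p \<in> A_class 4 h" for p
  proof -
    have "lfun p \<le> quad p"
      by (rule lfun_le_quadrature_sum[OF p sum_theta Q]) (use beta_bounds in \<open>auto intro: less_imp_le\<close>)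
    also have "\<dots> \<le> quad f"
    proof (intro sum_mono mult_left_mono)
      fix i :: nat assume i: "i \<in> {1..4}"
      have "ereal (poly p (beta i)) \<le> h (beta i)"
        using p beta_bounds[OF i] unfolding A_class_def by auto
      then show "poly p (beta i) \<le> poly f (beta i)" using pf(5)[OF i] by simp
      show "0 \<le> theta i" using theta_pos[OF i] by simp
    qed
    also have "\<dots> = lfun f" using lfun_eq_quad[OF pf(1)] by simp
    finally show ?thesis .
  qed
  then have "\<not> 24\<^sup>2 * lfun f < 24\<^sup>2 * lfun p" if "poly p \<in> A_class 4 h" for p
    using that by (simp add: not_less)
  moreover have "(real 24)\<^sup>2 * (mean 4 (poly p) - poly p 1 / real 24) = 24\<^sup>2 * lfun p" for p
    by (simp add: lfun_def pmean_def)
  ultimately show ?thesis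
    unfolding LP_optimal_def is_arg_max_def using pf(4) by auto
qed

lemma ULB_space_Lambda43: "ULB_space 4 24 (poly ` Lambda43)"
  unfolding ULB_space_def
proof (intro conjI exI allI impI)
  show "continuous_subspace (poly ` Lambda43)" by (rule continuous_subspace_Lambda43)
  show "quadrature_rule 4 24 (poly ` Lambda43) 4 beta theta" by (rule quadrature_rule_beta)
  fix h assume h: "absolutely_monotone h"
  obtain f where "hermite_interpolant Lambda43 4 beta h f" using hermite_exists[OF h] by blast
  note p = hermite_properties[OF h this]
  show "\<exists>f\<in>poly ` Lambda43 \<inter> A_class 4 h. \<forall>i\<in>{1..4}. ereal (f (beta i)) = h (beta i)"
    using p by (intro bexI[of _ "poly f"]) auto
qed

text \<open>Both rules integrate the interpolant of degree 5 at the Levenshtein nodes exactly, so the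
  difference of the two bounds is the value of the rule at \<open>beta\<close> on the interpolation error.\<close>

lemma levenshtein_compare:
  assumes rule: "quadrature_rule 4 24 (poly ` polys_upto 5) 3 \<alpha> \<rho>" and \<alpha>3: "\<alpha> 3 < b4"
    and h: "absolutely_monotone h"
  shows "quadrature_bound 24 3 \<alpha> \<rho> h \<le> quadrature_bound 24 4 beta theta h"
    and "\<not> (\<exists>q\<in>polys_upto 5. \<forall>t\<in>{-1..<1}. h t = ereal (poly q t)) \<Longrightarrow>
      quadrature_bound 24 3 \<alpha> \<rho> h < quadrature_bound 24 4 beta theta h"
proof -
  have s: "{1..3::nat} = {1, 2, 3}" by auto
  have \<alpha>: "\<alpha> i \<in> {-1..<1}" "\<alpha> i < b4" if "i \<in> {1..3}" for i
  proof -
    show "\<alpha> i \<in> {-1..<1}" using rule that unfolding quadrature_rule_def by auto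
    have "\<alpha> i \<le> \<alpha> 3" using rule that unfolding quadrature_rule_def strict_mono_on_def
      by (cases "i = 3") (auto intro: less_imp_le)
    then show "\<alpha> i < b4" using \<alpha>3 by simp
  qed
  obtain g where g: "amon g" "\<And>t. t \<in> {-1..<1} \<Longrightarrow> h t = ereal (g t)"
    using absolutely_monotone_amon[OF h] by blast
  define xs where "xs = [\<alpha> 1, \<alpha> 1, \<alpha> 2, \<alpha> 2, \<alpha> 3, \<alpha> 3]"
  have "set xs \<subseteq> {-1..<1}" using \<alpha>(1)[of 1] \<alpha>(1)[of 2] \<alpha>(1)[of 3] by (auto simp: xs_def)
  from amon_newton_expansion[OF g(1) this] obtain c r where c: "\<forall>j. 0 \<le> c j" and r: "amon r" and
    gx: "\<forall>t\<in>{-1..<1}. g t = (\<Sum>j<length xs. c j * poly (newton_poly xs j) t) + r t * poly (newton_poly xs (length xs)) t"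
    by (elim exE conjE)
  note cr = c[rule_format] r
  define f where "f = (\<Sum>j<6. smult (c j) (newton_poly xs j))"
  define v where "v t = (t - \<alpha> 1) * (t - \<alpha> 2) * (t - \<alpha> 3)" for t
  have len: "length xs = 6" by (simp add: xs_def)
  have n6: "poly (newton_poly xs 6) t = (v t)\<^sup>2" for t
    by (simp add: xs_def v_def numeral_eq_Suc newton_poly_Suc mult_ac del: mult_pCons_left mult_pCons_right)
  have gf: "g t = poly f t + r t * (v t)\<^sup>2" if "t \<in> {-1..<1}" for t
    unfolding gx[rule_format, OF that] len n6 by (simp add: f_def poly_sum)
  have f: "f \<in> polys_upto 5" unfolding f_def polys_upto_def mem_Collect_eq
    by (intro degree_sum_le order.trans[OF degree_smult_le]) (auto simp: degree_newton_poly)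
  have R: "quadrature_bound 24 3 \<alpha> \<rho> h = ereal (24\<^sup>2 * lfun f)"
  proof -
    have "h (\<alpha> i) = ereal (poly f (\<alpha> i))" if "i \<in> {1..3}" for i
      using g(2)[OF \<alpha>(1)[OF that]] gf[OF \<alpha>(1)[OF that]] that unfolding s by (auto simp: v_def)
    moreover have "lfun f = (\<Sum>i=1..3. \<rho> i * poly f (\<alpha> i))"
      using rule f unfolding quadrature_rule_4_24_iff by blast
    ultimately show ?thesis using quadrature_bound_eq[of 3 h \<alpha> "poly f" \<rho>] by simp
  qed
  define err where "err = (\<Sum>i=1..4. theta i * (r (beta i) * (v (beta i))\<^sup>2))"
  have bI: "beta i \<in> {-1..<1}" if "i \<in> {1..4}" for i using beta_bounds[OF that] by auto
  have terms: "0 \<le> theta i * (r (beta i) * (v (beta i))\<^sup>2)" if "i \<in> {1..4}" for i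
    using theta_pos[OF that] amon_nonneg[OF cr(2) bI[OF that]] by simp
  have S: "quadrature_bound 24 4 beta theta h = ereal (24\<^sup>2 * (lfun f + err))"
  proof -
    have "(\<Sum>i=1..4. theta i * g (beta i)) = (\<Sum>i=1..4. theta i * poly f (beta i) + theta i * (r (beta i) * (v (beta i))\<^sup>2))"
      by (intro sum.cong refl) (simp only: gf[OF bI] distrib_left)
    also have "\<dots> = quad f + err" unfolding err_def by (rule sum.distrib)
    also have "quad f = lfun f" using f polys_upto_5_subset_Lambda43 lfun_eq_quad by auto
    finally show ?thesis using quadrature_bound_eq[of 4 h beta g theta] g(2)[OF bI] by simp
  qed
  have err: "0 \<le> err" unfolding err_def by (intro sum_nonneg terms)
  then show "quadrature_bound 24 3 \<alpha> \<rho> h \<le> quadrature_bound 24 4 beta theta h" unfolding R S by simp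
  assume np: "\<not> (\<exists>q\<in>polys_upto 5. \<forall>t\<in>{-1..<1}. h t = ereal (poly q t))"
  have "err \<noteq> 0"
  proof
    assume "err = 0"
    then have "\<forall>i\<in>{1..4}. theta i * (r (beta i) * (v (beta i))\<^sup>2) = 0"
      unfolding err_def using terms by (subst (asm) sum_nonneg_eq_0_iff) auto
    \<comment> \<open>The last node suffices: \<open>b4\<close> exceeds all Levenshtein nodes, so
      \<open>v b4\<close> is nonzero, and \<open>r b4 = 0\<close> forces \<open>r = 0\<close> by
      \<open>amon_eq_0\<close>, making \<open>h\<close> a polynomial of degree at most 5 on [-1,
      1).\<close>
    then have "theta 4 * (r b4 * (v b4)\<^sup>2) = 0" by (force dest: bspec[of _ _ 4])
    moreover have "0 < theta 4" by (rule theta_pos) simp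
    moreover have "v b4 \<noteq> 0" unfolding v_def using \<alpha>(2)[of 1] \<alpha>(2)[of 2] \<alpha>(2)[of 3] by simp
    ultimately have "r b4 = 0" by simp
    then have "r t = 0" if "t \<in> {-1..<1}" for t
      using amon_eq_0[OF cr(2) _ _ that, of b4] beta_order by auto
    then have "\<forall>t\<in>{-1..<1}. h t = ereal (poly f t)" using g(2) gf by simp
    then show False using np f by blast
  qed
  then show "quadrature_bound 24 3 \<alpha> \<rho> h < quadrature_bound 24 4 beta theta h"
    using err unfolding R S by simp
qed

end

theorem theorem4p1:
  shows "\<exists>(\<beta> :: nat \<Rightarrow> real) (\<theta> :: nat \<Rightarrow> real) (\<alpha> :: nat \<Rightarrow> real) (\<rho> :: nat \<Rightarrow> real).
    \<beta> 1 \<in> {-0.86030<..-0.86029} \<and> \<beta> 2 \<in> {-0.48985<..-0.48984} \<and>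
    \<beta> 3 \<in> {-0.19573<..-0.19572} \<and> \<beta> 4 \<in> {0.478545..<0.478546} \<and>
    \<theta> 1 \<in> {0.09960..<0.09961} \<and> \<theta> 2 \<in> {0.14653..<0.14654} \<and>
    \<theta> 3 \<in> {0.33372..<0.33373} \<and> \<theta> 4 \<in> {0.37847..<0.37848} \<and>
    quadrature_rule 4 24 (poly ` Lambda43) 4 \<beta> \<theta> \<and>
    \<comment> \<open>the Levenshtein rule\<close>
    \<alpha> 1 \<in> {-0.817353<..-0.817352} \<and> \<alpha> 2 \<in> {-0.257598<..-0.257597} \<and>
    \<alpha> 3 \<in> {0.47495..<0.47496} \<and>
    \<rho> 1 \<in> {0.138436..<0.138437} \<and> \<rho> 2 \<in> {0.433999..<0.434} \<and>
    \<rho> 3 \<in> {0.385897..<0.385898} \<and>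
    quadrature_rule 4 24 (poly ` polys_upto 5) 3 \<alpha> \<rho> \<and>
    \<comment> \<open>(1)\<close>
    (\<forall>h. absolutely_monotone h \<longrightarrow>
       (\<exists>!f. hermite_interpolant Lambda43 4 \<beta> h f) \<and>
       (\<forall>f. hermite_interpolant Lambda43 4 \<beta> h f \<longrightarrow> poly f \<in> poly ` Lambda43 \<inter> A_class 4 h)) \<and>
    ULB_space 4 24 (poly ` Lambda43) \<and>
    \<comment> \<open>(2); for polynomials of degree at most 5 both bounds coincide\<close>
    (\<forall>h. absolutely_monotone h \<longrightarrow>
       min_energy4 h 24 \<ge> quadrature_bound 24 4 \<beta> \<theta> h \<and>
       min_energy4 h 24 \<ge> quadrature_bound 24 3 \<alpha> \<rho> h \<and>
       quadrature_bound 24 4 \<beta> \<theta> h \<ge> quadrature_bound 24 3 \<alpha> \<rho> h \<and>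
       (\<not> (\<exists>q\<in>polys_upto 5. \<forall>t\<in>{-1..<1}. h t = ereal (poly q t)) \<longrightarrow>
          quadrature_bound 24 4 \<beta> \<theta> h > quadrature_bound 24 3 \<alpha> \<rho> h)) \<and>
    \<comment> \<open>(3)\<close>
    (\<forall>j. j \<notin> {1, 2, 3, 4, 5, 8, 9} \<longrightarrow> test_function 4 24 4 \<beta> \<theta> j > 0) \<and>
    (\<forall>h. absolutely_monotone h \<longrightarrow>
       (\<forall>f. hermite_interpolant Lambda43 4 \<beta> h f \<longrightarrow> LP_optimal 4 24 h f))"
proof -
  obtain b1 b2 b3 b4 b d where "second_level b1 b2 b3 b4 b d" using ex_second_level by blast
  then interpret second_level b1 b2 b3 b4 b d .
  obtain \<alpha> \<rho> where \<alpha>: "-817353/1000000 < \<alpha> 1 \<and> \<alpha> 1 < -817352/1000000"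
    "-257598/1000000 < \<alpha> 2 \<and> \<alpha> 2 < -257597/1000000" "47495/100000 < \<alpha> 3 \<and> \<alpha> 3 < 47496/100000"
    and \<rho>: "138436/1000000 < \<rho> 1 \<and> \<rho> 1 < 138437/1000000" "433999/1000000 < \<rho> 2 \<and> \<rho> 2 < 434/1000"
    "385897/1000000 < \<rho> 3 \<and> \<rho> 3 < 385898/1000000"
    and lev: "quadrature_rule 4 24 (poly ` polys_upto 5) 3 \<alpha> \<rho>"
    by (rule ex_levenshtein)
  have \<beta>: "-86030/100000 < beta 1 \<and> beta 1 \<le> -86029/100000" "-48985/100000 < beta 2 \<and> beta 2 \<le> -48984/100000"
    "-19573/100000 < beta 3 \<and> beta 3 \<le> -19572/100000" "478545/1000000 \<le> beta 4 \<and> beta 4 < 478546/1000000"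
    using appr_b1 appr_b2 appr_b3 appr_b4 unfolding beta_simps appr_def by linarith+
  have \<alpha>3: "\<alpha> 3 < b4" using \<alpha>(3) \<beta>(4) by simp
  note cmp = levenshtein_compare[OF lev \<alpha>3]
  have herm: "(\<exists>!f. hermite_interpolant Lambda43 4 beta h f) \<and>
      (\<forall>f. hermite_interpolant Lambda43 4 beta h f \<longrightarrow> poly f \<in> poly ` Lambda43 \<inter> A_class 4 h)"
    if "absolutely_monotone h" for h
    using hermite_exists[OF that] hermite_unique hermite_properties(1,4)[OF that] by blast
  show ?thesis
  proof (rule exI[of _ beta], rule exI[of _ theta], rule exI[of _ \<alpha>], rule exI[of _ \<rho>], intro conjI)
    show "\<forall>h. absolutely_monotone h \<longrightarrow> (\<exists>!f. hermite_interpolant Lambda43 4 beta h f) \<and>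
      (\<forall>f. hermite_interpolant Lambda43 4 beta h f \<longrightarrow> poly f \<in> poly ` Lambda43 \<inter> A_class 4 h)"
      using herm by blast
    show "\<forall>h. absolutely_monotone h \<longrightarrow>
       min_energy4 h 24 \<ge> quadrature_bound 24 4 beta theta h \<and>
       min_energy4 h 24 \<ge> quadrature_bound 24 3 \<alpha> \<rho> h \<and>
       quadrature_bound 24 4 beta theta h \<ge> quadrature_bound 24 3 \<alpha> \<rho> h \<and>
       (\<not> (\<exists>q\<in>polys_upto 5. \<forall>t\<in>{-1..<1}. h t = ereal (poly q t)) \<longrightarrow>
          quadrature_bound 24 4 beta theta h > quadrature_bound 24 3 \<alpha> \<rho> h)"
      using quadrature_bound_le_min_energy4 cmp by (meson order.trans)
    show "\<forall>j. j \<notin> {1, 2, 3, 4, 5, 8, 9} \<longrightarrow> test_function 4 24 4 beta theta j > 0"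
      using test_function_pos by blast
    show "\<forall>h. absolutely_monotone h \<longrightarrow> (\<forall>f. hermite_interpolant Lambda43 4 beta h f \<longrightarrow> LP_optimal 4 24 h f)"
      using LP_optimal_hermite by blast
    show "quadrature_rule 4 24 (poly ` Lambda43) 4 beta theta" by (rule quadrature_rule_beta)
    show "quadrature_rule 4 24 (poly ` polys_upto 5) 3 \<alpha> \<rho>" by (rule lev)
    show "ULB_space 4 24 (poly ` Lambda43)" by (rule ULB_space_Lambda43)
  qed (use \<alpha> \<rho> \<beta> theta_bounds in \<open>simp_all add: less_imp_le\<close>)
qed

end
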